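(* Let $n=3$, $1<p<3$, and let $$F_p(u)=\left(\sinh^{-1}\frac{1}{|u|}\right)^{-(p-1)}|u|\quad (u\ne0),\qquad F_p(0)=0,$$ where $\sinh^{-1}$ denotes the inverse hyperbolic sine. Consider the Cauchy problem $$\begin{cases}\partial_t^2u-(\Delta_{\mathbb{H}^3}+1)u=F_p(u),\\ u(0,x)=\varepsilon u_0(x),\quad u_t(0,x)=\varepsilon u_1(x),\end{cases}$$ with compactly supported data $(u_0,u_1)\in C^1_c(\mathbb{H}^3)\times C_c(\mathbb{H}^3)$. Then the only global solution is the trivial solution. In other words, for any nontrivial data $(u_0,u_1)\in C_c^1(\mathbb{H}^3)\times C_c(\mathbb{H}^3)$, $(u_0,u_1)\neq(0,0)$, and any $\varepsilon>0$, the corresponding weak solution blows up in finite time; that is, there is no weak solution $u\in C([0,\infty)\times\mathbb{H}^3)$.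
   Context: $\mathbb{H}^3$ is hyperbolic $3$-space (constant curvature $-1$); in geodesic polar coordinates $(r,\omega)\in(0,\infty)\times\mathbb{S}^2$ about a fixed origin its metric is $dr^2+(\sinh r)^2d\omega^2$. $\Delta_{\mathbb{H}^3}$ is the Laplace–Beltrami operator and $d(x,y)$ the geodesic distance. All functions are real-valued. For $r>0$, $M^rf(x)$ is the average of $f$ over the geodesic sphere $\{y:d(x,y)=r\}$ with respect to the induced surface measure, and $M^0f(x)=f(x)$. For continuous $g$ on $\mathbb{H}^3$ and $t\ge0$ put $I(t,x,g)=\sinh t\,(M^tg)(x)$; this is the solution of $\partial_t^2w-(\Delta_{\mathbb{H}^3}+1)w=0$ with $w(0)=0$, $w_t(0)=g$. A weak solution of the Cauchy problem on $[0,T]$ (respectively on $[0,\infty)$, in which case it is called global) is a function $u$, continuous on $[0,T]\times\mathbb{H}^3$ (respectively $[0,\infty)\times\mathbb{H}^3$), satisfying there the integral (Duhamel) equation $$u(t,x)=\varepsilon\big(\partial_tI(t,x,u_0)+I(t,x,u_1)\big)+\int_0^tI\big(\tau,x,F_p(u(t-\tau,\cdot))\big)\,d\tau .$$ *)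

theory Defs
  imports "HOL-Analysis.Analysis"
begin

section \<open>Hyperbolic 3-space (hyperboloid model)\<close>

type_synonym mpoint = "real \<times> (real ^ 3)"

definition mink :: "mpoint \<Rightarrow> mpoint \<Rightarrow> real" where
  "mink x y = snd x \<bullet> snd y - fst x * fst y"

text \<open>The Riemannian metric of the hyperboloid is the restriction of the Minkowski form
  \<open>mink\<close> to its tangent spaces; its topology is the subspace topology.\<close>

definition H3 :: "mpoint set" where
  "H3 = {x. mink x x = - 1 \<and> fst x > 0}"

definition hdist :: "mpoint \<Rightarrow> mpoint \<Rightarrow> real" where
  "hdist x y = arcosh (- mink x y)"

definition geodesic_sphere :: "mpoint \<Rightarrow> real \<Rightarrow> mpoint set" where
  "geodesic_sphere x r = {y \<in> H3. hdist x y = r}"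

section \<open>Geodesic polar coordinates and surface measure of geodesic spheres\<close>

text \<open>The Lorentz boost taking the origin \<open>(1, 0)\<close> to \<open>x\<close>, restricted to the tangent space
  at the origin: a linear isometry of \<open>\<real>\<^sup>3\<close> onto the tangent space of \<open>H3\<close> at \<open>x\<close>.\<close>

definition boost :: "mpoint \<Rightarrow> real ^ 3 \<Rightarrow> mpoint" where
  "boost x v = (snd x \<bullet> v, v + ((snd x \<bullet> v) / (1 + fst x)) *\<^sub>R snd x)"

text \<open>The endpoint of the geodesic of length \<open>r\<close> from \<open>x\<close> in the direction \<open>boost x \<omega>\<close>.\<close>

definition hpolar :: "mpoint \<Rightarrow> real \<Rightarrow> real ^ 3 \<Rightarrow> mpoint" where
  "hpolar x r \<omega> = cosh r *\<^sub>R x + sinh r *\<^sub>R boost x \<omega>"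

definition sph :: "real \<Rightarrow> real \<Rightarrow> real ^ 3" where
  "sph \<theta> \<phi> = vector [sin \<theta> * cos \<phi>, sin \<theta> * sin \<phi>, cos \<theta>]"

definition hparam :: "mpoint \<Rightarrow> real \<Rightarrow> real \<Rightarrow> real \<Rightarrow> mpoint" where
  "hparam x r \<theta> \<phi> = hpolar x r (sph \<theta> \<phi>)"

text \<open>The area element \<open>sqrt (E G - F\<^sup>2)\<close> of the metric induced on the sphere.\<close>

definition area_element :: "mpoint \<Rightarrow> real \<Rightarrow> real \<Rightarrow> real \<Rightarrow> real" where
  "area_element x r \<theta> \<phi> =
    (let X = vector_derivative (\<lambda>s. hparam x r s \<phi>) (at \<theta>);
         Y = vector_derivative (\<lambda>s. hparam x r \<theta> s) (at \<phi>)
     in sqrt (mink X X * mink Y Y - (mink X Y)\<^sup>2))"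

definition sphere_measure :: "mpoint \<Rightarrow> real \<Rightarrow> mpoint measure" where
  "sphere_measure x r =
    distr (density (restrict_space lborel ({0..pi} \<times> {0..2*pi}))
            (\<lambda>(\<theta>, \<phi>). ennreal (area_element x r \<theta> \<phi>)))
      (restrict_space borel (geodesic_sphere x r))
      (\<lambda>(\<theta>, \<phi>). hparam x r \<theta> \<phi>)"

text \<open>The surface average \<open>M\<^sup>r f(x)\<close>.\<close>

definition sphere_mean :: "real \<Rightarrow> (mpoint \<Rightarrow> real) \<Rightarrow> mpoint \<Rightarrow> real" where
  "sphere_mean r f x =
    (if r = 0 then f x
     else (\<integral>y. f y \<partial>sphere_measure x r) / measure (sphere_measure x r) (geodesic_sphere x r))"

section \<open>The Cauchy problem\<close>

definition hwave :: "real \<Rightarrow> mpoint \<Rightarrow> (mpoint \<Rightarrow> real) \<Rightarrow> real" where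
  "hwave t x g = sinh t * sphere_mean t g x"

definition Fp :: "real \<Rightarrow> real \<Rightarrow> real" where
  "Fp p v = (if v = 0 then 0 else arsinh (1 / \<bar>v\<bar>) powr (- (p - 1)) * \<bar>v\<bar>)"

text \<open>Functions on \<open>H3\<close> are represented by functions on the ambient space, whose values
  off \<open>H3\<close> are irrelevant.\<close>

definition Cc_H3 :: "(mpoint \<Rightarrow> real) \<Rightarrow> bool" where
  "Cc_H3 f \<longleftrightarrow> continuous_on H3 f \<and> compact (closure {x \<in> H3. f x \<noteq> 0})"

text \<open>Differentiability is tested in the global chart \<open>\<xi> \<mapsto> (sqrt (1 + |\<xi>|\<^sup>2), \<xi>)\<close>.\<close>

definition hchart :: "real ^ 3 \<Rightarrow> mpoint" where
  "hchart \<xi> = (sqrt (1 + (norm \<xi>)\<^sup>2), \<xi>)"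

definition C1_H3 :: "(mpoint \<Rightarrow> real) \<Rightarrow> bool" where
  "C1_H3 f \<longleftrightarrow> (\<exists>D :: (real ^ 3) \<Rightarrow> ((real ^ 3) \<Rightarrow>\<^sub>L real).
     (\<forall>\<xi>. ((f \<circ> hchart) has_derivative blinfun_apply (D \<xi>)) (at \<xi>)) \<and> continuous_on UNIV D)"

text \<open>Weak solutions on a time interval \<open>J\<close>, either \<open>{0..T}\<close> or \<open>{0..}\<close>. The time derivative of
  \<open>hwave\<close> is taken within \<open>{0..}\<close>, hence one-sided at \<open>t = 0\<close>.\<close>

definition weak_solution ::
  "real set \<Rightarrow> real \<Rightarrow> real \<Rightarrow> (mpoint \<Rightarrow> real) \<Rightarrow> (mpoint \<Rightarrow> real) \<Rightarrow> (real \<Rightarrow> mpoint \<Rightarrow> real) \<Rightarrow> bool"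
  where
  "weak_solution J p \<epsilon> u0 u1 u \<longleftrightarrow>
     continuous_on (J \<times> H3) (\<lambda>(t, x). u t x) \<and>
     (\<forall>t\<in>J. \<forall>x\<in>H3.
        u t x = \<epsilon> * (vector_derivative (\<lambda>s. hwave s x u0) (at t within {0..}) + hwave t x u1)
              + integral {0..t} (\<lambda>\<tau>. hwave \<tau> x (\<lambda>y. Fp p (u (t - \<tau>) y))))"

abbreviation global_weak_solution ::
  "real \<Rightarrow> real \<Rightarrow> (mpoint \<Rightarrow> real) \<Rightarrow> (mpoint \<Rightarrow> real) \<Rightarrow> (real \<Rightarrow> mpoint \<Rightarrow> real) \<Rightarrow> bool"
  where "global_weak_solution \<equiv> weak_solution {0..}"

section \<open>Consistency of the polar parametrization\<close>

text \<open>For \<open>x \<in> H3\<close> and \<open>r > 0\<close> the parametrization \<open>hparam x r\<close> is measurable, its image is exactly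
  the geodesic sphere, and its area element is \<open>sinh\<^sup>2 r sin \<theta>\<close>, in accordance with the form
  \<open>dr\<^sup>2 + sinh\<^sup>2 r d\<omega>\<^sup>2\<close> of the metric.\<close>

lemma H3_D:
  assumes "x \<in> H3"
  shows "fst x > 0" "snd x \<bullet> snd x = (fst x)\<^sup>2 - 1" "fst x \<ge> 1"
proof -
  show 1: "fst x > 0" and 2: "snd x \<bullet> snd x = (fst x)\<^sup>2 - 1"
    using assms by (auto simp: H3_def mink_def power2_eq_square)
  have "(fst x)\<^sup>2 \<ge> 1" using 2 inner_ge_zero[of "snd x"] by linarith
  thus "fst x \<ge> 1" using 1
    by (metis abs_of_pos abs_square_less_1 not_le)
qed

lemma mink_add_left: "mink (a + b) c = mink a c + mink b c"
  and mink_add_right: "mink c (a + b) = mink c a + mink c b"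
  and mink_scale_left: "mink (k *\<^sub>R a) c = k * mink a c"
  and mink_scale_right: "mink c (k *\<^sub>R a) = k * mink c a"
  and mink_commute: "mink a c = mink c a"
  by (auto simp: mink_def algebra_simps inner_add_left inner_add_right inner_commute)

lemmas mink_linear = mink_add_left mink_add_right mink_scale_left mink_scale_right

lemma mink_boost_boost:
  assumes "x \<in> H3"
  shows "mink (boost x v) (boost x w) = v \<bullet> w"
proof -
  obtain a \<xi> where x: "x = (a, \<xi>)" by (cases x)
  have a: "a > 0" and s: "\<xi> \<bullet> \<xi> = (a - 1) * (a + 1)"
    using H3_D[OF assms] by (auto simp: x power2_eq_square algebra_simps)
  have nz: "1 + a \<noteq> 0" using a by linarith
  define A where "A = \<xi> \<bullet> v"
  define B where "B = \<xi> \<bullet> w"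
  have "mink (boost x v) (boost x w)
    = v \<bullet> w + 2 * (A * B) / (1 + a) + (A / (1 + a)) * (B / (1 + a)) * (\<xi> \<bullet> \<xi>) - A * B"
    by (simp add: mink_def boost_def x A_def B_def inner_add_left inner_add_right inner_commute
        algebra_simps)
  also have "\<dots> = v \<bullet> w"
    using nz unfolding s by (simp add: divide_simps) (simp add: algebra_simps)
  finally show ?thesis .
qed

lemma mink_boost:
  assumes "x \<in> H3"
  shows "mink x (boost x v) = 0"
proof -
  obtain a \<xi> where x: "x = (a, \<xi>)" by (cases x)
  have a: "a > 0" and s: "\<xi> \<bullet> \<xi> = (a - 1) * (a + 1)"
    using H3_D[OF assms] by (auto simp: x power2_eq_square algebra_simps)
  have nz: "1 + a \<noteq> 0" using a by linarith
  show ?thesis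
    using nz by (simp add: mink_def boost_def x inner_add_right s divide_simps)
      (simp add: algebra_simps)
qed

lemma boost_onto_tangent:
  assumes "x \<in> H3" "mink x y = 0"
  shows "\<exists>v. y = boost x v"
proof -
  obtain a \<xi> where x: "x = (a, \<xi>)" by (cases x)
  obtain b w where y: "y = (b, w)" by (cases y)
  have a: "a > 0" and s: "\<xi> \<bullet> \<xi> = (a - 1) * (a + 1)"
    using H3_D[OF assms(1)] by (auto simp: x power2_eq_square algebra_simps)
  have nz: "1 + a \<noteq> 0" using a by linarith
  have t: "\<xi> \<bullet> w = a * b" using assms(2) by (simp add: mink_def x y)
  define v where "v = w - (b / (1 + a)) *\<^sub>R \<xi>"
  have "\<xi> \<bullet> v = b"
    using nz by (simp add: v_def inner_diff_right t s divide_simps) (simp add: algebra_simps)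
  hence "boost x v = y" by (simp add: boost_def x y v_def)
  thus ?thesis by metis
qed

lemma mink_hpolar:
  assumes "x \<in> H3"
  shows "mink x (hpolar x r \<omega>) = - cosh r"
    and "norm \<omega> = 1 \<Longrightarrow> mink (hpolar x r \<omega>) (hpolar x r \<omega>) = - 1"
proof -
  have xx: "mink x x = - 1" using assms by (simp add: H3_def)
  show "mink x (hpolar x r \<omega>) = - cosh r"
    by (simp add: hpolar_def mink_linear xx mink_boost assms)
  assume "norm \<omega> = 1"
  hence w: "\<omega> \<bullet> \<omega> = 1" by (simp add: dot_square_norm)
  show "mink (hpolar x r \<omega>) (hpolar x r \<omega>) = - 1"
    using cosh_square_eq[of r] by (simp add: hpolar_def mink_linear xx mink_boost
        mink_boost_boost mink_commute[of "boost x \<omega>" x] w assms power2_eq_square)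
qed

lemma mink_neg_imp_pos:
  assumes "x \<in> H3" "mink y y = - 1" "mink x y \<le> 0"
  shows "fst y > 0"
proof (rule ccontr)
  assume "\<not> fst y > 0"
  hence ny: "fst y \<le> 0" by simp
  have x: "fst x > 0" "(norm (snd x))\<^sup>2 = (fst x)\<^sup>2 - 1"
    using H3_D[OF assms(1)] by (auto simp: dot_square_norm)
  have y: "(norm (snd y))\<^sup>2 = (fst y)\<^sup>2 - 1"
    using assms(2) by (simp add: mink_def dot_square_norm power2_eq_square)
  have "norm (snd x) < fst x" by (rule power2_less_imp_less) (use x in auto)
  moreover have "norm (snd y) < - fst y" by (rule power2_less_imp_less) (use y ny in auto)
  ultimately have "norm (snd x) * norm (snd y) < fst x * (- fst y)"
    by (intro mult_strict_mono) (use x(1) in auto)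
  moreover have "\<bar>snd x \<bullet> snd y\<bar> \<le> norm (snd x) * norm (snd y)" by (rule Cauchy_Schwarz_ineq2)
  ultimately show False using assms(3) by (simp add: mink_def)
qed

lemma mink_H3_le:
  assumes "x \<in> H3" "y \<in> H3"
  shows "mink x y \<le> - 1"
proof -
  have x: "fst x \<ge> 1" "(norm (snd x))\<^sup>2 = (fst x)\<^sup>2 - 1"
    and y: "fst y \<ge> 1" "(norm (snd y))\<^sup>2 = (fst y)\<^sup>2 - 1"
    using H3_D[OF assms(1)] H3_D[OF assms(2)] by (auto simp: dot_square_norm)
  have p: "fst x * fst y \<ge> 1" using mult_mono[of 1 "fst x" 1 "fst y"] x(1) y(1) by simp
  have "norm (snd x) * norm (snd y) \<le> fst x * fst y - 1"
  proof (rule power2_le_imp_le)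
    have "(norm (snd x) * norm (snd y))\<^sup>2 = ((fst x)\<^sup>2 - 1) * ((fst y)\<^sup>2 - 1)"
      by (simp add: power_mult_distrib x y)
    also have "\<dots> = (fst x * fst y - 1)\<^sup>2 - (fst x - fst y)\<^sup>2"
      by (simp add: power2_eq_square algebra_simps)
    finally show "(norm (snd x) * norm (snd y))\<^sup>2 \<le> (fst x * fst y - 1)\<^sup>2" by simp
  qed (use p in simp)
  moreover have "snd x \<bullet> snd y \<le> norm (snd x) * norm (snd y)" by (rule norm_cauchy_schwarz)
  ultimately show ?thesis by (simp add: mink_def)
qed

lemma hpolar_image:
  assumes x: "x \<in> H3" and r: "r > 0"
  shows "hpolar x r ` sphere 0 1 = geodesic_sphere x r"
proof (intro equalityI subsetI)
  fix y assume "y \<in> hpolar x r ` sphere 0 1"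
  then obtain \<omega> where w: "norm \<omega> = 1" and y: "y = hpolar x r \<omega>" by auto
  have "y \<in> H3"
    using mink_neg_imp_pos[OF x, of y] mink_hpolar[OF x] w by (simp add: y H3_def)
  thus "y \<in> geodesic_sphere x r"
    using r by (simp add: geodesic_sphere_def hdist_def y mink_hpolar x arcosh_cosh_real)
next
  fix y assume "y \<in> geodesic_sphere x r"
  hence y: "y \<in> H3" and d: "arcosh (- mink x y) = r"
    by (auto simp: geodesic_sphere_def hdist_def)
  have c: "mink x y = - cosh r"
    using mink_H3_le[OF x y] cosh_arcosh_real[of "- mink x y"] d by simp
  have xx: "mink x x = - 1" and yy: "mink y y = - 1" using x y by (auto simp: H3_def)
  have s: "sinh r > 0" using r by simp
  define z where "z = y + (- cosh r) *\<^sub>R x"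
  have "mink x z = 0" unfolding z_def mink_linear c xx by simp
  then obtain v where v: "z = boost x v" using boost_onto_tangent[OF x] by blast
  have "v \<bullet> v = mink z z" by (simp add: v mink_boost_boost x)
  also have "\<dots> = (sinh r)\<^sup>2"
    unfolding z_def mink_linear c xx yy mink_commute[of y x]
    using cosh_square_eq[of r] by (simp add: power2_eq_square)
  finally have "norm v = sinh r" using s by (simp add: norm_eq_sqrt_inner)
  hence "norm (v /\<^sub>R sinh r) = 1" using s by simp
  moreover have "boost x (v /\<^sub>R sinh r) = boost x v /\<^sub>R sinh r"
    by (simp add: boost_def scaleR_add_right)
  hence "hpolar x r (v /\<^sub>R sinh r) = y" using s by (simp add: hpolar_def flip: v) (simp add: z_def)
  ultimately show "y \<in> hpolar x r ` sphere 0 1" by force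
qed

lemma hchart_image: "range hchart = H3"
proof (intro equalityI subsetI)
  fix x assume "x \<in> range hchart"
  then obtain \<xi> where x: "x = hchart \<xi>" by blast
  have "1 + (norm \<xi>)\<^sup>2 > 0" by (simp add: add_pos_nonneg)
  thus "x \<in> H3" by (simp add: x H3_def mink_def hchart_def dot_square_norm)
next
  fix x assume "x \<in> H3"
  hence "x = hchart (snd x)"
    using H3_D[of x] by (simp add: prod_eq_iff hchart_def flip: dot_square_norm)
  thus "x \<in> range hchart" by blast
qed

lemma inner_vec3: "(v :: real ^ 3) \<bullet> w = v $ 1 * w $ 1 + v $ 2 * w $ 2 + v $ 3 * w $ 3"
  by (simp add: inner_vec_def sum_3)

lemma sph_image: "(\<lambda>(\<theta>, \<phi>). sph \<theta> \<phi>) ` ({0..pi} \<times> {0..2*pi}) = sphere 0 1"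
proof (intro equalityI subsetI)
  fix v assume "v \<in> (\<lambda>(\<theta>, \<phi>). sph \<theta> \<phi>) ` ({0..pi} \<times> {0..2*pi})"
  then obtain \<theta> \<phi> where v: "v = sph \<theta> \<phi>" by auto
  have "v \<bullet> v = (sin \<theta>)\<^sup>2 * ((cos \<phi>)\<^sup>2 + (sin \<phi>)\<^sup>2) + (cos \<theta>)\<^sup>2"
    by (simp add: v sph_def inner_vec3 power2_eq_square algebra_simps
        del: sin_cos_squared_add3 sin_cos_squared_add sin_cos_squared_add2)
  hence "v \<bullet> v = 1" by simp
  thus "v \<in> sphere 0 1" by (simp add: norm_eq_sqrt_inner)
next
  fix v :: "real ^ 3" assume "v \<in> sphere 0 1"
  hence n: "(v $ 1)\<^sup>2 + (v $ 2)\<^sup>2 + (v $ 3)\<^sup>2 = 1"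
    by (simp add: norm_eq_sqrt_inner inner_vec3 power2_eq_square)
  define \<theta> where "\<theta> = arccos (v $ 3)"
  have "(v $ 3)\<^sup>2 \<le> 1" using n by (smt (verit) zero_le_power2)
  hence b: "- 1 \<le> v $ 3" "v $ 3 \<le> 1" by (simp_all add: abs_square_le_1 abs_le_iff)
  have ct: "cos \<theta> = v $ 3" and th: "\<theta> \<in> {0..pi}"
    using b by (simp_all add: \<theta>_def arccos_lbound arccos_ubound)
  have st: "(sin \<theta>)\<^sup>2 = (v $ 1)\<^sup>2 + (v $ 2)\<^sup>2" using n by (simp add: sin_squared_eq ct)
  show "v \<in> (\<lambda>(\<theta>, \<phi>). sph \<theta> \<phi>) ` ({0..pi} \<times> {0..2*pi})"
  proof (cases "sin \<theta> = 0")
    case True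
    hence "v $ 1 = 0" "v $ 2 = 0" using st by (simp_all add: sum_power2_eq_zero_iff)
    hence "v = sph \<theta> 0" using True by (simp add: sph_def vec_eq_iff forall_3 ct)
    thus ?thesis using th by force
  next
    case False
    have "(v $ 1 / sin \<theta>)\<^sup>2 + (v $ 2 / sin \<theta>)\<^sup>2 = 1"
      using False by (simp add: power_divide st[symmetric] flip: add_divide_distrib)
    then obtain \<phi> where "0 \<le> \<phi>" "\<phi> < 2 * pi" "v $ 1 / sin \<theta> = cos \<phi>" "v $ 2 / sin \<theta> = sin \<phi>"
      using sincos_total_2pi by metis
    moreover from this have "v = sph \<theta> \<phi>"
      using False by (simp add: sph_def vec_eq_iff forall_3 ct divide_eq_eq mult.commute)
    ultimately show ?thesis using th by force
  qed
qed

lemma hparam_image: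
  assumes "x \<in> H3" "r > 0"
  shows "(\<lambda>(\<theta>, \<phi>). hparam x r \<theta> \<phi>) ` ({0..pi} \<times> {0..2*pi}) = geodesic_sphere x r"
proof -
  have "(\<lambda>(\<theta>, \<phi>). hparam x r \<theta> \<phi>) = hpolar x r \<circ> (\<lambda>(\<theta>, \<phi>). sph \<theta> \<phi>)"
    by (auto simp: hparam_def)
  thus ?thesis using hpolar_image[OF assms] sph_image by (metis image_comp)
qed

lemma bounded_linear_boost: "bounded_linear (boost x)"
  unfolding linear_conv_bounded_linear[symmetric]
  by (rule linearI) (auto simp: boost_def inner_add_right algebra_simps add_divide_distrib)

lemma sph_axis:
  "sph \<theta> \<phi> = (sin \<theta> * cos \<phi>) *\<^sub>R axis 1 1 + (sin \<theta> * sin \<phi>) *\<^sub>R axis 2 1 + cos \<theta> *\<^sub>R axis 3 1"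
  by (simp add: sph_def vec_eq_iff forall_3 axis_def)

lemma hparam_measurable:
  assumes "x \<in> H3" "r > 0"
  shows "(\<lambda>(\<theta>, \<phi>). hparam x r \<theta> \<phi>) \<in>
    restrict_space lborel ({0..pi} \<times> {0..2*pi}) \<rightarrow>\<^sub>M restrict_space borel (geodesic_sphere x r)"
proof (rule measurable_restrict_space3)
  have "continuous_on UNIV (\<lambda>z. hparam x r (fst z) (snd z))"
    unfolding hparam_def hpolar_def sph_axis
    by (intro continuous_intros bounded_linear.continuous_on[OF bounded_linear_boost])
  thus "(\<lambda>(\<theta>, \<phi>). hparam x r \<theta> \<phi>) \<in> borel_measurable lborel"
    by (simp add: case_prod_unfold borel_measurable_continuous_onI)
  show "(\<lambda>(\<theta>, \<phi>). hparam x r \<theta> \<phi>) \<in> {0..pi} \<times> {0..2*pi} \<rightarrow> geodesic_sphere x r"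
    using hparam_image[OF assms] by blast
qed

lemma hparam_derivs:
  "((\<lambda>s. hparam x r s \<phi>) has_vector_derivative
     sinh r *\<^sub>R boost x ((cos \<theta> * cos \<phi>) *\<^sub>R axis 1 1 + (cos \<theta> * sin \<phi>) *\<^sub>R axis 2 1
       + (- sin \<theta>) *\<^sub>R axis 3 1)) (at \<theta>)"
  "((\<lambda>s. hparam x r \<theta> s) has_vector_derivative
     sinh r *\<^sub>R boost x ((- sin \<theta> * sin \<phi>) *\<^sub>R axis 1 1 + (sin \<theta> * cos \<phi>) *\<^sub>R axis 2 1)) (at \<phi>)"
  unfolding hparam_def hpolar_def sph_axis
  by (auto intro!: derivative_eq_intros bounded_linear.has_vector_derivative[OF bounded_linear_boost]
      simp: mult.commute)

lemma area_element_eq: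
  assumes "x \<in> H3" "\<theta> \<in> {0..pi}"
  shows "area_element x r \<theta> \<phi> = (sinh r)\<^sup>2 * sin \<theta>"
proof -
  define V :: "real ^ 3" where "V = (cos \<theta> * cos \<phi>) *\<^sub>R axis 1 1 + (cos \<theta> * sin \<phi>) *\<^sub>R axis 2 1
       + (- sin \<theta>) *\<^sub>R axis 3 1"
  define W :: "real ^ 3" where
    "W = (- sin \<theta> * sin \<phi>) *\<^sub>R axis 1 1 + (sin \<theta> * cos \<phi>) *\<^sub>R axis 2 1"
  have "V \<bullet> V = (cos \<theta>)\<^sup>2 * ((cos \<phi>)\<^sup>2 + (sin \<phi>)\<^sup>2) + (sin \<theta>)\<^sup>2"
    by (simp add: V_def inner_vec3 axis_def power2_eq_square algebra_simps
        del: sin_cos_squared_add3 sin_cos_squared_add sin_cos_squared_add2)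
  hence VV: "V \<bullet> V = 1" by simp
  have "W \<bullet> W = (sin \<theta>)\<^sup>2 * ((cos \<phi>)\<^sup>2 + (sin \<phi>)\<^sup>2)"
    by (simp add: W_def inner_vec3 axis_def power2_eq_square algebra_simps
        del: sin_cos_squared_add3 sin_cos_squared_add sin_cos_squared_add2)
  hence WW: "W \<bullet> W = (sin \<theta>)\<^sup>2" by simp
  have VW: "V \<bullet> W = 0"
    by (simp add: V_def W_def inner_vec3 axis_def)
  have d: "vector_derivative (\<lambda>s. hparam x r s \<phi>) (at \<theta>) = sinh r *\<^sub>R boost x V"
    "vector_derivative (\<lambda>s. hparam x r \<theta> s) (at \<phi>) = sinh r *\<^sub>R boost x W"
    unfolding V_def W_def by (intro vector_derivative_at hparam_derivs)+
  have "area_element x r \<theta> \<phi> = sqrt (sinh r * (sinh r * 1) * (sinh r * (sinh r * (sin \<theta>)\<^sup>2))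
      - (sinh r * (sinh r * 0))\<^sup>2)"
    unfolding area_element_def Let_def d mink_linear mink_boost_boost[OF assms(1)] VV WW VW ..
  also have "\<dots> = sqrt (((sinh r)\<^sup>2 * sin \<theta>)\<^sup>2)"
    by (rule arg_cong[where f = sqrt]) (simp add: power2_eq_square)
  also have "\<dots> = (sinh r)\<^sup>2 * sin \<theta>" using assms(2) by (simp add: sin_ge_zero)
  finally show ?thesis .
qed

end

theory Submission
  imports Defs
begin

text \<open>
  Since \<open>sinh t M\<^sup>t\<close> acts on functions of the distance \<open>\<rho>\<close> to a fixed point, multiplied by \<open>sinh \<rho>\<close>, as the
  one-dimensional wave propagator, pointwise lower bounds that are radial about the origin propagate
  by d'Alembert's formula as soon as the contribution of the data has left (Huygens' principle).

  Suppose \<open>u\<close> is nonzero at some \<open>(s0, y0)\<close> with \<open>s0 + d(o, y0) > R\<close>, where the data are supported in the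
  ball of radius \<open>R\<close> about \<open>o\<close>. Then \<open>u\<close> is positive in a solid forward light cone, and \<open>v = sinh r u\<close> is
  bounded below in a strip \<open>a \<le> t - r \<le> a + 1/2\<close>. As long as \<open>v\<close> is not exponentially small, the source
  \<open>sinh r F\<^sub>p(u)\<close> is at least of order \<open>t powr (1 - p) v\<close>, so each application of d'Alembert's formula gains a
  factor \<open>t powr (3 - p)\<close>. For \<open>p < 3\<close> this makes \<open>u\<close> arbitrarily large on a bounded set of radii, where
  \<open>F\<^sub>p(u) \<ge> u powr p\<close> forces blow-up within unit time.

  Otherwise \<open>u\<close> vanishes for \<open>t > R\<close>, and reversing time (which rests on the group law of the propagators)
  shows that \<open>u\<close> vanishes identically.
\<close>

section \<open>Averages over the unit sphere\<close>

text \<open>A weak solution is only continuous and the data carry no sign, so the argument rests on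
  the integral equation, the positivity of the propagator at positive times and \<open>Fp\<close>
  \<ge> 0. While the data can still contribute, the sign of \<open>u\<close> is unknown; this forces
  the dichotomy.

  The threshold 3 is a count of powers. Write \<open>Fp p u\<close> as V |u| with V = arsinh(1/|u|)
  powr (1 - p). If sinh r u is bounded below by a power of t, the only exponential loss in u is sinh
  r, so arsinh(1/|u|) is at most of order t. This is where the power 1 - p comes from; the other two
  powers are the area of the space-time region over which the source is integrated.

  The vanishing branch needs the opposite estimate: on bounded sets \<open>Fp\<close> lies below a
  linear function, so the nonlinearity acts like a bounded potential and the reversed integral
  equation can be iterated to zero.\<close>

definition sph_box :: "(real \<times> real) set" where
  "sph_box = cbox (0, 0) (pi, 2 * pi)"

definition sph_avg :: "(real ^ 3 \<Rightarrow> real) \<Rightarrow> real" where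
  "sph_avg h = integral sph_box (\<lambda>z. sin (fst z) * h (sph (fst z) (snd z))) / (4 * pi)"

text \<open>Agrees with \<^const>\<open>hpolar\<close> wherever \<open>fst x \<ge> 0\<close>; the \<open>max\<close> keeps the denominator away from \<open>0\<close>, so that
  \<open>hpol\<close> is continuous on the whole ambient space.\<close>

definition hpol :: "mpoint \<Rightarrow> real \<Rightarrow> real ^ 3 \<Rightarrow> mpoint" where
  "hpol x r w = cosh r *\<^sub>R x + sinh r *\<^sub>R
     (snd x \<bullet> w, w + ((snd x \<bullet> w) / (1 + max 0 (fst x))) *\<^sub>R snd x)"

lemma hpol_eq_hpolar: "fst x \<ge> 0 \<Longrightarrow> hpol x r w = hpolar x r w"
  by (simp add: hpol_def hpolar_def boost_def max_def)

lemma continuous_on_hpol [continuous_intros]: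
  fixes f :: "'a::t2_space \<Rightarrow> mpoint"
  assumes "continuous_on A f" "continuous_on A g" "continuous_on A h"
  shows "continuous_on A (\<lambda>z. hpol (f z) (g z) (h z))"
proof -
  have nz: "1 + max 0 (fst (f z)) \<noteq> 0" for z
    using max.cobounded1[of 0 "fst (f z)"] by linarith
  show ?thesis unfolding hpol_def
    by (intro continuous_on_add continuous_on_scaleR continuous_on_cosh continuous_on_sinh
        continuous_on_Pair continuous_on_inner continuous_on_divide continuous_on_fst
        continuous_on_snd continuous_on_max continuous_on_const assms) (use nz in blast)
qed

lemma continuous_on_sph [continuous_intros]:
  fixes f :: "'a::t2_space \<Rightarrow> real"
  assumes "continuous_on A f" "continuous_on A g"
  shows "continuous_on A (\<lambda>z. sph (f z) (g z))"
  unfolding sph_axis by (intro continuous_intros assms)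

lemma continuous_on_UNIV_comp:
  assumes "continuous_on UNIV f" "continuous_on A g"
  shows "continuous_on A (\<lambda>z. f (g z))"
  by (rule continuous_on_compose2[OF assms]) auto

lemma continuous_on_UNIV_comp2:
  assumes "continuous_on UNIV (\<lambda>(x, y). f x y)" "continuous_on A g" "continuous_on A h"
  shows "continuous_on A (\<lambda>z. f (g z) (h z))"
  using continuous_on_UNIV_comp[OF assms(1), of A "\<lambda>z. (g z, h z)"] assms(2,3)
  by (auto intro: continuous_on_Pair)

lemma norm_sph [simp]: "norm (sph \<theta> \<phi>) = 1"
proof -
  have "sph \<theta> \<phi> \<bullet> sph \<theta> \<phi> = (sin \<theta>)\<^sup>2 * ((cos \<phi>)\<^sup>2 + (sin \<phi>)\<^sup>2) + (cos \<theta>)\<^sup>2"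
    by (simp add: sph_def inner_vec3 power2_eq_square algebra_simps
        del: sin_cos_squared_add3 sin_cos_squared_add sin_cos_squared_add2)
  thus ?thesis by (simp add: norm_eq_sqrt_inner)
qed

lemma hpolar_H3:
  assumes "x \<in> H3" "norm w = 1"
  shows "hpolar x r w \<in> H3"
  using mink_neg_imp_pos[OF assms(1), of "hpolar x r w"] mink_hpolar[OF assms(1)] assms(2)
  by (simp add: H3_def)

lemma hpol_H3_eq: "x \<in> H3 \<Longrightarrow> hpol x r w = hpolar x r w"
  using H3_D(1) hpol_eq_hpolar by (simp add: less_imp_le)

lemma hpol_H3 [simp]: "x \<in> H3 \<Longrightarrow> norm w = 1 \<Longrightarrow> hpol x r w \<in> H3"
  by (simp add: hpol_H3_eq hpolar_H3)

lemma hpol_0 [simp]: "hpol x 0 w = x"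
  by (simp add: hpol_def zero_prod_def)

lemma integrable_sph_avg:
  assumes "continuous_on UNIV h"
  shows "(\<lambda>z. sin (fst z) * h (sph (fst z) (snd z))) integrable_on sph_box"
  unfolding sph_box_def
  by (intro integrable_continuous continuous_intros continuous_on_UNIV_comp[OF assms])

lemma sin_sph_box: "z \<in> sph_box \<Longrightarrow> sin (fst z) \<ge> 0"
  by (cases z) (auto simp: sph_box_def cbox_Pair_eq intro: sin_ge_zero)

lemma integral_sph_box_const: "integral sph_box (\<lambda>z. sin (fst z)) = 4 * pi"
proof -
  have "integral sph_box (\<lambda>z. sin (fst z))
      = integral (cbox 0 pi) (\<lambda>\<theta>. integral (cbox 0 (2*pi)) (\<lambda>\<phi>. sin (fst (\<theta>, \<phi> :: real))))"
    unfolding sph_box_def by (rule integral_prod_continuous) (intro continuous_intros)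
  also have "\<dots> = integral {0..pi} (\<lambda>\<theta>. 2 * pi * sin \<theta>)"
    by simp
  also have "\<dots> = 2 * pi * (- cos pi) - 2 * pi * (- cos 0)"
    by (rule integral_unique, rule fundamental_theorem_of_calculus)
      (auto intro!: derivative_eq_intros simp flip: has_real_derivative_iff_has_vector_derivative)
  finally show ?thesis by simp
qed

lemma sph_avg_const [simp]: "sph_avg (\<lambda>_. c) = c"
  using integral_sph_box_const by (simp add: sph_avg_def)

lemma sph_avg_mult [simp]: "sph_avg (\<lambda>w. c * h w) = c * sph_avg h"
  using integral_mult_right[of sph_box c "\<lambda>z. sin (fst z) * h (sph (fst z) (snd z))"]
  by (simp add: sph_avg_def algebra_simps)

lemma sph_avg_add:
  assumes "continuous_on UNIV g" "continuous_on UNIV h"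
  shows "sph_avg (\<lambda>w. g w + h w) = sph_avg g + sph_avg h"
  using integral_add[OF assms[THEN integrable_sph_avg]]
  by (simp add: sph_avg_def algebra_simps add_divide_distrib)

lemma sph_avg_diff:
  assumes "continuous_on UNIV g" "continuous_on UNIV h"
  shows "sph_avg (\<lambda>w. g w - h w) = sph_avg g - sph_avg h"
  using integral_diff[OF assms[THEN integrable_sph_avg]]
  by (simp add: sph_avg_def right_diff_distrib diff_divide_distrib)

lemma sph_avg_cong:
  assumes "\<And>w. norm w = 1 \<Longrightarrow> g w = h w"
  shows "sph_avg g = sph_avg h"
  unfolding sph_avg_def by (simp add: assms)

lemma sph_avg_mono:
  assumes "continuous_on UNIV g" "continuous_on UNIV h" "\<And>w. norm w = 1 \<Longrightarrow> g w \<le> h w"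
  shows "sph_avg g \<le> sph_avg h"
  unfolding sph_avg_def
  by (intro divide_right_mono integral_le integrable_sph_avg assms mult_left_mono)
    (auto simp: assms sin_sph_box)

lemma sph_avg_nonneg:
  assumes "continuous_on UNIV g" "\<And>w. norm w = 1 \<Longrightarrow> 0 \<le> g w"
  shows "0 \<le> sph_avg g"
  using sph_avg_mono[of "\<lambda>_. 0" g] assms by auto

lemma sph_avg_abs_diff_le:
  assumes "continuous_on UNIV g" "continuous_on UNIV h"
    and "\<And>w. norm w = 1 \<Longrightarrow> \<bar>g w - h w\<bar> \<le> e"
  shows "\<bar>sph_avg g - sph_avg h\<bar> \<le> e"
proof -
  have "sph_avg (\<lambda>w. g w - h w) \<le> sph_avg (\<lambda>_. e)" "sph_avg (\<lambda>_. - e) \<le> sph_avg (\<lambda>w. g w - h w)"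
    by (intro sph_avg_mono continuous_intros assms; use assms(3) in \<open>auto simp: abs_le_iff minus_le_iff\<close>;
        smt (verit) assms(3))+
  thus ?thesis using sph_avg_diff[OF assms(1,2)] by simp
qed

lemma sph_avg_pos:
  assumes c: "continuous_on UNIV g" and nn: "\<And>w. norm w = 1 \<Longrightarrow> 0 \<le> g w"
    and w0: "norm w0 = 1" "g w0 > 0"
  shows "0 < sph_avg g"
proof (rule ccontr)
  assume "\<not> 0 < sph_avg g"
  hence 0: "sph_avg g = 0" using sph_avg_nonneg[OF c nn] by simp
  let ?f = "\<lambda>z. sin (fst z) * g (sph (fst z) (snd z))"
  have cf: "continuous_on UNIV ?f"
    by (intro continuous_intros continuous_on_UNIV_comp[OF c])
  have i0: "integral sph_box ?f = 0" using 0 by (simp add: sph_avg_def)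
  have ge: "?f z \<ge> 0" if "z \<in> sph_box" for z
    using sin_sph_box[OF that] nn[of "sph (fst z) (snd z)"] by simp
  have "integral sph_box ?f = 0 \<longleftrightarrow> (\<forall>z\<in>sph_box. ?f z = 0)"
    unfolding sph_box_def
  proof (rule integral_cbox_eq_0_iff)
    show "box (0, 0) (pi, 2 * pi) \<noteq> {}" by (auto simp: box_ne_empty Basis_prod_def)
    show "continuous_on (cbox (0, 0) (pi, 2 * pi)) ?f" by (rule continuous_on_subset[OF cf subset_UNIV])
  qed (use ge in \<open>simp add: sph_box_def\<close>)
  hence z: "?f z = 0" if "z \<in> sph_box" for z using i0 that by blast
  obtain \<theta> \<phi> where tp: "\<theta> \<in> {0..pi}" "\<phi> \<in> {0..2*pi}" "w0 = sph \<theta> \<phi>"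
  proof -
    have "w0 \<in> (\<lambda>(\<theta>, \<phi>). sph \<theta> \<phi>) ` ({0..pi} \<times> {0..2*pi})"
      unfolding sph_image using w0(1) by simp
    thus ?thesis using that by (elim imageE) (auto split: prod.splits)
  qed
  \<comment> \<open>The weight \<open>sin\<close> vanishes at the poles, so the zero integral says
    nothing there; the poles are reached by continuity along a meridian.\<close>
  have c2: "continuous_on {0..pi} (\<lambda>t. g (sph t \<phi>))"
    by (intro continuous_intros continuous_on_UNIV_comp[OF c])
  have "g (sph t \<phi>) = 0" if "t \<in> {0<..<pi}" for t
    using z[of "(t, \<phi>)"] that tp sin_gt_zero[of t] by (auto simp: sph_box_def cbox_Pair_eq)
  hence "g (sph \<theta> \<phi>) = 0"
    using continuous_constant_on_closure[of "{0<..<pi}" "\<lambda>t. g (sph t \<phi>)" 0 \<theta>] c2 tp(1)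
    by (simp add: closure_greaterThanLessThan)
  thus False using w0 tp by simp
qed

lemma continuous_on_sph_avg:
  fixes G :: "'a::t2_space \<Rightarrow> real ^ 3 \<Rightarrow> real"
  assumes "continuous_on UNIV (\<lambda>(p, w). G p w)"
  shows "continuous_on UNIV (\<lambda>p. sph_avg (G p))"
proof -
  have "continuous_on UNIV (\<lambda>p. integral sph_box (\<lambda>z. sin (fst z) * G p (sph (fst z) (snd z))))"
    unfolding sph_box_def
    by (rule integral_continuous_on_param)
      (auto simp: case_prod_unfold intro!: continuous_intros continuous_on_UNIV_comp2[OF assms])
  thus ?thesis unfolding sph_avg_def by (intro continuous_intros) auto
qed

lemma sph_avg_integral_swap:
  assumes "continuous_on UNIV (\<lambda>(s::real, w). G s w)"
  shows "sph_avg (\<lambda>w. integral {a..b} (\<lambda>s. G s w)) = integral {a..b} (\<lambda>s. sph_avg (G s))"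
proof -
  have "integral sph_box (\<lambda>z. integral {a..b} (\<lambda>s. sin (fst z) * G s (sph (fst z) (snd z))))
      = integral {a..b} (\<lambda>s. integral sph_box (\<lambda>z. sin (fst z) * G s (sph (fst z) (snd z))))"
    unfolding sph_box_def cbox_interval[symmetric]
    by (rule integral_swap_continuous)
      (auto simp: case_prod_unfold intro!: continuous_intros continuous_on_UNIV_comp2[OF assms])
  thus ?thesis unfolding sph_avg_def by simp
qed

lemma sph_avg_has_derivative:
  fixes G G' :: "real \<Rightarrow> real ^ 3 \<Rightarrow> real"
  assumes d: "\<And>t w. ((\<lambda>t. G t w) has_real_derivative G' t w) (at t)"
    and c: "continuous_on UNIV (\<lambda>(t, w). G t w)" "continuous_on UNIV (\<lambda>(t, w). G' t w)"
  shows "((\<lambda>t. sph_avg (G t)) has_real_derivative sph_avg (G' t)) (at t)"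
proof -
  have cw: "continuous_on UNIV (G t)" for t
    using continuous_on_UNIV_comp2[OF c(1), of UNIV "\<lambda>_. t" "\<lambda>w. w"] by (simp add: continuous_on_id)
  have "((\<lambda>t. integral sph_box (\<lambda>z. sin (fst z) * G t (sph (fst z) (snd z))))
      has_real_derivative integral sph_box (\<lambda>z. sin (fst z) * G' t (sph (fst z) (snd z))))
      (at t within UNIV)"
    unfolding sph_box_def
    by (rule leibniz_rule_field_derivative[where U = UNIV])
      (auto simp: case_prod_unfold sph_box_def[symmetric]
        intro!: continuous_intros continuous_on_UNIV_comp2[OF c(2)] integrable_sph_avg cw DERIV_cmult d)
  thus ?thesis unfolding sph_avg_def by (intro DERIV_cdivide) simp
qed

section \<open>Geodesic sphere means as averages over the unit sphere\<close>

text \<open>Precomposition with the projection onto the hyperboloid along the time axis turns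
  continuity on \<open>H3\<close> into continuity on the whole ambient space, so later arguments run
  over \<open>UNIV\<close>.\<close>

definition extend :: "(mpoint \<Rightarrow> 'a) \<Rightarrow> mpoint \<Rightarrow> 'a" where
  "extend f y = f (hchart (snd y))"

lemma hchart_snd: "y \<in> H3 \<Longrightarrow> hchart (snd y) = y"
proof -
  assume "y \<in> H3"
  hence "y \<in> range hchart" by (simp add: hchart_image)
  thus ?thesis by (auto simp: hchart_def)
qed

lemma hchart_H3 [simp]: "hchart \<xi> \<in> H3"
  using hchart_image by blast

lemma extend_eq [simp]: "y \<in> H3 \<Longrightarrow> extend f y = f y"
  by (simp add: extend_def hchart_snd)

lemma continuous_on_hchart [continuous_intros]:
  "continuous_on A f \<Longrightarrow> continuous_on A (\<lambda>z. hchart (f z))"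
  unfolding hchart_def by (intro continuous_intros)

lemma continuous_on_extend:
  assumes "continuous_on H3 f"
  shows "continuous_on UNIV (extend f)"
proof -
  have "extend f = f \<circ> (\<lambda>y. hchart (snd y))" by (auto simp: extend_def)
  moreover have "continuous_on UNIV (\<lambda>y::mpoint. hchart (snd y))" by (intro continuous_intros)
  ultimately show ?thesis
    by (metis (no_types, lifting) assms continuous_on_compose continuous_on_subset hchart_H3 image_subsetI)
qed

lemma integral_sphere_measure:
  assumes x: "x \<in> H3" and r: "r > 0" and g: "continuous_on UNIV g"
  shows "(\<integral>y. g y \<partial>sphere_measure x r) = (sinh r)\<^sup>2 * (4 * pi * sph_avg (\<lambda>w. g (hpol x r w)))"
proof -
  define D where "D = ({0..pi} \<times> {0..2*pi} :: (real \<times> real) set)"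
  have Db: "D = sph_box" by (simp add: D_def sph_box_def cbox_Pair_eq)
  have Dm: "D \<in> sets lborel" by (simp add: D_def borel_closed closed_Times)
  let ?M = "restrict_space lborel D"
  let ?p = "\<lambda>(\<theta>, \<phi>). hparam x r \<theta> \<phi>"
  let ?a = "\<lambda>z. (sinh r)\<^sup>2 * sin (fst z) :: real"
  have "(\<lambda>z. sin (fst z)) \<in> borel_measurable (lborel :: (real \<times> real) measure)"
    by (simp add: borel_measurable_continuous_onI continuous_intros)
  hence am: "?a \<in> borel_measurable ?M"
    by (intro borel_measurable_times measurable_restrict_space1) auto
  \<comment> \<open>\<open>area_element_eq\<close> holds on the coordinate box only, so the two
    densities are compared through the measures they define.\<close>
  have dens: "density ?M (\<lambda>(\<theta>, \<phi>). ennreal (area_element x r \<theta> \<phi>)) = density ?M (\<lambda>z. ennreal (?a z))"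
  proof (unfold density_def, rule arg_cong[where f = "measure_of _ _"], rule ext)
    fix A
    show "(\<integral>\<^sup>+z. (case z of (\<theta>, \<phi>) \<Rightarrow> ennreal (area_element x r \<theta> \<phi>)) * indicator A z \<partial>?M)
      = (\<integral>\<^sup>+z. ennreal (?a z) * indicator A z \<partial>?M)"
      by (rule nn_integral_cong) (auto simp: space_restrict_space D_def area_element_eq[OF x])
  qed
  have pm: "?p \<in> density ?M (\<lambda>z. ennreal (?a z)) \<rightarrow>\<^sub>M restrict_space borel (geodesic_sphere x r)"
    using hparam_measurable[OF x r] by (simp add: D_def)
  have gm: "g \<in> borel_measurable (restrict_space borel (geodesic_sphere x r))"
    by (intro measurable_restrict_space1 borel_measurable_continuous_onI g)
  have gp: "(\<lambda>z. g (?p z)) \<in> borel_measurable ?M"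
    using measurable_compose[OF hparam_measurable[OF x r] gm] by (simp add: D_def)
  have c: "continuous_on UNIV (\<lambda>z. sin (fst z) * g (hpol x r (sph (fst z) (snd z))))"
    by (intro continuous_intros continuous_on_UNIV_comp[OF g])
  have si: "set_integrable lborel sph_box (\<lambda>z. sin (fst z) * g (hpol x r (sph (fst z) (snd z))))"
    unfolding set_integrable_def sph_box_def
    by (intro borel_integrable_compact compact_cbox continuous_on_subset[OF c]) auto
  have "(\<integral>y. g y \<partial>sphere_measure x r) = (\<integral>z. g (?p z) \<partial>density ?M (\<lambda>z. ennreal (?a z)))"
    unfolding sphere_measure_def D_def[symmetric] dens by (rule integral_distr[OF pm gm])
  also have "\<dots> = (\<integral>z. ?a z * g (?p z) \<partial>?M)"
    by (subst integral_density) (use am gp in \<open>auto intro!: AE_I2 sin_ge_zero mult_nonneg_nonneg simp: space_restrict_space D_def\<close>)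
  also have "\<dots> = (LINT z:D|lborel. ?a z * g (?p z))"
    by (subst integral_restrict_space) (use Dm in \<open>auto simp: set_lebesgue_integral_def\<close>)
  also have "\<dots> = (LINT z:sph_box|lborel. (sinh r)\<^sup>2 * (sin (fst z) * g (hpol x r (sph (fst z) (snd z)))))"
    unfolding Db by (intro set_lebesgue_integral_cong)
      (use Dm Db in \<open>auto simp: hparam_def hpol_H3_eq[OF x] case_prod_unfold\<close>)
  also have "\<dots> = (sinh r)\<^sup>2 * integral sph_box (\<lambda>z. sin (fst z) * g (hpol x r (sph (fst z) (snd z))))"
    by (simp add: set_borel_integral_eq_integral(2)[OF si])
  finally show ?thesis by (simp add: sph_avg_def)
qed

lemma sphere_mean_eq:
  assumes x: "x \<in> H3" and r: "r \<ge> 0" and f: "continuous_on H3 f"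
  shows "sphere_mean r f x = sph_avg (\<lambda>w. extend f (hpol x r w))"
proof (cases "r = 0")
  case True
  thus ?thesis using x by (simp add: sphere_mean_def)
next
  case False
  hence r: "r > 0" using r by simp
  have sp: "space (sphere_measure x r) = geodesic_sphere x r"
    by (simp add: sphere_measure_def space_restrict_space)
  have "(\<integral>y. f y \<partial>sphere_measure x r) = (\<integral>y. extend f y \<partial>sphere_measure x r)"
    by (rule Bochner_Integration.integral_cong) (auto simp: sp geodesic_sphere_def)
  also have "\<dots> = (sinh r)\<^sup>2 * (4 * pi * sph_avg (\<lambda>w. extend f (hpol x r w)))"
    by (rule integral_sphere_measure[OF x r continuous_on_extend[OF f]])
  finally have 1: "(\<integral>y. f y \<partial>sphere_measure x r) = (sinh r)\<^sup>2 * (4 * pi * sph_avg (\<lambda>w. extend f (hpol x r w)))" .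
  have "measure (sphere_measure x r) (geodesic_sphere x r) = (\<integral>y. 1 \<partial>sphere_measure x r)"
    by (simp add: sp)
  also have "\<dots> = (sinh r)\<^sup>2 * (4 * pi)"
    by (subst integral_sphere_measure[OF x r]) auto
  finally show ?thesis using r 1 by (simp add: sphere_mean_def)
qed

text \<open>For \<open>t \<ge> 0\<close> this is \<open>I(t,x,g)\<close>; for \<open>t < 0\<close> it is the odd continuation, which is the solution operator
  backward in time.\<close>

definition wave_op :: "real \<Rightarrow> (mpoint \<Rightarrow> real) \<Rightarrow> mpoint \<Rightarrow> real" where
  "wave_op t g x = sinh t * sph_avg (\<lambda>w. g (hpol x \<bar>t\<bar> w))"

lemma hwave_eq:
  assumes "x \<in> H3" "t \<ge> 0" "continuous_on H3 f"
  shows "hwave t x f = wave_op t (extend f) x"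
  using assms by (simp add: hwave_def wave_op_def sphere_mean_eq)

section \<open>Antiderivatives and averages of zonal functions\<close>

lemma antiderivative_exists:
  fixes f :: "real \<Rightarrow> real"
  assumes "continuous_on UNIV f"
  obtains F where "\<And>x. (F has_real_derivative f x) (at x)"
proof -
  have "\<exists>F. \<forall>x::real. - \<infinity> < ereal x \<longrightarrow> ereal x < \<infinity> \<longrightarrow> (F has_vector_derivative f x) (at x)"
    by (rule einterval_antiderivative) (use assms in \<open>auto simp: continuous_on_eq_continuous_at\<close>)
  thus ?thesis using that by (auto simp: has_real_derivative_iff_has_vector_derivative)
qed

lemma integral_FTC:
  fixes F f :: "real \<Rightarrow> real"
  assumes "\<And>x. (F has_real_derivative f x) (at x)" "a \<le> b"
  shows "integral {a..b} f = F b - F a"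
  by (rule integral_unique, rule fundamental_theorem_of_calculus)
    (use assms in \<open>auto simp: has_real_derivative_iff_has_vector_derivative intro: has_vector_derivative_at_within\<close>)

text \<open>The mean of a zonal function does not depend on its axis: for \<open>\<Phi> = sin \<alpha> sin \<theta> cos (\<phi> - \<beta>) + cos \<alpha> cos \<theta>\<close>,
  \<open>sin \<theta> \<partial>\<^sub>\<alpha> \<psi>(R\<Phi>) = \<partial>\<^sub>\<phi>(cos \<theta> sin (\<phi> - \<beta>) \<psi>(R\<Phi>)) - \<partial>\<^sub>\<theta>(sin \<theta> cos (\<phi> - \<beta>) \<psi>(R\<Phi>))\<close>,
  and both terms on the right integrate to \<open>0\<close>.\<close>

lemma zonal_integral:
  fixes \<psi> \<psi>' :: "real \<Rightarrow> real"
  assumes d: "\<And>x. (\<psi> has_real_derivative \<psi>' x) (at x)" and c: "continuous_on UNIV \<psi>'"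
  shows "integral sph_box (\<lambda>z. sin (fst z) *
      \<psi> (R * (sin \<alpha> * sin (fst z) * cos (snd z - \<beta>) + cos \<alpha> * cos (fst z))))
    = 2 * pi * integral {-1..1} (\<lambda>s. \<psi> (R * s))"
proof -
  have c0: "continuous_on UNIV \<psi>"
    using d by (meson DERIV_isCont continuous_at_imp_continuous_on)
  note ci = continuous_on_UNIV_comp[OF c0] continuous_on_UNIV_comp[OF c]
  note dc = DERIV_chain2[OF d]
  define \<Phi> where "\<Phi> a t p = R * (sin a * sin t * cos (p - \<beta>) + cos a * cos t)" for a t p
  define I where "I a = integral sph_box (\<lambda>z. sin (fst z) * \<psi> (\<Phi> a (fst z) (snd z)))" for a
  define X' where "X' a t p = cos t * cos (p - \<beta>) * \<psi> (\<Phi> a t p) + sin t * cos (p - \<beta>) *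
    (\<psi>' (\<Phi> a t p) * (R * (sin a * cos t * cos (p - \<beta>) - cos a * sin t)))" for a t p
  define Y' where "Y' a t p = cos t * cos (p - \<beta>) * \<psi> (\<Phi> a t p) - cos t * sin (p - \<beta>) *
    (\<psi>' (\<Phi> a t p) * (R * (sin a * sin t * sin (p - \<beta>))))" for a t p
  have cX: "continuous_on UNIV (\<lambda>(t, p). X' a t p)" and cY: "continuous_on UNIV (\<lambda>(t, p). Y' a t p)" for a
    unfolding X'_def Y'_def \<Phi>_def case_prod_unfold by (intro continuous_intros ci)+
  have iX: "integral (cbox 0 pi) (\<lambda>t. X' a t p) = 0" for a p
  proof -
    have "((\<lambda>t. sin t * cos (p - \<beta>) * \<psi> (\<Phi> a t p)) has_real_derivative X' a t p) (at t)" for t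
      unfolding X'_def \<Phi>_def
      by (auto intro!: derivative_eq_intros dc simp: algebra_simps)
    from integral_FTC[OF this, of 0 pi] show ?thesis by simp
  qed
  have iY: "integral (cbox 0 (2*pi)) (\<lambda>p. Y' a t p) = 0" for a t
  proof -
    have "((\<lambda>p. cos t * sin (p - \<beta>) * \<psi> (\<Phi> a t p)) has_real_derivative Y' a t p) (at p)" for p
      unfolding Y'_def \<Phi>_def
      by (auto intro!: derivative_eq_intros dc simp: algebra_simps)
    from integral_FTC[OF this, of 0 "2*pi"] show ?thesis by (simp add: \<Phi>_def cos_diff sin_diff)
  qed
  have IX: "integral sph_box (\<lambda>(t, p). X' a t p) = 0" for a
  proof -
    have "integral sph_box (\<lambda>(t, p). X' a t p)
        = integral (cbox 0 pi) (\<lambda>t. integral (cbox 0 (2*pi)) (X' a t))"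
      unfolding sph_box_def by (subst integral_prod_continuous)
        (auto intro: continuous_on_subset[OF cX])
    also have "\<dots> = integral (cbox 0 (2*pi)) (\<lambda>p. integral (cbox 0 pi) (\<lambda>t. X' a t p))"
      by (rule integral_swap_continuous) (rule continuous_on_subset[OF cX subset_UNIV])
    finally show ?thesis unfolding iX by simp
  qed
  have IY: "integral sph_box (\<lambda>(t, p). Y' a t p) = 0" for a
  proof -
    have "integral sph_box (\<lambda>(t, p). Y' a t p)
        = integral (cbox 0 pi) (\<lambda>t. integral (cbox 0 (2*pi)) (Y' a t))"
      unfolding sph_box_def by (subst integral_prod_continuous)
        (auto intro: continuous_on_subset[OF cY])
    thus ?thesis unfolding iY by simp
  qed
  define D where "D a t p = sin t * (\<psi>' (\<Phi> a t p) * (R * (cos a * sin t * cos (p - \<beta>) - sin a * cos t)))" for a t p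
  have D: "D a t p = Y' a t p - X' a t p" for a t p
  proof -
    have "(sin (p - \<beta>))\<^sup>2 = 1 - (cos (p - \<beta>))\<^sup>2" by (simp add: sin_squared_eq)
    thus ?thesis unfolding D_def X'_def Y'_def by algebra
  qed
  have ID: "integral sph_box (\<lambda>z. D a (fst z) (snd z)) = 0" for a
  proof -
    have "integral sph_box (\<lambda>z. (case z of (t, p) \<Rightarrow> Y' a t p) - (case z of (t, p) \<Rightarrow> X' a t p)) = 0"
      unfolding sph_box_def
      by (subst integral_diff)
        (auto simp: IX IY sph_box_def[symmetric]
          intro!: integrable_continuous[of "(0, 0)" "(pi, 2*pi)", folded sph_box_def]
            continuous_on_subset[OF cX] continuous_on_subset[OF cY])
    thus ?thesis by (simp add: D case_prod_unfold)
  qed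
  have "(I has_real_derivative 0) (at a)" for a
  proof -
    have "((\<lambda>a. integral (cbox (0, 0) (pi, 2 * pi)) (\<lambda>z. sin (fst z) * \<psi> (\<Phi> a (fst z) (snd z))))
      has_real_derivative integral (cbox (0, 0) (pi, 2 * pi)) (\<lambda>z. D a (fst z) (snd z))) (at a within UNIV)"
    proof (rule leibniz_rule_field_derivative[where U = UNIV])
      fix a and z :: "real \<times> real"
      show "((\<lambda>a. sin (fst z) * \<psi> (\<Phi> a (fst z) (snd z))) has_real_derivative D a (fst z) (snd z)) (at a within UNIV)"
        unfolding D_def \<Phi>_def by (auto intro!: derivative_eq_intros dc simp: algebra_simps)
      show "(\<lambda>z. sin (fst z) * \<psi> (\<Phi> a (fst z) (snd z))) integrable_on cbox (0, 0) (pi, 2 * pi)"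
        unfolding \<Phi>_def by (intro integrable_continuous continuous_intros ci)
      show "continuous_on (UNIV \<times> cbox (0, 0) (pi, 2 * pi)) (\<lambda>(a, z). D a (fst z) (snd z))"
        unfolding D_def \<Phi>_def case_prod_unfold by (intro continuous_intros ci)
    qed auto
    thus ?thesis unfolding sph_box_def[symmetric] ID by (simp add: I_def[abs_def])
  qed
  \<comment> \<open>At \<open>\<alpha> = 0\<close> the axis is the pole: the integrand no longer
    depends on the azimuth, and only the substitution \<open>s = cos t\<close> remains.\<close>
  hence "I \<alpha> = I 0" using DERIV_isconst_all by blast
  also have "I 0 = integral (cbox 0 pi) (\<lambda>t. integral (cbox 0 (2*pi)) (\<lambda>p::real. sin t * \<psi> (R * cos t)))"
    unfolding I_def sph_box_def
    by (subst integral_prod_continuous) (auto simp: \<Phi>_def intro!: continuous_intros ci)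
  also have "\<dots> = integral {0..pi} (\<lambda>t. 2 * pi * (sin t * \<psi> (R * cos t)))"
    by (simp add: mult_ac)
  also have "\<dots> = 2 * pi * integral {0..pi} (\<lambda>t. sin t * \<psi> (R * cos t))"
    by (rule integral_mult_right)
  also have "integral {0..pi} (\<lambda>t. sin t * \<psi> (R * cos t)) = integral {-1..1} (\<lambda>s. \<psi> (R * s))"
  proof -
    obtain P where P: "(P has_real_derivative \<psi> (R * s)) (at s)" for s
      using antiderivative_exists[of "\<lambda>s. \<psi> (R * s)"] by (metis continuous_on_UNIV_comp[OF c0] continuous_on_mult_const)
    have "((\<lambda>t. - P (cos t)) has_real_derivative sin t * \<psi> (R * cos t)) (at t)" for t
      by (auto intro!: derivative_eq_intros DERIV_chain2[OF P])
    from integral_FTC[OF this, of 0 pi] integral_FTC[OF P, of "-1" 1] show ?thesis by simp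
  qed
  finally show ?thesis by (simp add: I_def \<Phi>_def)
qed

lemma sphere_param_ex: "\<exists>\<alpha> \<beta>. w = norm w *\<^sub>R sph \<alpha> \<beta>"
proof (cases "w = 0")
  case False
  have "w /\<^sub>R norm w \<in> (\<lambda>(\<theta>, \<phi>). sph \<theta> \<phi>) ` ({0..pi} \<times> {0..2*pi})"
    unfolding sph_image using False by simp
  then obtain \<alpha> \<beta> where "w /\<^sub>R norm w = sph \<alpha> \<beta>" by (elim imageE) (auto split: prod.splits)
  hence "w = norm w *\<^sub>R sph \<alpha> \<beta>" using False by (metis divideR_right norm_eq_zero)
  thus ?thesis by blast
qed auto

text \<open>Archimedes: normalized area projects to the uniform distribution on an axis. As
  \<open>zonal_integral\<close> needs a differentiable profile, it is applied to an antiderivative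
  \<open>\<Psi>\<close> shifted by \<open>a\<close>, and the identity is then differentiated in
  \<open>a\<close>.\<close>

lemma sph_avg_zonal:
  assumes c: "continuous_on UNIV \<psi>"
  shows "sph_avg (\<lambda>v. \<psi> (A + w \<bullet> v)) = integral {-1..1} (\<lambda>s. \<psi> (A + norm w * s)) / 2"
proof -
  obtain \<Psi> where \<Psi>: "(\<Psi> has_real_derivative \<psi> x) (at x)" for x
    using antiderivative_exists[OF c] by blast
  obtain \<alpha> \<beta> where ab: "w = norm w *\<^sub>R sph \<alpha> \<beta>" using sphere_param_ex by blast
  have wi: "w \<bullet> sph t p = norm w * (sin \<alpha> * sin t * cos (p - \<beta>) + cos \<alpha> * cos t)" for t p
    by (subst ab) (simp add: inner_vec3 sph_def cos_diff algebra_simps)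
  have sh: "((\<lambda>x. \<Psi> (a + x)) has_real_derivative \<psi> (a + x)) (at x)" for a x
    using DERIV_chain2[OF \<Psi>, of "\<lambda>x. a + x" 1 x UNIV] DERIV_shift[of "\<lambda>x. x" 1 x a]
    by (simp add: add.commute DERIV_ident)
  have sh': "((\<lambda>a. \<Psi> (a + x)) has_real_derivative \<psi> (a + x)) (at a)" for a x
    using sh[of x a] by (simp add: add.commute)
  have 1: "sph_avg (\<lambda>v. \<Psi> (a + w \<bullet> v)) = integral {-1..1} (\<lambda>s. \<Psi> (a + norm w * s)) / 2" for a
    unfolding sph_avg_def wi
    by (subst zonal_integral[where \<psi> = "\<lambda>x. \<Psi> (a + x)" and \<psi>' = "\<lambda>x. \<psi> (a + x)"])
      (auto intro!: sh continuous_intros continuous_on_UNIV_comp[OF c])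
  have c\<Psi>: "continuous_on UNIV \<Psi>"
    using \<Psi> by (meson DERIV_isCont continuous_at_imp_continuous_on)
  have "((\<lambda>a. sph_avg (\<lambda>v. \<Psi> (a + w \<bullet> v))) has_real_derivative sph_avg (\<lambda>v. \<psi> (A + w \<bullet> v))) (at A)"
    by (rule sph_avg_has_derivative)
      (auto simp: case_prod_unfold intro!: sh' continuous_intros
        continuous_on_UNIV_comp[OF c] continuous_on_UNIV_comp[OF c\<Psi>])
  moreover have "((\<lambda>a. integral (cbox (-1) 1) (\<lambda>s. \<Psi> (a + norm w * s))) has_real_derivative
      integral (cbox (-1) 1) (\<lambda>s. \<psi> (A + norm w * s))) (at A within UNIV)"
    by (rule leibniz_rule_field_derivative[where U = UNIV])
      (auto simp: case_prod_unfold intro!: sh' continuous_intros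
        continuous_on_UNIV_comp[OF c] continuous_on_UNIV_comp[OF c\<Psi>] integrable_continuous_real)
  hence "((\<lambda>a. sph_avg (\<lambda>v. \<Psi> (a + w \<bullet> v))) has_real_derivative
      integral {-1..1} (\<lambda>s. \<psi> (A + norm w * s)) / 2) (at A)"
    unfolding 1 by (intro DERIV_cdivide) simp
  ultimately show ?thesis by (rule DERIV_unique)
qed

section \<open>The wave operator on zonal functions\<close>

lemma DERIV_comp:
  fixes F f g :: "real \<Rightarrow> real"
  assumes "\<And>c. (F has_real_derivative f c) (at c)" "(g has_real_derivative g') (at x)" "f (g x) * g' = D"
  shows "((\<lambda>x. F (g x)) has_real_derivative D) (at x)"
  using DERIV_chain2[OF assms(1,2)] assms(3) by simp

lemma continuous_on_wave_op:
  fixes T :: "'a::t2_space \<Rightarrow> real"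
  assumes "continuous_on UNIV T" "continuous_on UNIV X" "continuous_on UNIV (\<lambda>(p, y). G p y)"
  shows "continuous_on UNIV (\<lambda>p. wave_op (T p) (G p) (X p))"
proof -
  have "continuous_on UNIV (\<lambda>(p, w). G p (hpol (X p) \<bar>T p\<bar> w))"
    unfolding case_prod_unfold
    by (intro continuous_on_UNIV_comp2[OF assms(3)] continuous_on_hpol continuous_intros
        continuous_on_UNIV_comp[OF assms(1)] continuous_on_UNIV_comp[OF assms(2)])
  thus ?thesis unfolding wave_op_def
    by (intro continuous_intros continuous_on_sph_avg assms)
qed

lemma continuous_on_wave_op_const:
  assumes "continuous_on UNIV f"
  shows "continuous_on UNIV (\<lambda>y. wave_op t f y)" "continuous_on UNIV (\<lambda>t. wave_op t f x)"
  by (rule continuous_on_wave_op; auto simp: case_prod_unfold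
      intro!: continuous_intros continuous_on_UNIV_comp[OF assms])+

lemma continuous_on_hpol_arg:
  assumes "continuous_on UNIV f"
  shows "continuous_on UNIV (\<lambda>w. f (hpol x t w))"
  by (intro continuous_on_UNIV_comp[OF assms] continuous_on_hpol continuous_intros)

lemma wave_op_cong:
  assumes "x \<in> H3" "\<And>y. y \<in> H3 \<Longrightarrow> f y = g y"
  shows "wave_op t f x = wave_op t g x"
proof -
  have "sph_avg (\<lambda>w. f (hpol x \<bar>t\<bar> w)) = sph_avg (\<lambda>w. g (hpol x \<bar>t\<bar> w))"
    by (rule sph_avg_cong) (rule assms(2)[OF hpol_H3[OF assms(1)]])
  thus ?thesis by (simp add: wave_op_def)
qed

lemma wave_op_0 [simp]: "wave_op 0 f x = 0"
  by (simp add: wave_op_def)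

lemma wave_op_minus: "wave_op (- t) f x = - wave_op t f x"
  by (simp add: wave_op_def)

lemma wave_op_add:
  assumes "continuous_on UNIV f" "continuous_on UNIV g"
  shows "wave_op t (\<lambda>y. f y + g y) x = wave_op t f x + wave_op t g x"
  unfolding wave_op_def
  by (subst sph_avg_add) (auto intro!: continuous_on_hpol_arg assms simp: algebra_simps)

lemma wave_op_cmult: "wave_op t (\<lambda>y. c * f y) x = c * wave_op t f x"
  by (simp add: wave_op_def)

lemma wave_op_zero [simp]: "wave_op t (\<lambda>y. 0) x = 0"
  by (simp add: wave_op_def)

lemma wave_op_mono:
  assumes "t \<ge> 0" "continuous_on UNIV f" "continuous_on UNIV g"
    "\<And>w. norm w = 1 \<Longrightarrow> f (hpol x t w) \<le> g (hpol x t w)"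
  shows "wave_op t f x \<le> wave_op t g x"
  unfolding wave_op_def
  by (intro mult_left_mono sph_avg_mono continuous_on_hpol_arg assms) (use assms in auto)

lemma wave_op_abs_diff_le:
  assumes "continuous_on UNIV f" "continuous_on UNIV g"
    "\<And>w. norm w = 1 \<Longrightarrow> \<bar>f (hpol x \<bar>t\<bar> w) - g (hpol x \<bar>t\<bar> w)\<bar> \<le> e"
  shows "\<bar>wave_op t f x - wave_op t g x\<bar> \<le> \<bar>sinh t\<bar> * e"
proof -
  have "\<bar>sph_avg (\<lambda>w. f (hpol x \<bar>t\<bar> w)) - sph_avg (\<lambda>w. g (hpol x \<bar>t\<bar> w))\<bar> \<le> e"
    by (intro sph_avg_abs_diff_le continuous_on_hpol_arg assms)
  thus ?thesis unfolding wave_op_def right_diff_distrib[symmetric] abs_mult by (intro mult_left_mono) auto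
qed

section \<open>Distance, polar coordinates and the Minkowski form\<close>

lemma cosh_hdist: "x \<in> H3 \<Longrightarrow> y \<in> H3 \<Longrightarrow> cosh (hdist x y) = - mink x y"
  using mink_H3_le[of x y] by (simp add: hdist_def)

lemma hdist_nonneg [simp]: "x \<in> H3 \<Longrightarrow> y \<in> H3 \<Longrightarrow> hdist x y \<ge> 0"
  using mink_H3_le[of x y] by (simp add: hdist_def)

lemma hdist_commute: "hdist x y = hdist y x"
  by (simp add: hdist_def mink_commute)

lemma hdist_hpol:
  assumes "x \<in> H3" "t \<ge> 0"
  shows "hdist x (hpol x t w) = t"
  using assms mink_hpolar(1)[OF assms(1)] by (simp add: hdist_def hpol_H3_eq arcosh_cosh_real)

lemma hpol_surj:
  assumes "x \<in> H3" "y \<in> H3"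
  shows "\<exists>w. norm w = 1 \<and> y = hpol x (hdist x y) w"
proof (cases "hdist x y = 0")
  case False
  hence r: "hdist x y > 0" using hdist_nonneg[OF assms] by simp
  have "y \<in> geodesic_sphere x (hdist x y)" using assms by (simp add: geodesic_sphere_def)
  hence "y \<in> hpolar x (hdist x y) ` sphere 0 1" using hpolar_image[OF assms(1) r] by simp
  thus ?thesis using hpol_H3_eq[OF assms(1)] by auto
next
  case True
  hence c: "mink x y = - 1" using cosh_hdist[OF assms] by simp
  have xx: "mink x x = - 1" and yy: "mink y y = - 1" using assms by (auto simp: H3_def)
  \<comment> \<open>At distance zero the difference \<open>y - x\<close> is tangent at
    \<open>x\<close> and null for \<open>mink\<close>, which is positive definite on the tangent
    space.\<close>
  define z where "z = y + (- 1) *\<^sub>R x"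
  have "mink x z = 0" unfolding z_def mink_linear c xx by simp
  then obtain v where v: "z = boost x v" using boost_onto_tangent[OF assms(1)] by blast
  have "v \<bullet> v = mink z z" by (simp add: v mink_boost_boost assms)
  also have "\<dots> = 0" unfolding z_def mink_linear c xx yy mink_commute[of y x] by simp
  finally have "v = 0" by simp
  hence "z = 0" by (simp add: v boost_def zero_prod_def)
  hence "y = x" by (simp add: z_def)
  moreover have "norm (axis 1 1 :: real ^ 3) = 1" by simp
  ultimately show ?thesis using True by fastforce
qed

text \<open>The component of \<open>q\<close> tangent at \<open>x\<close>, read in the frame
  \<open>boost x\<close>. It makes \<open>mink q\<close> on a geodesic sphere about \<open>x\<close>
  an affine function of the direction; its length is the hyperbolic sine of the distance.\<close>

definition zonal_dir :: "mpoint \<Rightarrow> mpoint \<Rightarrow> real ^ 3" where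
  "zonal_dir q x = snd q + ((snd q \<bullet> snd x) / (1 + fst x) - fst q) *\<^sub>R snd x"

lemma mink_hpol:
  assumes "x \<in> H3"
  shows "mink q (hpol x t v) = cosh t * mink q x + sinh t * (zonal_dir q x \<bullet> v)"
proof -
  have "mink q (boost x v) = zonal_dir q x \<bullet> v"
    by (simp add: mink_def boost_def zonal_dir_def inner_add_left inner_add_right inner_diff_left algebra_simps)
  thus ?thesis by (simp add: hpol_H3_eq[OF assms] hpolar_def mink_linear)
qed

lemma norm_zonal_dir:
  assumes "q \<in> H3" "x \<in> H3"
  shows "norm (zonal_dir q x) = sqrt ((mink q x)\<^sup>2 - 1)"
proof -
  obtain a \<xi> where x: "x = (a, \<xi>)" by (cases x)
  obtain b \<eta> where q: "q = (b, \<eta>)" by (cases q)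
  have a: "a > 0" and s: "\<xi> \<bullet> \<xi> = a\<^sup>2 - 1" and e: "\<eta> \<bullet> \<eta> = b\<^sup>2 - 1"
    using H3_D[OF assms(1)] H3_D[OF assms(2)] by (auto simp: x q)
  define k where "k = \<eta> \<bullet> \<xi> / (1 + a) - b"
  have k: "\<eta> \<bullet> \<xi> = (k + b) * (1 + a)" using a by (simp add: k_def)
  have "zonal_dir q x \<bullet> zonal_dir q x = \<eta> \<bullet> \<eta> + 2 * k * (\<eta> \<bullet> \<xi>) + k * k * (\<xi> \<bullet> \<xi>)"
    by (simp add: zonal_dir_def x q k_def[symmetric] inner_add_left inner_add_right inner_commute algebra_simps)
  also have "\<dots> = (mink q x)\<^sup>2 - 1"
    unfolding s e by (simp add: mink_def x q k power2_eq_square algebra_simps)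
  finally show ?thesis by (simp add: norm_eq_sqrt_inner)
qed

text \<open>The variable \<open>c\<close> is the hyperbolic cosine of the distance to the centre.
  Since \<open>- mink q y\<close> is linear in \<open>y\<close>, a continuous profile in this
  variable gives a zonal function continuous on the ambient space, to which the propagator can be
  applied again.\<close>

definition zonal_op :: "(real \<Rightarrow> real) \<Rightarrow> real \<Rightarrow> real \<Rightarrow> real" where
  "zonal_op \<phi> t c = sinh t *
    (integral {-1..1} (\<lambda>s. \<phi> (cosh t * c + sinh \<bar>t\<bar> * sqrt (max 0 (c\<^sup>2 - 1)) * s)) / 2)"

lemma wave_op_zonal:
  assumes "q \<in> H3" "x \<in> H3" "continuous_on UNIV \<phi>"
  shows "wave_op t (\<lambda>y. \<phi> (- mink q y)) x = zonal_op \<phi> t (- mink q x)"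
proof -
  have "(mink q x)\<^sup>2 \<ge> 1" using mink_H3_le[OF assms(1,2)] one_le_power[of "- mink q x" 2] by simp
  moreover have "(\<lambda>w. \<phi> (- mink q (hpol x \<bar>t\<bar> w)))
      = (\<lambda>v. \<phi> (cosh t * (- mink q x) + ((- sinh \<bar>t\<bar>) *\<^sub>R zonal_dir q x) \<bullet> v))"
    by (simp add: mink_hpol[OF assms(2)])
  moreover have "norm ((- sinh \<bar>t\<bar>) *\<^sub>R zonal_dir q x) = sinh \<bar>t\<bar> * sqrt ((mink q x)\<^sup>2 - 1)"
    by (simp add: norm_zonal_dir[OF assms(1,2)])
  ultimately show ?thesis unfolding wave_op_def zonal_op_def
    by (simp only: sph_avg_zonal[OF assms(3)]) (simp add: max_def)
qed

lemma continuous_on_zonal_op: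
  assumes "continuous_on UNIV \<phi>"
  shows "continuous_on UNIV (zonal_op \<phi> t)"
  unfolding zonal_op_def cbox_interval[symmetric]
  by (intro continuous_intros integral_continuous_on_param)
    (auto simp: case_prod_unfold intro!: continuous_intros continuous_on_UNIV_comp[OF assms])

text \<open>This is d'Alembert's formula: \<open>\<Phi>\<close> composed with \<open>cosh\<close> is
  an antiderivative of \<open>sinh \<rho> * \<phi> (cosh \<rho>)\<close>. Evenness of
  \<open>cosh\<close> supplies the reflection at the centre. The sign of
  \<open>sinh \<rho> * sinh t\<close> only decides which end of the interval is
  \<open>cosh (\<rho> + t)\<close>.\<close>

lemma zonal_op_cosh:
  assumes d: "\<And>c. (\<Phi> has_real_derivative \<phi> c) (at c)"
  shows "sinh \<rho> * zonal_op \<phi> t (cosh \<rho>) = (\<Phi> (cosh (\<rho> + t)) - \<Phi> (cosh (\<rho> - t))) / 2"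
proof -
  have q: "sqrt (max 0 ((cosh \<rho>)\<^sup>2 - 1)) = \<bar>sinh \<rho>\<bar>"
    by (simp add: cosh_square_eq max_def)
  define A where "A = cosh t * cosh \<rho>"
  define B where "B = \<bar>sinh t\<bar> * \<bar>sinh \<rho>\<bar>"
  have "((\<lambda>s. \<Phi> (A + B * s)) has_real_derivative B * \<phi> (A + B * s)) (at s)" for s
    by (rule DERIV_comp[OF d]) (auto intro!: derivative_eq_intros)
  from integral_FTC[OF this, of "-1" 1]
  have i: "B * integral {-1..1} (\<lambda>s. \<phi> (A + B * s)) = \<Phi> (A + B) - \<Phi> (A - B)" by simp
  have "sinh \<bar>t\<bar> = \<bar>sinh t\<bar>" by (simp add: abs_if)
  hence z: "sinh \<rho> * zonal_op \<phi> t (cosh \<rho>) = sinh \<rho> * sinh t * integral {-1..1} (\<lambda>s. \<phi> (A + B * s)) / 2"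
    by (simp add: zonal_op_def q A_def B_def)
  define J where "J = integral {-1..1} (\<lambda>s. \<phi> (A + B * s))"
  have "sinh \<rho> * sinh t * J = \<Phi> (cosh (\<rho> + t)) - \<Phi> (cosh (\<rho> - t))"
  proof (cases "sinh \<rho> * sinh t \<ge> 0")
    case True
    hence B: "B = sinh \<rho> * sinh t" by (simp add: B_def mult.commute flip: abs_mult)
    hence "A + B = cosh (\<rho> + t)" "A - B = cosh (\<rho> - t)"
      by (simp_all add: A_def cosh_add cosh_diff mult.commute)
    thus ?thesis using i by (simp add: J_def flip: B)
  next
    case False
    hence B: "B = - (sinh \<rho> * sinh t)" by (simp add: B_def mult.commute flip: abs_mult)
    hence "A + B = cosh (\<rho> - t)" "A - B = cosh (\<rho> + t)"
      by (simp_all add: A_def cosh_add cosh_diff mult.commute)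
    hence "B * J = \<Phi> (cosh (\<rho> - t)) - \<Phi> (cosh (\<rho> + t))" using i by (simp add: J_def)
    thus ?thesis unfolding B by simp
  qed
  thus ?thesis unfolding z J_def by simp
qed

lemma has_derivative_comp_cosh:
  assumes d: "\<And>c. (\<Phi> has_real_derivative \<phi> c) (at c)"
  shows "((\<lambda>\<rho>. \<Phi> (cosh \<rho>)) has_real_derivative sinh \<rho> * \<phi> (cosh \<rho>)) (at \<rho>)"
  by (rule DERIV_comp[OF d]) (auto intro!: derivative_eq_intros)

lemma wave_op_zonal_FTC:
  assumes "q \<in> H3" "x \<in> H3" "\<And>c. (\<Phi> has_real_derivative \<phi> c) (at c)" "continuous_on UNIV \<phi>"
  shows "sinh (hdist q x) * wave_op t (\<lambda>y. \<phi> (- mink q y)) x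
    = (\<Phi> (cosh (hdist q x + t)) - \<Phi> (cosh (hdist q x - t))) / 2"
  using wave_op_zonal[OF assms(1,2,4), of t] zonal_op_cosh[OF assms(3), of "hdist q x" t]
    cosh_hdist[OF assms(1,2)] by simp

text \<open>The operator form of 2 sin a sin h = cos (a - h) - cos (a + h). After multiplication by
  \<open>sinh (hdist q x)\<close> both sides are d'Alembert expressions in one variable.\<close>

lemma wave_op_wave_op_zonal:
  assumes q: "q \<in> H3" and x: "x \<in> H3" and c: "continuous_on UNIV \<phi>" and h: "h \<ge> 0"
  shows "wave_op h (wave_op a (\<lambda>y. \<phi> (- mink q y))) x = integral {a-h..a+h} (\<lambda>\<rho>. wave_op \<rho> (\<lambda>y. \<phi> (- mink q y)) x) / 2"
proof -
  let ?f = "\<lambda>y. \<phi> (- mink q y)"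
  have cf: "continuous_on UNIV ?f" unfolding mink_def
    by (intro continuous_on_UNIV_comp[OF c] continuous_intros)
  obtain \<Phi> where \<Phi>: "(\<Phi> has_real_derivative \<phi> c) (at c)" for c
    using antiderivative_exists[OF c] by blast
  obtain \<Phi>1 where \<Phi>1: "(\<Phi>1 has_real_derivative zonal_op \<phi> a c) (at c)" for c
    using antiderivative_exists[OF continuous_on_zonal_op[OF c]] by blast
  have c\<Phi>: "continuous_on UNIV \<Phi>"
    using \<Phi> by (meson DERIV_isCont continuous_at_imp_continuous_on)
  obtain Q where Q: "(Q has_real_derivative \<Phi> (cosh r)) (at r)" for r
  proof -
    have "continuous_on UNIV (\<lambda>r. \<Phi> (cosh r))"
      by (intro continuous_on_UNIV_comp[OF c\<Phi>] continuous_on_cosh continuous_on_id)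
    thus ?thesis using antiderivative_exists that by blast
  qed
  have Qp: "((\<lambda>r. Q (k + r)) has_real_derivative \<Phi> (cosh (k + r))) (at r)" for k r
    by (rule DERIV_comp[OF Q, where g' = 1]) (auto intro!: derivative_eq_intros)
  have Qm: "((\<lambda>r. Q (k - r)) has_real_derivative - \<Phi> (cosh (k - r))) (at r)" for k r
    by (rule DERIV_comp[OF Q, where g' = "-1"]) (auto intro!: derivative_eq_intros)
  have ar: "(A + D) / 2 - (C + B) / 2 = 2 * ((A - B - C + D) / 4)" for A B C D :: real
    by (simp add: field_simps)
  have gen: "wave_op h (wave_op a ?f) x = integral {a-h..a+h} (\<lambda>\<rho>. wave_op \<rho> ?f x) / 2"
    if x: "x \<in> H3" and pos: "hdist q x > 0" for x
  proof -
    let ?d = "hdist q x"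
    have "wave_op h (wave_op a ?f) x = wave_op h (\<lambda>y. zonal_op \<phi> a (- mink q y)) x"
      by (rule wave_op_cong[OF x wave_op_zonal[OF q _ c]])
    hence L: "sinh ?d * wave_op h (wave_op a ?f) x = (\<Phi>1 (cosh (?d + h)) - \<Phi>1 (cosh (?d - h))) / 2"
      using wave_op_zonal_FTC[OF q x \<Phi>1 continuous_on_zonal_op[OF c]] by simp
    \<comment> \<open>By \<open>zonal_op_cosh\<close> the derivative of
      \<open>\<Phi>1 (cosh r)\<close> is half a difference of shifted copies of
      \<open>\<Phi> (cosh r)\<close>; \<open>E\<close> subtracts their antiderivatives, hence is
      constant.\<close>
    define E where "E r = \<Phi>1 (cosh r) - (Q (a + r) + - Q (- a + r)) / 2" for r
    have "(E has_real_derivative sinh r * zonal_op \<phi> a (cosh r)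
        - (\<Phi> (cosh (a + r)) + - \<Phi> (cosh (- a + r))) / 2) (at r)" for r
      unfolding E_def by (intro DERIV_diff DERIV_cdivide DERIV_add DERIV_minus Qp
          has_derivative_comp_cosh[OF \<Phi>1])
    hence "(E has_real_derivative 0) (at r)" for r
      unfolding zonal_op_cosh[OF \<Phi>] by (simp add: algebra_simps)
    hence "E (?d + h) = E (?d - h)" using DERIV_isconst_all by blast
    hence L2: "sinh ?d * wave_op h (wave_op a ?f) x
        = (Q (a + ?d + h) - Q (?d + h - a) - Q (a + ?d - h) + Q (?d - h - a)) / 4"
      unfolding L by (simp add: E_def field_simps)
    have "((\<lambda>\<rho>. (Q (?d + \<rho>) + Q (?d - \<rho>)) / 2) has_real_derivative sinh ?d * wave_op \<rho> ?f x) (at \<rho>)" for \<rho>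
      unfolding wave_op_zonal_FTC[OF q x \<Phi> c]
      using DERIV_cdivide[OF DERIV_add[OF Qp[of ?d \<rho>] Qm[of ?d \<rho>]], of 2] by simp
    from integral_FTC[OF this, of "a - h" "a + h"] h
    have "sinh ?d * integral {a-h..a+h} (\<lambda>\<rho>. wave_op \<rho> ?f x)
        = (Q (?d + (a + h)) + Q (?d - (a + h))) / 2 - (Q (?d + (a - h)) + Q (?d - (a - h))) / 2"
      by simp
    also have "?d + (a + h) = a + ?d + h" by simp
    also have "?d - (a + h) = ?d - h - a" by simp
    also have "?d + (a - h) = a + ?d - h" by simp
    also have "?d - (a - h) = ?d + h - a" by simp
    finally have "sinh ?d * integral {a-h..a+h} (\<lambda>\<rho>. wave_op \<rho> ?f x) = 2 * (sinh ?d * wave_op h (wave_op a ?f) x)"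
      unfolding L2 using ar by metis
    hence "integral {a-h..a+h} (\<lambda>\<rho>. wave_op \<rho> ?f x) = 2 * wave_op h (wave_op a ?f) x" using pos by simp
    thus ?thesis by simp
  qed
  show ?thesis
  proof (cases "hdist q x = 0")
    case False
    thus ?thesis using gen[OF x] hdist_nonneg[OF q x] by linarith
  next
    case True
    hence xq: "x = q" using hpol_surj[OF q x] by auto
    \<comment> \<open>At the centre the factor \<open>sinh (hdist q x)\<close> vanishes and cannot
      be cancelled; the identity passes to the limit along a ray issuing from
      \<open>q\<close>.\<close>
    let ?e = "axis 1 1 :: real ^ 3"
    let ?G = "\<lambda>t. wave_op h (wave_op a ?f) (hpol q t ?e) - integral (cbox (a-h) (a+h)) (\<lambda>\<rho>. wave_op \<rho> ?f (hpol q t ?e)) / 2"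
    have 1: "continuous_on UNIV (\<lambda>t. wave_op h (wave_op a ?f) (hpol q t ?e))"
      by (intro continuous_on_UNIV_comp[OF continuous_on_wave_op_const(1)] continuous_on_wave_op_const cf
          continuous_on_hpol continuous_intros)
    have 2: "continuous_on UNIV (\<lambda>t. integral (cbox (a-h) (a+h)) (\<lambda>\<rho>. wave_op \<rho> ?f (hpol q t ?e)))"
    proof (rule integral_continuous_on_param)
      have "continuous_on UNIV (\<lambda>z. wave_op (snd z) ?f (hpol q (fst z) ?e))"
        by (rule continuous_on_wave_op)
          (auto intro!: continuous_intros continuous_on_UNIV_comp[OF cf] simp: case_prod_unfold)
      thus "continuous_on (UNIV \<times> cbox (a - h) (a + h)) (\<lambda>(t, \<rho>). wave_op \<rho> ?f (hpol q t ?e))"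
        by (auto simp: case_prod_unfold intro: continuous_on_subset)
    qed
    have cG: "continuous_on (closure {0<..<1}) ?G"
      by (rule continuous_on_subset[OF _ subset_UNIV]) (intro continuous_intros 1 2, auto)
    have "?G t = 0" if "t \<in> {0<..<1}" for t
      using gen[of "hpol q t ?e"] hdist_hpol[OF q, of t ?e] that q by simp
    hence "?G 0 = 0"
      by (rule continuous_constant_on_closure[OF cG]) (auto simp: closure_greaterThanLessThan)
    thus ?thesis by (simp add: xq)
  qed
qed

section \<open>The group law of the wave operator\<close>

definition wave_group_law :: "(mpoint \<Rightarrow> real) \<Rightarrow> bool" where
  "wave_group_law f \<longleftrightarrow> continuous_on UNIV f \<and> (\<forall>x\<in>H3. \<forall>h\<ge>0. \<forall>a.
     wave_op h (wave_op a f) x = integral {a-h..a+h} (\<lambda>\<rho>. wave_op \<rho> f x) / 2)"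

text \<open>Products of the exponentials stay in the span because future timelike vectors form a convex cone
  (\<open>timelike_sum\<close>); hence the Stone--Weierstrass theorem applies on compact subsets of \<open>H3\<close>.\<close>

inductive_set exp_span :: "(mpoint \<Rightarrow> real) set" where
  base: "q \<in> H3 \<Longrightarrow> \<kappa> \<ge> 0 \<Longrightarrow> (\<lambda>y. c * exp (\<kappa> * mink q y)) \<in> exp_span"
| add: "f \<in> exp_span \<Longrightarrow> g \<in> exp_span \<Longrightarrow> (\<lambda>y. f y + g y) \<in> exp_span"

lemma wave_group_law_exp_span: "f \<in> exp_span \<Longrightarrow> wave_group_law f"
proof (induction rule: exp_span.induct)
  case (base q \<kappa> c)
  define \<phi> where "\<phi> r = c * exp (- \<kappa> * r)" for r
  have c: "continuous_on UNIV \<phi>" unfolding \<phi>_def by (intro continuous_intros)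
  have e: "(\<lambda>y. c * exp (\<kappa> * mink q y)) = (\<lambda>y. \<phi> (- mink q y))" by (simp add: \<phi>_def)
  have "continuous_on UNIV (\<lambda>y. \<phi> (- mink q y))"
    unfolding mink_def by (intro continuous_on_UNIV_comp[OF c] continuous_intros)
  thus ?case unfolding wave_group_law_def e using wave_op_wave_op_zonal[OF base(1) _ c] by blast
next
  case (add f g)
  hence c: "continuous_on UNIV f" "continuous_on UNIV g" by (auto simp: wave_group_law_def)
  show ?case unfolding wave_group_law_def
  proof (intro conjI ballI allI impI)
    show "continuous_on UNIV (\<lambda>y. f y + g y)" by (intro continuous_intros c)
    fix x h a assume x: "x \<in> H3" and h: "(h::real) \<ge> 0"
    have "wave_op a (\<lambda>y. f y + g y) = (\<lambda>y. wave_op a f y + wave_op a g y)"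
      by (rule ext) (rule wave_op_add[OF c])
    hence "wave_op h (wave_op a (\<lambda>y. f y + g y)) x = wave_op h (\<lambda>y. wave_op a f y + wave_op a g y) x" by simp
    also have "\<dots> = wave_op h (wave_op a f) x + wave_op h (wave_op a g) x"
      by (rule wave_op_add) (intro continuous_on_wave_op_const c)+
    also have "\<dots> = (integral {a-h..a+h} (\<lambda>\<rho>. wave_op \<rho> f x) + integral {a-h..a+h} (\<lambda>\<rho>. wave_op \<rho> g x)) / 2"
    proof -
      have "wave_op h (wave_op a f) x = integral {a-h..a+h} (\<lambda>\<rho>. wave_op \<rho> f x) / 2"
        "wave_op h (wave_op a g) x = integral {a-h..a+h} (\<lambda>\<rho>. wave_op \<rho> g x) / 2"
        using add.IH x h unfolding wave_group_law_def by blast+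
      thus ?thesis by (simp only: add_divide_distrib)
    qed
    also have "integral {a-h..a+h} (\<lambda>\<rho>. wave_op \<rho> f x) + integral {a-h..a+h} (\<lambda>\<rho>. wave_op \<rho> g x)
        = integral {a-h..a+h} (\<lambda>\<rho>. wave_op \<rho> (\<lambda>y. f y + g y) x)"
      unfolding wave_op_add[OF c]
      by (rule integral_add[symmetric])
        (intro integrable_continuous_real continuous_on_subset[OF continuous_on_wave_op_const(2)] c subset_UNIV)+
    finally show "wave_op h (wave_op a (\<lambda>y. f y + g y)) x = integral {a-h..a+h} (\<lambda>\<rho>. wave_op \<rho> (\<lambda>y. f y + g y) x) / 2" .
  qed
qed

lemma timelike_sum:
  assumes "q \<in> H3" "q' \<in> H3" "\<kappa> \<ge> 0" "\<kappa>' \<ge> 0"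
  shows "\<exists>p\<in>H3. \<exists>k\<ge>0. \<kappa> *\<^sub>R q + \<kappa>' *\<^sub>R q' = k *\<^sub>R p"
proof (cases "\<kappa> = 0 \<and> \<kappa>' = 0")
  case True
  thus ?thesis using assms(1) by (auto intro!: bexI[of _ q] exI[of _ 0])
next
  case False
  define v where "v = \<kappa> *\<^sub>R q + \<kappa>' *\<^sub>R q'"
  have qq: "mink q q = -1" "mink q' q' = -1" "fst q > 0" "fst q' > 0" using assms by (auto simp: H3_def)
  have "- mink v v = \<kappa>\<^sup>2 + \<kappa>'\<^sup>2 + 2 * (\<kappa> * \<kappa>') * (- mink q q')"
    unfolding v_def mink_linear qq mink_commute[of q' q] by (simp add: power2_eq_square algebra_simps)
  moreover have "(\<kappa> * \<kappa>') * (- mink q q') \<ge> 0"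
    using mink_H3_le[OF assms(1,2)] assms(3,4) by (intro mult_nonneg_nonneg) auto
  moreover have "\<kappa>\<^sup>2 + \<kappa>'\<^sup>2 > 0" using False by (simp add: sum_power2_gt_zero_iff)
  ultimately have N: "- mink v v > 0" by linarith
  define k where "k = sqrt (- mink v v)"
  have k: "k > 0" "k * k = - mink v v" using N by (simp_all add: k_def)
  have "mink (v /\<^sub>R k) (v /\<^sub>R k) = -1"
    using k N by (simp add: mink_scale_left mink_scale_right field_simps)
  moreover have "fst v > 0"
    using False assms(3,4) qq(3,4) unfolding v_def
    by (cases "\<kappa> = 0") (auto intro!: add_pos_nonneg)
  ultimately have "v /\<^sub>R k \<in> H3" using k by (simp add: H3_def)
  moreover have "v = k *\<^sub>R (v /\<^sub>R k)" using k by simp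
  ultimately show ?thesis unfolding v_def[symmetric] using k(1) less_imp_le by blast
qed

lemma exp_span_mult: "f \<in> exp_span \<Longrightarrow> g \<in> exp_span \<Longrightarrow> (\<lambda>y. f y * g y) \<in> exp_span"
proof (induction rule: exp_span.induct)
  case (base q \<kappa> c)
  from base(3) show ?case
  proof (induction rule: exp_span.induct)
    case (base q' \<kappa>' c')
    obtain p k where pk: "p \<in> H3" "k \<ge> 0" "\<kappa> *\<^sub>R q + \<kappa>' *\<^sub>R q' = k *\<^sub>R p"
      using timelike_sum[OF \<open>q \<in> H3\<close> \<open>q' \<in> H3\<close> \<open>\<kappa> \<ge> 0\<close> \<open>\<kappa>' \<ge> 0\<close>] by blast
    have "\<kappa> * mink q y + \<kappa>' * mink q' y = k * mink p y" for y
      using arg_cong[OF pk(3), of "\<lambda>z. mink z y"] by (simp add: mink_linear)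
    hence e: "(\<lambda>y. c * exp (\<kappa> * mink q y) * (c' * exp (\<kappa>' * mink q' y)))
        = (\<lambda>y. (c * c') * exp (k * mink p y))"
      by (intro ext) (simp add: exp_add flip: \<open>\<And>y. _ = k * mink p y\<close>)
    show ?case unfolding e by (rule exp_span.base[OF pk(1,2)])
  next
    case (add f g)
    thus ?case using exp_span.add[OF add.IH] by (simp add: distrib_left)
  qed
next
  case (add f g)
  thus ?case using exp_span.add[of "\<lambda>y. f y * _ y"] by (simp add: distrib_right)
qed

lemma exp_span_separates:
  assumes "x \<in> H3" "y \<in> H3" "x \<noteq> y"
  shows "\<exists>f\<in>exp_span. f x \<noteq> f y"
proof (rule ccontr)
  assume c: "\<not> ?thesis"
  have eq: "mink q x = mink q y" if "q \<in> H3" for q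
    using c exp_span.base[OF that, of 1 1] by auto
  have "mink x y = -1" using eq[OF assms(2)] eq[OF assms(1)] assms by (auto simp: H3_def)
  hence "hdist x y = 0" by (simp add: hdist_def)
  thus False using hpol_surj[OF assms(1,2)] assms(3) by auto
qed

text \<open>Both sides depend only on the values of \<open>f\<close> on the compact set
  \<open>S\<close> and are Lipschitz for the supremum norm there, so the law passes from
  \<open>exp_span\<close> to its uniform closure. \<open>S\<close> collects the points reached by
  two successive arcs and those seen by the right-hand side.\<close>

lemma wave_op_wave_op:
  assumes f: "continuous_on UNIV f" and x: "x \<in> H3" and h: "h \<ge> 0"
  shows "wave_op h (wave_op a f) x = integral {a-h..a+h} (\<lambda>\<rho>. wave_op \<rho> f x) / 2"
proof -
  define S where "S = (\<lambda>z. hpol (hpol x \<bar>h\<bar> (fst z)) \<bar>a\<bar> (snd z)) ` (sphere 0 1 \<times> sphere 0 1)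
    \<union> (\<lambda>z. hpol x \<bar>fst z\<bar> (snd z)) ` ({a-h..a+h} \<times> sphere 0 1)"
  have "compact S" unfolding S_def
    by (intro compact_Un compact_continuous_image compact_Times compact_sphere compact_Icc
        continuous_on_hpol continuous_intros)
  have SH: "S \<subseteq> H3" unfolding S_def using x by auto
  interpret function_ring_on exp_span S
  proof
    show "compact S" by fact
    show "continuous_on S f" if "f \<in> exp_span" for f
      using wave_group_law_exp_span[OF that] by (auto simp: wave_group_law_def intro: continuous_on_subset)
    have "(1, 0) \<in> H3" by (simp add: H3_def mink_def)
    thus "(\<lambda>_. c) \<in> exp_span" for c using exp_span.base[of "(1, 0)" 0 c] by simp
    show "\<exists>f\<in>exp_span. f x \<noteq> f y" if "x \<in> S" "y \<in> S" "x \<noteq> y" for x y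
      using exp_span_separates that SH by blast
  qed (auto intro: exp_span.add exp_span_mult)
  \<comment> \<open>The first summand bounds the error of the two nested averages, the second that
    of half an integral over an interval of length \<open>2 * h\<close>.\<close>
  define M where "M = \<bar>sinh h\<bar> * \<bar>sinh a\<bar> + h * sinh (\<bar>a\<bar> + h)"
  have *: "\<bar>wave_op h (wave_op a f) x - integral {a-h..a+h} (\<lambda>\<rho>. wave_op \<rho> f x) / 2\<bar> \<le> M * e" if e: "e > 0" for e
  proof -
    obtain g where g: "g \<in> exp_span" "\<And>y. y \<in> S \<Longrightarrow> \<bar>f y - g y\<bar> < e"
      using Stone_Weierstrass_basic[OF continuous_on_subset[OF f subset_UNIV] e] by blast
    have gg: "wave_group_law g" by (rule wave_group_law_exp_span[OF g(1)])
    hence cg: "continuous_on UNIV g" by (simp add: wave_group_law_def)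
    have 1: "\<bar>wave_op h (wave_op a f) x - wave_op h (wave_op a g) x\<bar> \<le> \<bar>sinh h\<bar> * (\<bar>sinh a\<bar> * e)"
    proof (intro wave_op_abs_diff_le continuous_on_wave_op_const f cg)
      fix v w :: "real ^ 3" assume "norm w = 1" "norm v = 1"
      hence "hpol (hpol x \<bar>h\<bar> v) \<bar>a\<bar> w \<in> S" unfolding S_def by force
      thus "\<bar>f (hpol (hpol x \<bar>h\<bar> v) \<bar>a\<bar> w) - g (hpol (hpol x \<bar>h\<bar> v) \<bar>a\<bar> w)\<bar> \<le> e" by (rule less_imp_le[OF g(2)])
    qed
    have 2: "\<bar>wave_op \<rho> f x - wave_op \<rho> g x\<bar> \<le> sinh (\<bar>a\<bar> + h) * e" if r: "\<rho> \<in> {a-h..a+h}" for \<rho>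
    proof -
      have "\<bar>wave_op \<rho> f x - wave_op \<rho> g x\<bar> \<le> \<bar>sinh \<rho>\<bar> * e"
      proof (intro wave_op_abs_diff_le f cg)
        fix w :: "real ^ 3" assume "norm w = 1"
        hence "hpol x \<bar>\<rho>\<bar> w \<in> S" unfolding S_def using r by force
        thus "\<bar>f (hpol x \<bar>\<rho>\<bar> w) - g (hpol x \<bar>\<rho>\<bar> w)\<bar> \<le> e" by (rule less_imp_le[OF g(2)])
      qed
      also have "\<bar>sinh \<rho>\<bar> * e \<le> sinh (\<bar>a\<bar> + h) * e"
      proof (rule mult_right_mono)
        have "sinh \<rho> \<le> sinh (\<bar>a\<bar> + h)" "sinh (- \<rho>) \<le> sinh (\<bar>a\<bar> + h)"
          using r by (intro sinh_real_le_iff[THEN iffD2]; auto)+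
        thus "\<bar>sinh \<rho>\<bar> \<le> sinh (\<bar>a\<bar> + h)" by (simp add: abs_le_iff)
      qed (use e in simp)
      finally show ?thesis .
    qed
    have "norm (integral {a-h..a+h} (\<lambda>\<rho>. wave_op \<rho> f x - wave_op \<rho> g x)) \<le> (sinh (\<bar>a\<bar> + h) * e) * ((a + h) - (a - h))"
      using h by (intro integral_bound continuous_intros
          continuous_on_subset[OF continuous_on_wave_op_const(2)] f cg subset_UNIV) (use 2 in auto)
    moreover have "integral {a-h..a+h} (\<lambda>\<rho>. wave_op \<rho> f x - wave_op \<rho> g x)
        = integral {a-h..a+h} (\<lambda>\<rho>. wave_op \<rho> f x) - integral {a-h..a+h} (\<lambda>\<rho>. wave_op \<rho> g x)"
      by (rule integral_diff)
        (intro integrable_continuous_real continuous_on_subset[OF continuous_on_wave_op_const(2)] f cg subset_UNIV)+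
    moreover have "wave_op h (wave_op a g) x = integral {a-h..a+h} (\<lambda>\<rho>. wave_op \<rho> g x) / 2"
      using gg x h by (simp add: wave_group_law_def)
    moreover have "M * e = \<bar>sinh h\<bar> * (\<bar>sinh a\<bar> * e) + (sinh (\<bar>a\<bar> + h) * e) * ((a + h) - (a - h)) / 2"
      by (simp add: M_def algebra_simps)
    ultimately show ?thesis using 1 unfolding real_norm_def by linarith
  qed
  have "\<bar>wave_op h (wave_op a f) x - integral {a-h..a+h} (\<lambda>\<rho>. wave_op \<rho> f x) / 2\<bar> \<le> 0"
  proof (rule field_le_epsilon)
    fix e :: real assume e: "e > 0"
    have M: "M \<ge> 0" using h by (auto simp: M_def)
    have "M * (e / (M + 1)) \<le> e" using M e by (simp add: field_simps)
    thus "\<bar>wave_op h (wave_op a f) x - integral {a-h..a+h} (\<lambda>\<rho>. wave_op \<rho> f x) / 2\<bar> \<le> 0 + e"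
      using *[of "e / (M + 1)"] M e by simp
  qed
  thus ?thesis by simp
qed

section \<open>Solutions of the homogeneous equation\<close>

lemma continuous_on_slice:
  assumes "continuous_on UNIV (\<lambda>(t::'a::topological_space, x::'b::topological_space). f t x)"
  shows "continuous_on UNIV (f t)" "continuous_on UNIV (\<lambda>t. f t x)"
  using continuous_on_UNIV_comp2[OF assms, of UNIV "\<lambda>_. t" "\<lambda>x. x"]
    continuous_on_UNIV_comp2[OF assms, of UNIV "\<lambda>t. t" "\<lambda>_. x"]
  by (simp_all add: continuous_on_id)

text \<open>An integrated form of the homogeneous wave equation that needs no derivatives.\<close>

definition homogeneous :: "(real \<Rightarrow> mpoint \<Rightarrow> real) \<Rightarrow> bool" where
  "homogeneous w \<longleftrightarrow> continuous_on UNIV (\<lambda>(t, x). w t x) \<and>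
    (\<forall>T h. \<forall>x\<in>H3. 0 \<le> h \<longrightarrow> h < T \<longrightarrow> wave_op h (w T) x = integral {T-h..T+h} (\<lambda>\<rho>. w \<rho> x) / 2)"

lemma homogeneous_add:
  assumes "homogeneous v" "homogeneous w"
  shows "homogeneous (\<lambda>t x. v t x + w t x)"
proof -
  have c: "continuous_on UNIV (\<lambda>(t, x). v t x)" "continuous_on UNIV (\<lambda>(t, x). w t x)"
    using assms by (auto simp: homogeneous_def)
  note cs = continuous_on_slice[OF c(1)] continuous_on_slice[OF c(2)]
  show ?thesis unfolding homogeneous_def
  proof (intro conjI allI ballI impI)
    show "continuous_on UNIV (\<lambda>(t, x). v t x + w t x)"
      using c by (auto simp: case_prod_unfold intro!: continuous_intros)
    fix T h :: real and x assume "x \<in> H3" "0 \<le> h" "h < T"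
    hence "wave_op h (v T) x = integral {T-h..T+h} (\<lambda>\<rho>. v \<rho> x) / 2"
      "wave_op h (w T) x = integral {T-h..T+h} (\<lambda>\<rho>. w \<rho> x) / 2"
      using assms unfolding homogeneous_def by blast+
    moreover have "wave_op h (\<lambda>x. v T x + w T x) x = wave_op h (v T) x + wave_op h (w T) x"
      by (rule wave_op_add[OF cs(1,3)])
    moreover have "integral {T-h..T+h} (\<lambda>\<rho>. v \<rho> x + w \<rho> x)
        = integral {T-h..T+h} (\<lambda>\<rho>. v \<rho> x) + integral {T-h..T+h} (\<lambda>\<rho>. w \<rho> x)"
      by (intro integral_add integrable_continuous_real continuous_on_subset[OF cs(2)]
          continuous_on_subset[OF cs(4)] subset_UNIV)
    ultimately show "wave_op h (\<lambda>x. v T x + w T x) x = integral {T-h..T+h} (\<lambda>\<rho>. v \<rho> x + w \<rho> x) / 2"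
      by (simp add: add_divide_distrib)
  qed
qed

lemma homogeneous_cmult:
  assumes "homogeneous w"
  shows "homogeneous (\<lambda>t x. c * w t x)"
  using assms by (auto simp: homogeneous_def wave_op_cmult case_prod_unfold intro!: continuous_intros)

lemma homogeneous_wave_op:
  assumes "continuous_on UNIV g"
  shows "homogeneous (\<lambda>t. wave_op t g)"
  unfolding homogeneous_def
proof (intro conjI allI ballI impI)
  show "continuous_on UNIV (\<lambda>(t, x). wave_op t g x)"
    unfolding case_prod_unfold
    by (intro continuous_on_wave_op) (auto simp: case_prod_unfold intro!: continuous_intros continuous_on_UNIV_comp[OF assms])
qed (rule wave_op_wave_op[OF assms])

lemma continuous_on_wave_op_family:
  fixes T s :: "'a::t2_space \<Rightarrow> real"
  assumes c: "continuous_on UNIV (\<lambda>(t, x). f t x)"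
    and "continuous_on UNIV T" "continuous_on UNIV s" "continuous_on UNIV X"
  shows "continuous_on UNIV (\<lambda>z. wave_op (T z) (f (s z)) (X z))"
  by (rule continuous_on_wave_op[OF assms(2,4)])
    (auto simp: case_prod_unfold intro!: continuous_on_UNIV_comp2[OF c] continuous_intros
      continuous_on_UNIV_comp[OF assms(3)])

text \<open>With the upper limit frozen at \<open>S\<close>, Duhamel's integral is a superposition
  of free waves, one for each emission time \<open>s\<close>, and makes sense for all
  \<open>t\<close>. Fubini moves the propagator inside.\<close>

lemma homogeneous_source:
  assumes c: "continuous_on UNIV (\<lambda>(t, x). f t x)"
  shows "homogeneous (\<lambda>t x. integral {0..S} (\<lambda>s. wave_op (t - s) (f s) x))"
  unfolding homogeneous_def
proof (intro conjI allI ballI impI)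
  note cs = continuous_on_slice[OF c]
  note cw = continuous_on_wave_op_family[OF c]
  have "continuous_on (UNIV \<times> cbox 0 S) (\<lambda>(z, s). wave_op (fst z - s) (f s) (snd z))"
    unfolding case_prod_unfold
    by (rule continuous_on_subset[OF cw subset_UNIV]; intro continuous_intros)
  from integral_continuous_on_param[OF this]
  show "continuous_on UNIV (\<lambda>(t, x). integral {0..S} (\<lambda>s. wave_op (t - s) (f s) x))"
    by (simp add: case_prod_unfold)
  fix T h :: real and x assume x: "x \<in> H3" and h: "0 \<le> h" "h < T"
  have "wave_op h (\<lambda>x. integral {0..S} (\<lambda>s. wave_op (T - s) (f s) x)) x
      = sinh h * integral {0..S} (\<lambda>s. sph_avg (\<lambda>w. wave_op (T - s) (f s) (hpol x \<bar>h\<bar> w)))"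
    unfolding wave_op_def[of h]
    by (subst sph_avg_integral_swap)
      (auto simp: case_prod_unfold intro!: cw continuous_intros)
  also have "\<dots> = integral {0..S} (\<lambda>s. wave_op h (wave_op (T - s) (f s)) x)"
    by (simp add: wave_op_def[of h])
  also have "\<dots> = integral {0..S} (\<lambda>s. integral {T-h..T+h} (\<lambda>\<rho>. wave_op (\<rho> - s) (f s) x) / 2)"
  proof (rule integral_cong)
    fix s
    have "wave_op h (wave_op (T - s) (f s)) x = integral {T-h+(-s)..T+h+(-s)} (\<lambda>\<rho>. wave_op \<rho> (f s) x) / 2"
      using wave_op_wave_op[OF cs(1) x h(1), of "T - s" s] by (simp add: algebra_simps)
    also have "integral {T-h+(-s)..T+h+(-s)} (\<lambda>\<rho>. wave_op \<rho> (f s) x)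
        = integral {T-h..T+h} ((\<lambda>\<rho>. wave_op \<rho> (f s) x) \<circ> (\<lambda>\<rho>. \<rho> + (-s)))"
      by (rule integral_shift[symmetric])
        (rule continuous_on_subset[OF continuous_on_wave_op_const(2)[OF cs(1)] subset_UNIV])
    finally show "wave_op h (wave_op (T - s) (f s)) x = integral {T-h..T+h} (\<lambda>\<rho>. wave_op (\<rho> - s) (f s) x) / 2"
      by (simp add: o_def)
  qed
  also have "\<dots> = integral (cbox 0 S) (\<lambda>s. integral (cbox (T-h) (T+h)) (\<lambda>\<rho>. wave_op (\<rho> - s) (f s) x)) / 2"
    by simp
  also have "integral (cbox 0 S) (\<lambda>s. integral (cbox (T-h) (T+h)) (\<lambda>\<rho>. wave_op (\<rho> - s) (f s) x))
     = integral (cbox (T-h) (T+h)) (\<lambda>\<rho>. integral (cbox 0 S) (\<lambda>s. wave_op (\<rho> - s) (f s) x))"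
    by (rule integral_swap_continuous)
      (auto simp: case_prod_unfold intro!: continuous_on_subset[OF cw subset_UNIV] continuous_intros)
  finally show "wave_op h (\<lambda>x. integral {0..S} (\<lambda>s. wave_op (T - s) (f s) x)) x
    = integral {T-h..T+h} (\<lambda>\<rho>. integral {0..S} (\<lambda>s. wave_op (\<rho> - s) (f s) x)) / 2" by simp
qed

text \<open>Since \<open>w T\<close> vanishes, so does the integral of \<open>w\<close> over every
  window centred at \<open>T\<close>. Differentiating in the half-width gives
  \<open>w (T + h) x + w (T - h) x = 0\<close>, which reflects the late zeros to early times; time 0
  follows by continuity.\<close>

lemma homogeneous_unique:
  assumes w: "homogeneous w" and T: "T > 0" and 0: "\<And>t x. t \<ge> T \<Longrightarrow> x \<in> H3 \<Longrightarrow> w t x = 0"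
    and x: "x \<in> H3" and t: "t \<ge> 0"
  shows "w t x = 0"
proof -
  have c: "continuous_on UNIV (\<lambda>(t, x). w t x)" using w by (simp add: homogeneous_def)
  obtain A where A: "(A has_real_derivative w r x) (at r)" for r
    using antiderivative_exists[OF continuous_on_slice(2)[OF c]] by blast
  have pos: "w t x = 0" if t: "0 < t" "t < T" for t
  proof -
    let ?E = "\<lambda>h. A (T + h) - A (T - h)"
    have z: "?E h = 0" if "h \<in> {0<..<T}" for h
    proof -
      have "wave_op h (w T) x = wave_op h (\<lambda>_. 0) x" by (rule wave_op_cong[OF x]) (simp add: 0)
      moreover have "wave_op h (w T) x = integral {T-h..T+h} (\<lambda>\<rho>. w \<rho> x) / 2"
        using w x that by (simp add: homogeneous_def)
      moreover have "integral {T-h..T+h} (\<lambda>\<rho>. w \<rho> x) = ?E h"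
        by (rule integral_FTC[OF A]) (use that in auto)
      ultimately show ?thesis by simp
    qed
    define h where "h = T - t"
    have h: "h \<in> {0<..<T}" using t by (simp add: h_def)
    have "((\<lambda>h. A (T + h)) has_real_derivative w (T + h) x) (at h)"
      by (rule DERIV_comp[OF A, where g' = 1]) (auto intro!: derivative_eq_intros)
    moreover have "((\<lambda>h. A (T - h)) has_real_derivative - w (T - h) x) (at h)"
      by (rule DERIV_comp[OF A, where g' = "-1"]) (auto intro!: derivative_eq_intros)
    ultimately have "(?E has_real_derivative w (T + h) x - (- w (T - h) x)) (at h)"
      by (rule DERIV_diff)
    moreover have "(?E has_real_derivative 0) (at h)"
      by (rule has_field_derivative_transform_within_open[of "\<lambda>_. 0" 0 h "{0<..<T}"])
        (use h z in auto)
    ultimately have "w (T + h) x + w (T - h) x = 0" using DERIV_unique by fastforce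
    thus ?thesis using 0[of "T + h" x] h x by (simp add: h_def)
  qed
  have "w 0 x = 0"
  proof (rule continuous_constant_on_closure[of "{0<..<T}" "\<lambda>t. w t x" 0])
    show "continuous_on (closure {0<..<T}) (\<lambda>t. w t x)"
      by (rule continuous_on_subset[OF continuous_on_slice(2)[OF c] subset_UNIV])
  qed (use pos T in \<open>auto simp: closure_greaterThanLessThan\<close>)
  thus ?thesis using pos[of t] 0[of t x] t x by (cases "t = 0"; cases "t < T") auto
qed

section \<open>The time derivative of the propagator\<close>

definition hpol' :: "mpoint \<Rightarrow> real \<Rightarrow> real ^ 3 \<Rightarrow> mpoint" where
  "hpol' x r w = sinh r *\<^sub>R x + cosh r *\<^sub>R
     (snd x \<bullet> w, w + ((snd x \<bullet> w) / (1 + max 0 (fst x))) *\<^sub>R snd x)"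

lemma continuous_on_hpol' [continuous_intros]:
  fixes f :: "'a::t2_space \<Rightarrow> mpoint"
  assumes "continuous_on A f" "continuous_on A g" "continuous_on A h"
  shows "continuous_on A (\<lambda>z. hpol' (f z) (g z) (h z))"
proof -
  have nz: "1 + max 0 (fst (f z)) \<noteq> 0" for z
    using max.cobounded1[of 0 "fst (f z)"] by linarith
  show ?thesis unfolding hpol'_def
    by (intro continuous_on_add continuous_on_scaleR continuous_on_cosh continuous_on_sinh
        continuous_on_Pair continuous_on_inner continuous_on_divide continuous_on_fst
        continuous_on_snd continuous_on_max continuous_on_const assms) (use nz in blast)
qed

lemma hpol_has_derivative:
  "((\<lambda>t. snd (hpol x t w)) has_vector_derivative snd (hpol' x t w)) (at t)"
  unfolding hpol_def hpol'_def
  by (auto intro!: derivative_eq_intros simp: add.commute)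

text \<open>\<open>extend\<close> factors through the chart, so only the spatial part of the
  geodesic enters and the chain rule in three-space suffices. With \<open>t\<close> instead of its
  absolute value the average is differentiable on both sides of 0.\<close>

lemma C1_wave_op_derivative:
  assumes "C1_H3 u"
  obtains d where "continuous_on UNIV (\<lambda>(t, x). d t x)"
    "\<And>t x. ((\<lambda>t. sinh t * sph_avg (\<lambda>w. extend u (hpol x t w))) has_real_derivative d t x) (at t)"
    "\<And>x. x \<in> H3 \<Longrightarrow> d 0 x = u x"
proof -
  obtain D :: "real ^ 3 \<Rightarrow> ((real ^ 3) \<Rightarrow>\<^sub>L real)" where
    D: "\<And>\<xi>. ((u \<circ> hchart) has_derivative blinfun_apply (D \<xi>)) (at \<xi>)" and cD: "continuous_on UNIV D"
    using assms unfolding C1_H3_def by blast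
  have cu: "continuous_on UNIV (u \<circ> hchart)"
    by (intro continuous_at_imp_continuous_on ballI has_derivative_continuous[OF D])
  have cE: "continuous_on UNIV (extend u)"
    using continuous_on_UNIV_comp[OF cu, of UNIV "snd :: mpoint \<Rightarrow> real ^ 3"]
      continuous_on_snd[OF continuous_on_id]
    unfolding extend_def[abs_def] o_def by blast
  define G' where "G' x t w = blinfun_apply (D (snd (hpol x t w))) (snd (hpol' x t w))" for x t w
  have cG0: "continuous_on UNIV (\<lambda>z. G' (fst z) (fst (snd z)) (snd (snd z)))"
    unfolding G'_def
    by (intro bounded_bilinear.continuous_on[OF bounded_bilinear_blinfun_apply]
        continuous_on_UNIV_comp[OF cD] continuous_intros)
  have cG': "continuous_on A (\<lambda>z. G' (X z) (T z) (W z))"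
    if "continuous_on A X" "continuous_on A T" "continuous_on A W"
    for A :: "'b::topological_space set" and X T W
    using continuous_on_UNIV_comp[OF cG0, of A "\<lambda>z. (X z, T z, W z)"] that
    by (simp add: continuous_on_Pair)
  have dG: "((\<lambda>t. extend u (hpol x t w)) has_real_derivative G' x t w) (at t)" for x t w
  proof -
    have "((\<lambda>t. (u \<circ> hchart) (snd (hpol x t w))) has_vector_derivative G' x t w) (at t)"
      unfolding has_vector_derivative_def G'_def
      using has_derivative_compose[OF hpol_has_derivative[unfolded has_vector_derivative_def] D]
      by (simp add: blinfun.scaleR_right)
    thus ?thesis by (simp add: has_real_derivative_iff_has_vector_derivative extend_def o_def)
  qed
  define d where "d t x = cosh t * sph_avg (\<lambda>w. extend u (hpol x t w)) + sinh t * sph_avg (G' x t)" for t x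
  have S: "((\<lambda>t. sph_avg (\<lambda>w. extend u (hpol x t w))) has_real_derivative sph_avg (G' x t)) (at t)" for x t
    by (rule sph_avg_has_derivative[OF dG])
      (auto simp: case_prod_unfold intro!: cG' continuous_intros continuous_on_UNIV_comp[OF cE])
  have "(sinh has_real_derivative cosh t) (at t)" for t :: real
    by (auto intro!: derivative_eq_intros)
  from DERIV_mult[OF this S]
  have "((\<lambda>t. sinh t * sph_avg (\<lambda>w. extend u (hpol x t w))) has_real_derivative d t x) (at t)" for t x
    by (simp add: d_def mult.commute)
  moreover have "continuous_on UNIV (\<lambda>(t, x). d t x)"
    unfolding d_def case_prod_unfold
    by (intro continuous_intros continuous_on_sph_avg)
      (auto simp: case_prod_unfold intro!: cG' continuous_intros continuous_on_UNIV_comp[OF cE])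
  moreover have "d 0 x = u x" if "x \<in> H3" for x
    using that by (simp add: d_def)
  ultimately show ?thesis using that by blast
qed

text \<open>Differentiate the group law in its centre \<open>T\<close>: on the left under the
  average, on the right by the fundamental theorem. No second derivative of \<open>g\<close>
  appears.\<close>

lemma homogeneous_derivative:
  assumes cg: "continuous_on UNIV g" and cd: "continuous_on UNIV (\<lambda>(t, x). d t x)"
    and d: "\<And>t x. ((\<lambda>t. sinh t * sph_avg (\<lambda>w. g (hpol x t w))) has_real_derivative d t x) (at t)"
  shows "homogeneous d"
  unfolding homogeneous_def
proof (intro conjI allI ballI impI)
  show "continuous_on UNIV (\<lambda>(t, x). d t x)" by fact
  fix T h :: real and x assume x: "x \<in> H3" and h: "0 \<le> h" "h < T"
  define W where "W t x = sinh t * sph_avg (\<lambda>w. g (hpol x t w))" for t x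
  \<comment> \<open>\<open>W\<close> and \<open>wave_op\<close> are identified at nonnegative times;
    \<open>h < T\<close> keeps the whole window from \<open>T - h\<close> to \<open>T + h\<close> in
    that range.\<close>
  have Wwv: "W t x = wave_op t g x" if "t \<ge> 0" for t x using that by (simp add: W_def wave_op_def)
  have cW: "continuous_on UNIV (\<lambda>(t, x). W t x)"
    unfolding W_def case_prod_unfold
    by (intro continuous_intros continuous_on_sph_avg)
      (auto simp: case_prod_unfold intro!: continuous_intros continuous_on_UNIV_comp[OF cg])
  note dW = d[folded W_def]
  obtain A where A: "(A has_real_derivative W r x) (at r)" for r
    using antiderivative_exists[OF continuous_on_slice(2)[OF cW]] by blast
  have e: "wave_op h (W t) x = (A (t + h) - A (t - h)) / 2" if "t > h" for t
  proof -
    have "wave_op h (W t) x = wave_op h (wave_op t g) x" using that h by (intro wave_op_cong x Wwv) simp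
    also have "\<dots> = integral {t-h..t+h} (\<lambda>\<rho>. wave_op \<rho> g x) / 2" by (rule wave_op_wave_op[OF cg x h(1)])
    also have "integral {t-h..t+h} (\<lambda>\<rho>. wave_op \<rho> g x) = integral {t-h..t+h} (\<lambda>\<rho>. W \<rho> x)"
      by (rule integral_cong) (use that Wwv in auto)
    also have "\<dots> = A (t + h) - A (t - h)" by (rule integral_FTC[OF A]) (use h in simp)
    finally show ?thesis .
  qed
  have "((\<lambda>t. A (t + h)) has_real_derivative W (T + h) x) (at T)"
    by (rule DERIV_comp[OF A, where g' = 1]) (auto intro!: derivative_eq_intros)
  moreover have "((\<lambda>t. A (t - h)) has_real_derivative W (T - h) x) (at T)"
    by (rule DERIV_comp[OF A, where g' = "1"]) (auto intro!: derivative_eq_intros)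
  ultimately have "((\<lambda>t. (A (t + h) - A (t - h)) / 2) has_real_derivative (W (T + h) x - W (T - h) x) / 2) (at T)"
    by (intro DERIV_cdivide DERIV_diff)
  hence 1: "((\<lambda>t. wave_op h (W t) x) has_real_derivative (W (T + h) x - W (T - h) x) / 2) (at T)"
    by (rule has_field_derivative_transform_within_open[where S = "{h<..}"]) (use h e in auto)
  have "((\<lambda>t. sph_avg (\<lambda>w. W t (hpol x \<bar>h\<bar> w))) has_real_derivative sph_avg (\<lambda>w. d T (hpol x \<bar>h\<bar> w))) (at T)"
    by (rule sph_avg_has_derivative[OF dW])
      (auto simp: case_prod_unfold intro!: continuous_intros continuous_on_UNIV_comp2[OF cW]
        continuous_on_UNIV_comp2[OF cd])
  hence "((\<lambda>t. wave_op h (W t) x) has_real_derivative wave_op h (d T) x) (at T)"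
    unfolding wave_op_def by (rule DERIV_cmult)
  hence "wave_op h (d T) x = (W (T + h) x - W (T - h) x) / 2" using 1 by (rule DERIV_unique)
  also have "W (T + h) x - W (T - h) x = integral {T-h..T+h} (\<lambda>\<rho>. d \<rho> x)"
    by (rule integral_FTC[OF dW, symmetric]) (use h in simp)
  finally show "wave_op h (d T) x = integral {T-h..T+h} (\<lambda>\<rho>. d \<rho> x) / 2" .
qed

section \<open>The nonlinearity and backward uniqueness\<close>

lemma arsinh_real_le_iff: "arsinh x \<le> arsinh y \<longleftrightarrow> x \<le> (y::real)"
  by (meson arsinh_less_iff_real not_less)

lemma Fp_nonneg [simp]: "Fp p v \<ge> 0"
  by (simp add: Fp_def)

lemma Fp_0 [simp]: "Fp p 0 = 0"
  by (simp add: Fp_def)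

lemma Fp_pos: "v \<noteq> 0 \<Longrightarrow> Fp p v > 0"
  by (simp add: Fp_def)

text \<open>The factor in front of |v| increases with |v|, so its value at the largest amplitude
  bounds it. This gives continuity at 0 and the iteration in
  \<open>backward_uniqueness\<close>.\<close>

lemma Fp_le_linear:
  assumes "1 < p" "B > 0" "\<bar>v\<bar> \<le> B"
  shows "Fp p v \<le> arsinh (1 / B) powr (- (p - 1)) * \<bar>v\<bar>"
proof (cases "v = 0")
  case False
  have "arsinh (1 / \<bar>v\<bar>) powr (- (p - 1)) \<le> arsinh (1 / B) powr (- (p - 1))"
    using assms False by (intro powr_mono2') (auto simp: arsinh_real_le_iff intro!: divide_left_mono)
  thus ?thesis using False by (auto simp: Fp_def intro: mult_right_mono)
qed auto

lemma Fp_mono: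
  assumes "1 < p" "0 \<le> v" "v \<le> w"
  shows "Fp p v \<le> Fp p w"
proof (cases "v = 0")
  case False
  hence v: "v > 0" "w > 0" using assms by auto
  have "Fp p v \<le> arsinh (1 / w) powr (- (p - 1)) * \<bar>v\<bar>"
    by (rule Fp_le_linear) (use assms v in auto)
  also have "\<dots> \<le> arsinh (1 / w) powr (- (p - 1)) * \<bar>w\<bar>"
    by (intro mult_left_mono) (use assms v in auto)
  finally show ?thesis using v by (simp add: Fp_def)
qed auto

text \<open>Here \<open>s\<close> stands for \<open>sinh \<rho>\<close> and \<open>c\<close> for a
  lower bound of \<open>sinh \<rho> * U\<close>, so that \<open>U\<close> is at least
  \<open>c / s\<close>. The hypothesis says that \<open>arsinh (s / c)\<close> is at most
  \<open>y\<close>; thus \<open>y\<close> fixes the strength of the potential.\<close>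

lemma Fp_lower:
  assumes "1 < p" "c > 0" "s > 0" "y > 0" "s \<le> c * sinh y"
  shows "c * y powr (- (p - 1)) \<le> s * Fp p (c / s)"
proof -
  have "s / c \<le> sinh y" using assms by (simp add: field_simps)
  hence "arsinh (s / c) \<le> y" using arsinh_real_le_iff[of "s / c" "sinh y"] by (simp add: arsinh_sinh_real)
  hence "y powr (- (p - 1)) \<le> arsinh (s / c) powr (- (p - 1))"
    using assms by (intro powr_mono2') auto
  thus ?thesis using assms by (simp add: Fp_def mult.commute)
qed

text \<open>From \<open>arsinh z \<le> z\<close>. For large values this superlinear bound replaces
  the potential bound of \<open>Fp_lower\<close>.\<close>

lemma Fp_ge_powr:
  assumes "1 < p" "w > 0"
  shows "w powr p \<le> Fp p w"
proof -
  have "1 / w \<le> sinh (1 / w)"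
    using real_le_x_sinh[of "1 / w"] assms by (simp add: sinh_field_def exp_minus)
  hence "arsinh (1 / w) \<le> 1 / w"
    using arsinh_real_le_iff[of "1 / w" "sinh (1 / w)"] by (simp add: arsinh_sinh_real)
  hence "(1 / w) powr (- (p - 1)) \<le> arsinh (1 / w) powr (- (p - 1))"
    using assms by (intro powr_mono2') auto
  moreover have "(1 / w) powr (- (p - 1)) * w = w powr p"
    using assms by (simp add: powr_divide powr_minus_divide powr_diff)
  ultimately show ?thesis using assms
    by (simp add: Fp_def) (metis less_imp_le mult_right_mono)
qed

lemma continuous_on_Fp:
  assumes "1 < p"
  shows "continuous_on UNIV (Fp p)"
proof -
  have "isCont (Fp p) v" for v
  proof (cases "v = 0")
    case False
    have "continuous_on (- {0}) (\<lambda>v. arsinh (1 / \<bar>v\<bar>) powr (- (p - 1)) * \<bar>v\<bar>)"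
      by (intro continuous_intros) auto
    hence c: "isCont (\<lambda>v. arsinh (1 / \<bar>v\<bar>) powr (- (p - 1)) * \<bar>v\<bar>) v"
      using False by (simp add: continuous_on_eq_continuous_at open_Compl)
    have "\<forall>\<^sub>F v in nhds v. arsinh (1 / \<bar>v\<bar>) powr (- (p - 1)) * \<bar>v\<bar> = Fp p v"
      by (rule eventually_mono[OF t1_space_nhds[OF False]]) (simp add: Fp_def)
    from isCont_cong[OF this] c show ?thesis by (rule iffD1)
  next
    case True
    have "(Fp p \<longlongrightarrow> 0) (at 0)"
    proof (rule Lim_null_comparison)
      show "\<forall>\<^sub>F v in at 0. norm (Fp p v) \<le> arsinh (1 / 1) powr (- (p - 1)) * \<bar>v\<bar>"
        unfolding eventually_at
      proof (rule exI[of _ 1], intro conjI ballI impI)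
        fix v :: real assume "v \<noteq> 0 \<and> dist v 0 < 1"
        hence "\<bar>v\<bar> \<le> 1" by (simp add: dist_norm)
        thus "norm (Fp p v) \<le> arsinh (1 / 1) powr (- (p - 1)) * \<bar>v\<bar>"
          using Fp_le_linear[OF assms, of 1 v] Fp_nonneg[of p v] by (simp del: div_by_1)
      qed simp
      show "((\<lambda>v. arsinh (1 / 1) powr (- (p - 1)) * \<bar>v\<bar>) \<longlongrightarrow> 0) (at (0::real))"
        by (auto intro!: tendsto_eq_intros)
    qed
    thus ?thesis using True by (simp add: isCont_def)
  qed
  thus ?thesis by (simp add: continuous_at_imp_continuous_on)
qed

section \<open>The integral equation and its backward uniqueness\<close>

definition origin :: mpoint where "origin = (1, 0)"

lemma origin_H3 [simp]: "origin \<in> H3"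
  by (simp add: origin_def H3_def mink_def)

text \<open>\<open>L\<close> is the contribution of the data and \<open>R\<close> bounds their
  support; \<open>Lzero\<close> is the strong Huygens principle. Continuity is assumed on the whole
  ambient space-time, the equation only for nonnegative times on \<open>H3\<close>.\<close>

locale duhamel =
  fixes p R :: real and U L :: "real \<Rightarrow> mpoint \<Rightarrow> real"
  assumes p: "1 < p" "p < 3" and R: "R > 0"
    and cU: "continuous_on UNIV (\<lambda>(t, x). U t x)"
    and homL: "homogeneous L"
    and eq: "\<And>t x. t \<ge> 0 \<Longrightarrow> x \<in> H3 \<Longrightarrow>
      U t x = L t x + integral {0..t} (\<lambda>s. wave_op (t - s) (\<lambda>y. Fp p (U s y)) x)"
    and Lzero: "\<And>t x. x \<in> H3 \<Longrightarrow> t > hdist origin x + R \<Longrightarrow> L t x = 0"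
begin

definition f :: "real \<Rightarrow> mpoint \<Rightarrow> real" where
  "f s y = Fp p (U s y)"

lemma cf: "continuous_on UNIV (\<lambda>(s, y). f s y)"
  using continuous_on_UNIV_comp[OF continuous_on_Fp[OF p(1)] cU]
  by (simp add: f_def case_prod_unfold)

lemma f_nonneg [simp]: "f s y \<ge> 0"
  by (simp add: f_def)

lemma eq': "t \<ge> 0 \<Longrightarrow> x \<in> H3 \<Longrightarrow> U t x = L t x + integral {0..t} (\<lambda>s. wave_op (t - s) (f s) x)"
  using eq by (simp add: f_def[abs_def])

lemma cslice: "continuous_on A (\<lambda>s. wave_op (t - s) (f s) x)"
proof -
  have "continuous_on UNIV (\<lambda>s. wave_op (t - s) (f s) x)"
    by (rule continuous_on_wave_op_family[OF cf, where T = "\<lambda>s. t - s" and s = "\<lambda>s. s" and X = "\<lambda>_. x"])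
      (auto intro: continuous_intros)
  thus ?thesis by (rule continuous_on_subset) simp
qed

lemma islice: "(\<lambda>s. wave_op (t - s) (f s) x) integrable_on {a..b}"
  by (rule integrable_continuous_real[OF cslice])

lemma wave_op_f_nonneg: "s \<le> t \<Longrightarrow> wave_op (t - s) (f s) x \<ge> 0"
  unfolding wave_op_def
  by (intro mult_nonneg_nonneg sph_avg_nonneg continuous_on_hpol_arg continuous_on_slice[OF cf]) auto

text \<open>Subtracting the wave generated by the future source leaves a homogeneous solution that vanishes at
  late times, hence always; so \<open>U\<close> is an integral of its own future, and iterating that estimate
  gives \<open>U = 0\<close>.\<close>

lemma backward_uniqueness:
  assumes Z: "\<And>s y. s \<ge> 0 \<Longrightarrow> y \<in> H3 \<Longrightarrow> s + hdist origin y > R \<Longrightarrow> U s y = 0"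
    and t: "t \<ge> 0" and x: "x \<in> H3"
  shows "U t x = 0"
proof -
  define S where "S = R + 1"
  have S: "S > 0" "S > R" using R by (auto simp: S_def)
  have late: "U s y = 0" if "s \<ge> S" "y \<in> H3" for s y
    using Z[of s y] that S hdist_nonneg[OF origin_H3 that(2)] R by linarith
  have wlate: "wave_op \<tau> (f s) y = 0" if "s \<ge> S" "y \<in> H3" for s \<tau> y
  proof -
    have "wave_op \<tau> (f s) y = wave_op \<tau> (\<lambda>_. 0) y" by (rule wave_op_cong[OF that(2)]) (simp add: f_def late that(1))
    thus ?thesis by simp
  qed
  define w where "w t x = L t x + integral {0..S} (\<lambda>s. wave_op (t - s) (f s) x)" for t x
  have hw: "homogeneous w" unfolding w_def
    by (intro homogeneous_add homL homogeneous_source cf)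
  have "w t x = 0" if t: "t \<ge> S" and x: "x \<in> H3" for t x
  proof -
    have "integral {0..t} (\<lambda>s. wave_op (t - s) (f s) x) = integral {0..S} (\<lambda>s. wave_op (t - s) (f s) x)
        + integral {S..t} (\<lambda>s. wave_op (t - s) (f s) x)"
      using t S by (intro Henstock_Kurzweil_Integration.integral_combine[symmetric] islice) auto
    also have "integral {S..t} (\<lambda>s. wave_op (t - s) (f s) x) = integral {S..t} (\<lambda>s. 0)"
      by (rule integral_cong) (simp add: wlate x)
    finally have "w t x = U t x" using eq'[of t x] t S x by (simp add: w_def)
    thus ?thesis using late[OF t x] by simp
  qed
  hence w0: "w t x = 0" if "t \<ge> 0" "x \<in> H3" for t x
    using homogeneous_unique[OF hw S(1) _ that(2,1)] by blast
  have rev: "U t x = integral {t..S} (\<lambda>s. wave_op (s - t) (f s) x)" if t: "0 \<le> t" "t \<le> S" and x: "x \<in> H3" for t x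
  proof -
    have "integral {0..S} (\<lambda>s. wave_op (t - s) (f s) x) = integral {0..t} (\<lambda>s. wave_op (t - s) (f s) x)
        + integral {t..S} (\<lambda>s. wave_op (t - s) (f s) x)"
      using t by (intro Henstock_Kurzweil_Integration.integral_combine[symmetric] islice) auto
    hence "U t x = - integral {t..S} (\<lambda>s. wave_op (t - s) (f s) x)"
      using w0[OF t(1) x] eq'[OF t(1) x] by (simp add: w_def)
    also have "\<dots> = integral {t..S} (\<lambda>s. - wave_op (t - s) (f s) x)" by simp
    also have "\<dots> = integral {t..S} (\<lambda>s. wave_op (s - t) (f s) x)"
      by (simp flip: wave_op_minus)
    finally show ?thesis .
  qed
  \<comment> \<open>Outside the ball of radius \<open>R\<close> the hypothesis \<open>Z\<close>
    makes \<open>U\<close> vanish, so a bound on this compact ball is a bound on all of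
    \<open>H3\<close>.\<close>
  define C where "C = (\<lambda>z. hpol origin (fst z) (snd z)) ` ({0..R} \<times> sphere 0 1)"
  have "compact C" unfolding C_def
    by (intro compact_continuous_image compact_Times compact_sphere compact_Icc continuous_intros)
  hence "compact ((\<lambda>(t, x). U t x) ` ({0..S} \<times> C))"
    by (intro compact_continuous_image continuous_on_subset[OF cU] compact_Times) auto
  then obtain B where B: "B > 0" "\<And>t x. t \<in> {0..S} \<Longrightarrow> x \<in> C \<Longrightarrow> \<bar>U t x\<bar> \<le> B"
  proof -
    obtain B where "B > 0" "\<forall>y\<in>(\<lambda>(t, x). U t x) ` ({0..S} \<times> C). norm y \<le> B"
      using \<open>compact ((\<lambda>(t, x). U t x) ` _)\<close> compact_imp_bounded bounded_pos by metis
    thus ?thesis using that by simp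
  qed
  have bd: "\<bar>U t x\<bar> \<le> B" if t: "t \<in> {0..S}" and x: "x \<in> H3" for t x
  proof (cases "hdist origin x \<le> R")
    case True
    obtain v where "norm v = 1" "x = hpol origin (hdist origin x) v" using hpol_surj[OF origin_H3 x] by blast
    hence "x \<in> C" unfolding C_def using True hdist_nonneg[OF origin_H3 x] by force
    thus ?thesis using B(2) t by blast
  next
    case False
    thus ?thesis using Z[of t x] t x B(1) by auto
  qed
  define c where "c = arsinh (1 / B) powr (- (p - 1))"
  define K where "K = sinh S * c"
  have c0: "c \<ge> 0" and K0: "K \<ge> 0" using S by (auto simp: c_def K_def)
  \<comment> \<open>Each use of \<open>rev\<close> bounds the source by the linear estimate with
    factor \<open>K\<close> and integrates once over the remaining time, which produces the terms of
    an exponential series.\<close>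
  have it: "\<forall>t\<in>{0..S}. \<forall>x\<in>H3. \<bar>U t x\<bar> \<le> B * (K * (S - t)) ^ n / fact n" for n
  proof (induction n)
    case 0
    thus ?case using bd by simp
  next
    case (Suc n)
    show ?case
    proof (intro ballI)
      fix t x assume t: "t \<in> {0..S}" and x: "x \<in> H3"
      have st: "\<bar>wave_op (s - t) (f s) x\<bar> \<le> K * (B * (K * (S - s)) ^ n / fact n)" if s: "s \<in> {t..S}" for s
      proof -
        let ?b = "B * (K * (S - s)) ^ n / fact n"
        have b0: "?b \<ge> 0" using B K0 s by auto
        have "\<bar>wave_op (s - t) (f s) x - wave_op (s - t) (\<lambda>_. 0) x\<bar> \<le> \<bar>sinh (s - t)\<bar> * (c * ?b)"
        proof (intro wave_op_abs_diff_le continuous_on_slice[OF cf] continuous_intros)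
          fix v :: "real ^ 3" assume "norm v = 1"
          hence y: "hpol x \<bar>s - t\<bar> v \<in> H3" (is "?y \<in> _") using x by simp
          have sS: "s \<in> {0..S}" using s t by auto
          have "f s ?y \<le> c * \<bar>U s ?y\<bar>"
            unfolding f_def c_def by (rule Fp_le_linear[OF p(1) B(1) bd[OF sS y]])
          also have "\<dots> \<le> c * ?b" using Suc sS y c0 by (intro mult_left_mono) auto
          finally show "\<bar>f s ?y - 0\<bar> \<le> c * ?b" by simp
        qed
        also have "\<dots> \<le> sinh S * (c * ?b)"
          using s t mult_nonneg_nonneg[OF c0 b0] by (intro mult_right_mono) auto
        finally show ?thesis by (simp add: K_def)
      qed
      define k where "k = B * K ^ Suc n / fact (Suc n)"
      have k: "k * real (Suc n) = B * K ^ Suc n / fact n"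
        by (simp add: k_def fact_Suc field_simps del: power_Suc of_nat_Suc)
      have "((\<lambda>s. - (k * (S - s) ^ Suc n)) has_real_derivative (k * real (Suc n)) * (S - s) ^ n) (at s)" for s
      proof -
        have "((\<lambda>s. S - s) has_real_derivative -1) (at s)" by (auto intro!: derivative_eq_intros)
        from DERIV_cmult[OF DERIV_power_Suc[OF this, of n], of "- k"] show ?thesis
          by (simp add: algebra_simps del: power_Suc)
      qed
      hence "((\<lambda>s. - (k * (S - s) ^ Suc n))
          has_real_derivative K * (B * (K * (S - s)) ^ n / fact n)) (at s)" for s
        unfolding k by (simp add: power_mult_distrib mult_ac)
      note FTC = integral_FTC[OF this, of t S]
      have "\<bar>U t x\<bar> = norm (integral {t..S} (\<lambda>s. wave_op (s - t) (f s) x))"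
        using rev[of t x] t x by simp
      also have "\<dots> \<le> integral {t..S} (\<lambda>s. K * (B * (K * (S - s)) ^ n / fact n))"
      proof (rule integral_norm_bound_integral)
        show "(\<lambda>s. wave_op (s - t) (f s) x) integrable_on {t..S}"
          using integrable_neg[OF islice[of t x t S]] by (simp flip: wave_op_minus)
        show "(\<lambda>s. K * (B * (K * (S - s)) ^ n / fact n)) integrable_on {t..S}"
          by (intro integrable_continuous_real continuous_intros) auto
      qed (use st in auto)
      also have "\<dots> = B * (K * (S - t)) ^ Suc n / fact (Suc n)"
        using FTC t by (simp add: power_mult_distrib k_def)
      finally show "\<bar>U t x\<bar> \<le> B * (K * (S - t)) ^ Suc n / fact (Suc n)" .
    qed
  qed
  show "U t x = 0"
  proof (cases "t \<ge> S")
    case True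
    thus ?thesis using late x by simp
  next
    case False
    have "(\<lambda>n. inverse (fact n) * (K * (S - t)) ^ n) \<longlonglongrightarrow> 0"
      by (rule summable_LIMSEQ_zero[OF summable_exp])
    hence "(\<lambda>n. B * (inverse (fact n) * (K * (S - t)) ^ n)) \<longlonglongrightarrow> B * 0"
      by (rule tendsto_mult_left)
    hence "(\<lambda>n. B * (K * (S - t)) ^ n / fact n) \<longlonglongrightarrow> 0"
      by (simp add: field_simps)
    moreover have "\<forall>n\<ge>0. \<bar>U t x\<bar> \<le> B * (K * (S - t)) ^ n / fact n" using it False t x by auto
    ultimately have "\<bar>U t x\<bar> \<le> 0" using LIMSEQ_le_const by blast
    thus ?thesis by simp
  qed
qed

end

section \<open>Propagation of lower bounds\<close>

lemma hpol_origin: "hpol origin r w = (cosh r, sinh r *\<^sub>R w)"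
  by (simp add: hpol_def origin_def)

lemma hdist_eq_0D: "x \<in> H3 \<Longrightarrow> y \<in> H3 \<Longrightarrow> hdist x y = 0 \<Longrightarrow> x = y"
  using hpol_surj[of x y] by auto

lemma hdist_opposite:
  assumes "norm w = 1" "r \<ge> 0" "s \<ge> 0"
  shows "hdist (hpol origin r (- w)) (hpol origin s w) = r + s"
proof -
  have "w \<bullet> w = 1" using assms(1) by (simp add: dot_square_norm)
  hence "- mink (hpol origin r (- w)) (hpol origin s w) = cosh (r + s)"
    by (simp add: mink_def hpol_origin cosh_add)
  thus ?thesis using assms by (simp add: hdist_def arcosh_cosh_real)
qed

lemma continuous_on_hdist:
  assumes "x \<in> H3" "continuous_on A g" "\<And>z. z \<in> A \<Longrightarrow> g z \<in> H3"
  shows "continuous_on A (\<lambda>z. hdist x (g z))"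
proof -
  have "continuous_on A (\<lambda>z. - mink x (g z))" unfolding mink_def
    by (intro continuous_intros assms(2))
  moreover have "- mink x (g z) \<ge> 1" if "z \<in> A" for z
    using mink_H3_le[OF assms(1) assms(3)[OF that]] by simp
  ultimately show ?thesis unfolding hdist_def
    by (intro continuous_on_compose2[OF continuous_on_arcosh[of "{1..}"]]) auto
qed

text \<open>Replace \<open>g\<close> by a continuous zonal minorant and apply d'Alembert's formula.
  The hypotheses \<open>sub\<close> place the shell inside the interval of dependence. The minorant
  is exact on the middle half of the shell, and d'Alembert contributes another 1/2, hence the
  1/4.\<close>

lemma wave_op_lower_shell:
  assumes g: "continuous_on UNIV g" "\<And>y. g y \<ge> 0" and x: "x \<in> H3" and q: "q \<in> H3"
    and \<tau>: "\<tau> > 0" and \<alpha>: "\<alpha> > 0" and l: "len > 0"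
    and sub: "\<bar>hdist q x - \<tau>\<bar> \<le> \<alpha>" "\<alpha> + len \<le> hdist q x + \<tau>" and h: "h \<ge> 0"
    and lb: "\<And>y. y \<in> H3 \<Longrightarrow> \<alpha> \<le> hdist q y \<Longrightarrow> hdist q y \<le> \<alpha> + len \<Longrightarrow> h \<le> sinh (hdist q y) * g y"
  shows "h * len / 4 \<le> sinh (hdist q x) * wave_op \<tau> g x"
proof -
  \<comment> \<open>A trapezoid: 1 on the middle half of the shell, 0 outside the shell.\<close>
  define \<kappa> where "\<kappa> \<rho> = min 1 (max 0 (2 - 4 * \<bar>\<rho> - (\<alpha> + len / 2)\<bar> / len))" for \<rho> :: real
  define \<phi> where "\<phi> c = h * \<kappa> (arcosh (max 1 c)) / sinh (max \<alpha> (arcosh (max 1 c)))" for c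
  have s\<alpha>: "sinh (max \<alpha> z) > 0" for z using \<alpha> by (simp add: less_max_iff_disj)
  have c\<phi>: "continuous_on UNIV \<phi>"
    unfolding \<phi>_def \<kappa>_def
    by (intro continuous_intros) (use s\<alpha> l in \<open>auto simp: less_imp_neq[symmetric] dest: less_imp_neq\<close>)
  have \<kappa>0: "\<kappa> \<rho> = 0" if "\<not> (\<alpha> \<le> \<rho> \<and> \<rho> \<le> \<alpha> + len)" for \<rho>
  proof -
    have "len / 2 \<le> \<bar>\<rho> - (\<alpha> + len / 2)\<bar>" using that l by (auto simp: abs_if field_simps)
    thus ?thesis using l by (simp add: \<kappa>_def field_simps)
  qed
  have \<kappa>1: "0 \<le> \<kappa> \<rho>" "\<kappa> \<rho> \<le> 1" for \<rho> by (auto simp: \<kappa>_def)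
  have \<phi>cosh: "\<phi> (cosh \<rho>) = h * \<kappa> \<rho> / sinh (max \<alpha> \<rho>)" if "\<rho> \<ge> 0" for \<rho>
    using that cosh_real_ge_1[of \<rho>] by (simp add: \<phi>_def arcosh_cosh_real max_absorb2)
  have le: "\<phi> (- mink q y) \<le> g y" if y: "y \<in> H3" for y
  proof -
    have e: "\<phi> (- mink q y) = h * \<kappa> (hdist q y) / sinh (max \<alpha> (hdist q y))"
      using \<phi>cosh[OF hdist_nonneg[OF q y]] cosh_hdist[OF q y] by simp
    show ?thesis
    proof (cases "\<alpha> \<le> hdist q y \<and> hdist q y \<le> \<alpha> + len")
      case True
      hence s: "sinh (hdist q y) > 0" using \<alpha> by simp
      have "h * \<kappa> (hdist q y) \<le> h * 1" by (intro mult_left_mono \<kappa>1 h)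
      also have "\<dots> \<le> sinh (hdist q y) * g y" using lb[OF y] True by simp
      finally have "h * \<kappa> (hdist q y) / sinh (hdist q y) \<le> g y" using s by (simp add: field_simps)
      thus ?thesis using e True by (simp add: max_absorb2)
    next
      case False
      thus ?thesis using e \<kappa>0 g(2) by simp
    qed
  qed
  obtain \<Phi> where \<Phi>: "(\<Phi> has_real_derivative \<phi> c) (at c)" for c
    using antiderivative_exists[OF c\<phi>] by blast
  let ?r = "hdist q x"
  have r: "?r \<ge> 0" using q x by simp
  \<comment> \<open>Evenness of \<open>cosh\<close> lets the integral start at
    \<open>\<bar>?r - \<tau>\<bar>\<close>, so only nonnegative radii occur and the integrand is
    nonnegative throughout.\<close>
  have F: "integral {\<bar>?r - \<tau>\<bar>..?r + \<tau>} (\<lambda>\<rho>. sinh \<rho> * \<phi> (cosh \<rho>)) = \<Phi> (cosh (?r + \<tau>)) - \<Phi> (cosh (?r - \<tau>))"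
    using integral_FTC[OF has_derivative_comp_cosh[OF \<Phi>], of "\<bar>?r - \<tau>\<bar>" "?r + \<tau>"] r \<tau> by simp
  have ci: "continuous_on A (\<lambda>\<rho>. sinh \<rho> * \<phi> (cosh \<rho>))" for A :: "real set"
    by (intro continuous_intros continuous_on_UNIV_comp[OF c\<phi>])
  have "h * len / 2 = integral {\<alpha> + len/4..\<alpha> + 3*len/4} (\<lambda>\<rho>. h)"
    using l by (simp add: field_simps)
  also have "\<dots> = integral {\<alpha> + len/4..\<alpha> + 3*len/4} (\<lambda>\<rho>. sinh \<rho> * \<phi> (cosh \<rho>))"
  proof (rule integral_cong)
    fix \<rho> assume \<rho>: "\<rho> \<in> {\<alpha> + len/4..\<alpha> + 3*len/4}"
    have "\<bar>\<rho> - (\<alpha> + len / 2)\<bar> \<le> len / 4" using \<rho> unfolding abs_le_iff atLeastAtMost_iff by (intro conjI) linarith+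
    hence "4 * \<bar>\<rho> - (\<alpha> + len / 2)\<bar> / len \<le> 1" using l by (subst pos_divide_le_eq) auto
    hence "1 \<le> max 0 (2 - 4 * \<bar>\<rho> - (\<alpha> + len / 2)\<bar> / len)" unfolding le_max_iff_disj by linarith
    hence "\<kappa> \<rho> = 1" by (simp only: \<kappa>_def min_absorb1)
    moreover have "\<rho> > 0" "\<rho> \<ge> \<alpha>" using \<rho> \<alpha> l by auto
    ultimately show "h = sinh \<rho> * \<phi> (cosh \<rho>)" by (simp add: \<phi>cosh max_absorb2)
  qed
  also have "\<dots> \<le> integral {\<bar>?r - \<tau>\<bar>..?r + \<tau>} (\<lambda>\<rho>. sinh \<rho> * \<phi> (cosh \<rho>))"
  proof (rule integral_subset_le)
    show "{\<alpha> + len/4..\<alpha> + 3*len/4} \<subseteq> {\<bar>?r - \<tau>\<bar>..?r + \<tau>}" using sub l by auto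
    show "\<forall>\<rho>\<in>{\<bar>?r - \<tau>\<bar>..?r + \<tau>}. 0 \<le> sinh \<rho> * \<phi> (cosh \<rho>)"
    proof
      fix \<rho> assume that: "\<rho> \<in> {\<bar>?r - \<tau>\<bar>..?r + \<tau>}"
      have "\<rho> \<ge> 0" using that by auto
      thus "0 \<le> sinh \<rho> * \<phi> (cosh \<rho>)" using s\<alpha>[of \<rho>] \<kappa>1(1)[of \<rho>] h by (simp add: \<phi>cosh)
    qed
  qed (auto intro!: integrable_continuous_real ci)
  also have "\<dots> = 2 * (sinh ?r * wave_op \<tau> (\<lambda>y. \<phi> (- mink q y)) x)"
    unfolding F wave_op_zonal_FTC[OF q x \<Phi> c\<phi>] by simp
  finally have "h * len / 4 \<le> sinh ?r * wave_op \<tau> (\<lambda>y. \<phi> (- mink q y)) x" by simp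
  also have "\<dots> \<le> sinh ?r * wave_op \<tau> g x"
  proof (intro mult_left_mono wave_op_mono g)
    show "continuous_on UNIV (\<lambda>y. \<phi> (- mink q y))"
      unfolding mink_def by (intro continuous_on_UNIV_comp[OF c\<phi>] continuous_intros)
  qed (use \<tau> r le x in auto)
  finally show ?thesis .
qed

context duhamel
begin

lemma U_eq:
  assumes "x \<in> H3" "t > hdist origin x + R"
  shows "U t x = integral {0..t} (\<lambda>s. wave_op (t - s) (f s) x)"
proof -
  have "t \<ge> 0" using assms hdist_nonneg[OF origin_H3 assms(1)] R by linarith
  thus ?thesis using eq'[of t x] Lzero[OF assms] assms(1) by simp
qed

text \<open>The Duhamel integrand is continuous and nonnegative in time, so a single positive
  spherical average makes the integral positive; the data no longer contribute at this
  point.\<close>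

lemma cone_pos:
  assumes y: "y \<in> H3" and x: "x \<in> H3" and s: "0 \<le> s" "s < t" and d: "hdist x y = t - s"
    and t: "t > hdist origin x + R" and fy: "f s y > 0"
  shows "U t x > 0"
proof -
  obtain w where w: "norm w = 1" "y = hpol x (t - s) w" using hpol_surj[OF x y] d by auto
  have "sph_avg (\<lambda>v. f s (hpol x (t - s) v)) > 0"
    by (rule sph_avg_pos[OF continuous_on_hpol_arg[OF continuous_on_slice(1)[OF cf]] _ w(1)])
      (use fy w(2) in auto)
  hence wp: "wave_op (t - s) (f s) x > 0" using s by (simp add: wave_op_def)
  have nn: "0 \<le> wave_op (t - s) (f s) x" if "s \<in> {0..t}" for s using wave_op_f_nonneg that by simp
  have "integral {0..t} (\<lambda>s. wave_op (t - s) (f s) x) \<noteq> 0"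
  proof
    assume "integral {0..t} (\<lambda>s. wave_op (t - s) (f s) x) = 0"
    hence "\<forall>s\<in>{0..t}. wave_op (t - s) (f s) x = 0"
      by (subst (asm) integral_eq_0_iff[OF cslice _ nn]) (use s in auto)
    thus False using s wp by force
  qed
  moreover have "integral {0..t} (\<lambda>s. wave_op (t - s) (f s) x) \<ge> 0"
    by (intro integral_nonneg islice nn)
  ultimately show ?thesis using U_eq[OF x t] by simp
qed

text \<open>The point \<open>(t, x)\<close> is reached from \<open>(s0, y0)\<close> along two light rays through a point on the ray opposite
  to \<open>y0\<close>. This ray moves away from \<open>y0\<close> and from the origin at the same speed, so it leaves the domain
  of influence of the data.\<close>

lemma solid_cone_pos:
  assumes y0: "y0 \<in> H3" and s0: "s0 \<ge> 0" and U0: "U s0 y0 \<noteq> 0" and out: "s0 + hdist origin y0 > R"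
    and x: "x \<in> H3" and t: "t > s0 + hdist origin y0 + hdist origin x"
  shows "U t x > 0"
proof -
  define \<rho> where "\<rho> = hdist origin y0"
  have \<rho>: "\<rho> \<ge> 0" using y0 by (simp add: \<rho>_def)
  obtain w where w: "norm w = 1" "y0 = hpol origin \<rho> w"
    unfolding \<rho>_def using hpol_surj[OF origin_H3 y0] by blast
  define y where "y lam = hpol origin lam (- w)" for lam
  have yH: "y lam \<in> H3" for lam using w(1) by (simp add: y_def)
  \<comment> \<open>The time needed to travel from \<open>y0\<close> to \<open>y lam\<close> and on
    to \<open>x\<close>. The intermediate value theorem selects the point for which it is exactly
    \<open>t - s0\<close>.\<close>
  define D where "D lam = lam + \<rho> + hdist x (y lam)" for lam
  have tr: "t > s0 + \<rho> + hdist origin x" using t by (simp add: \<rho>_def)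
  have D0: "D 0 < t - s0" using tr by (simp add: D_def y_def hdist_commute)
  have t0: "t \<ge> 0" using tr s0 \<rho> hdist_nonneg[OF origin_H3 x] by linarith
  have Dt: "D t \<ge> t - s0" using \<rho> s0 hdist_nonneg[OF x yH[of t]] by (simp add: D_def)
  have "continuous_on {0..t} D" unfolding D_def y_def
    by (intro continuous_intros continuous_on_hdist x) (use yH in \<open>auto simp: y_def\<close>)
  from IVT'[OF less_imp_le[OF D0] Dt t0 this]
  obtain lam where l: "0 \<le> lam" "D lam = t - s0" by blast
  have l0: "lam > 0" using l D0 by (cases "lam = 0") auto
  define t' where "t' = s0 + lam + \<rho>"
  have "hdist (y lam) y0 = lam + \<rho>" unfolding y_def w(2) by (rule hdist_opposite[OF w(1) l(1) \<rho>])
  hence "U t' (y lam) > 0"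
    by (intro cone_pos[OF y0 yH s0])
      (use l0 \<rho> out hdist_hpol[OF origin_H3 l(1)] U0 in \<open>auto simp: t'_def y_def \<rho>_def f_def Fp_pos\<close>)
  moreover have d: "t - t' = hdist x (y lam)" using l(2) by (simp add: D_def t'_def)
  ultimately show ?thesis
  proof (cases "hdist x (y lam) = 0")
    case True
    hence "x = y lam" "t = t'" using hdist_eq_0D[OF x yH[of lam]] d by auto
    thus ?thesis using \<open>U t' (y lam) > 0\<close> by metis
  next
    case False
    hence "t' < t" using d hdist_nonneg[OF x yH[of lam]] by linarith
    thus ?thesis
      by (intro cone_pos[OF yH[of lam] x])
        (use \<open>U t' (y lam) > 0\<close> d s0 l \<rho> tr out in \<open>auto simp: t'_def \<rho>_def f_def intro!: Fp_pos\<close>)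
  qed
qed

definition radial_lb :: "real \<Rightarrow> real \<Rightarrow> real \<Rightarrow> bool" where
  "radial_lb t r c \<longleftrightarrow> (\<forall>x\<in>H3. hdist origin x = r \<longrightarrow> c \<le> sinh r * U t x)"

lemma radial_lb_mono: "radial_lb t r c \<Longrightarrow> c' \<le> c \<Longrightarrow> radial_lb t r c'"
  by (force simp: radial_lb_def)

text \<open>At each emission time the shell gives \<open>h * len / 4\<close>; integrating over the
  emission times gives the area of the region times \<open>h / 4\<close>. All other times contribute
  nonnegatively. Since \<open>\<alpha>\<close> may move with \<open>s\<close>, the region can be a
  slanted parallelogram.\<close>

lemma radial_lb_propagate_source:
  assumes t: "t > r + R" and r: "r > 0" and s: "0 \<le> s1" "s1 \<le> s2" "s2 < t" and l: "len > 0" and h: "h \<ge> 0"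
    and \<alpha>: "\<And>s. s \<in> {s1..s2} \<Longrightarrow> 0 < \<alpha> s" "\<And>s. s \<in> {s1..s2} \<Longrightarrow> \<bar>r - (t - s)\<bar> \<le> \<alpha> s"
      "\<And>s. s \<in> {s1..s2} \<Longrightarrow> \<alpha> s + len \<le> r + (t - s)"
    and lb: "\<And>s y. s \<in> {s1..s2} \<Longrightarrow> y \<in> H3 \<Longrightarrow> \<alpha> s \<le> hdist origin y \<Longrightarrow>
      hdist origin y \<le> \<alpha> s + len \<Longrightarrow> h \<le> sinh (hdist origin y) * f s y"
  shows "radial_lb t r ((s2 - s1) * len * h / 4)"
  unfolding radial_lb_def
proof (intro ballI impI)
  fix x assume x: "x \<in> H3" and rx: "hdist origin x = r"
  have k: "h * len / 4 / sinh r \<le> wave_op (t - s) (f s) x" if "s \<in> {s1..s2}" for s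
  proof -
    have "h * len / 4 \<le> sinh (hdist origin x) * wave_op (t - s) (f s) x"
      by (rule wave_op_lower_shell[OF continuous_on_slice(1)[OF cf] f_nonneg x origin_H3, of _ "\<alpha> s"])
        (use that s l h \<alpha> lb rx in auto)
    thus ?thesis using r rx by (simp add: field_simps)
  qed
  have "(s2 - s1) * (h * len / 4 / sinh r) = integral {s1..s2} (\<lambda>s. h * len / 4 / sinh r)"
    using s by simp
  also have "\<dots> \<le> integral {s1..s2} (\<lambda>s. wave_op (t - s) (f s) x)"
    by (intro integral_le islice) (use k in auto)
  also have "\<dots> \<le> integral {0..t} (\<lambda>s. wave_op (t - s) (f s) x)"
    by (intro integral_subset_le islice) (use s wave_op_f_nonneg in auto)
  also have "\<dots> = U t x" using U_eq[OF x] rx t by simp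
  finally show "(s2 - s1) * len * h / 4 \<le> sinh r * U t x" using r by (simp add: field_simps)
qed

text \<open>\<open>Fp_mono\<close> and \<open>Fp_lower\<close> turn the bound \<open>c\<close> into
  a source bound. As \<open>sinh\<close> increases, controlling the potential at the outer radius of
  each shell controls it on the whole shell.\<close>

lemma radial_lb_propagate:
  assumes t: "t > r + R" and r: "r > 0" and s: "0 \<le> s1" "s1 \<le> s2" "s2 < t" and l: "len > 0"
    and c: "c > 0" and y: "y > 0"
    and \<alpha>: "\<And>s. s \<in> {s1..s2} \<Longrightarrow> 0 < \<alpha> s" "\<And>s. s \<in> {s1..s2} \<Longrightarrow> \<bar>r - (t - s)\<bar> \<le> \<alpha> s"
      "\<And>s. s \<in> {s1..s2} \<Longrightarrow> \<alpha> s + len \<le> r + (t - s)"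
    and cy: "\<And>s. s \<in> {s1..s2} \<Longrightarrow> sinh (\<alpha> s + len) \<le> c * sinh y"
    and lb: "\<And>s \<rho>. s \<in> {s1..s2} \<Longrightarrow> \<alpha> s \<le> \<rho> \<Longrightarrow> \<rho> \<le> \<alpha> s + len \<Longrightarrow> radial_lb s \<rho> c"
  shows "radial_lb t r ((s2 - s1) * len * (c * y powr (- (p - 1))) / 4)"
proof (rule radial_lb_propagate_source[OF t r s l _ \<alpha>])
  fix s z assume s: "s \<in> {s1..s2}" and z: "z \<in> H3" and d: "\<alpha> s \<le> hdist origin z" "hdist origin z \<le> \<alpha> s + len"
  let ?\<rho> = "hdist origin z"
  have sp: "sinh ?\<rho> > 0" using \<alpha>(1)[OF s] d by simp
  have "c \<le> sinh ?\<rho> * U s z" using lb[OF s d] z by (simp add: radial_lb_def)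
  hence "c / sinh ?\<rho> \<le> U s z" using sp by (simp add: field_simps)
  hence "Fp p (c / sinh ?\<rho>) \<le> f s z" unfolding f_def
    by (intro Fp_mono p(1)) (use c sp in auto)
  moreover have "sinh ?\<rho> \<le> c * sinh y" using cy[OF s] d sinh_real_le_iff[of ?\<rho> "\<alpha> s + len"] by linarith
  hence "c * y powr (- (p - 1)) \<le> sinh ?\<rho> * Fp p (c / sinh ?\<rho>)"
    by (intro Fp_lower p(1) c sp y)
  ultimately show "c * y powr (- (p - 1)) \<le> sinh ?\<rho> * f s z"
    using sp by (meson less_imp_le mult_left_mono order_trans)
qed (use c in auto)

end

section \<open>Growth and blow-up\<close>

text \<open>The quotient of the two hyperbolic sines decays like exp (- x / 4), faster than any
  power. So a power-type lower bound on \<open>sinh r * U\<close> allows a \<open>y\<close> of the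
  order of the time in \<open>Fp_lower\<close>.\<close>

lemma sinh_ratio_eventually:
  fixes c m :: real
  assumes c: "c > 0"
  shows "\<exists>K\<ge>1. \<forall>x\<ge>K. sinh (3/4 * x) \<le> c * x powr m * sinh x"
proof -
  define n where "n = nat \<lceil>\<bar>m\<bar>\<rceil>"
  have n: "- m \<le> real n" unfolding n_def by linarith
  have "((\<lambda>x::real. (x / 4) ^ n / exp (x / 4)) \<longlongrightarrow> 0) at_top"
    by (rule filterlim_compose[OF tendsto_power_div_exp_0])
      (rule filterlim_at_top_mult_tendsto_pos[of "\<lambda>_. 1/4" "1/4", simplified]; simp add: filterlim_ident)
  hence "\<forall>\<^sub>F x::real in at_top. (x / 4) ^ n / exp (x / 4) < c / (2 * 4 ^ n)"
    by (rule order_tendstoD(2)) (use c in simp)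
  then obtain K0 where K0: "\<And>x::real. x \<ge> K0 \<Longrightarrow> (x / 4) ^ n / exp (x / 4) < c / (2 * 4 ^ n)"
    unfolding eventually_at_top_linorder by blast
  show ?thesis
  proof (intro exI[of _ "max 1 K0"] conjI allI impI)
    fix x :: real assume "max 1 K0 \<le> x"
    hence x: "x \<ge> 1" "x \<ge> K0" by auto
    have "x powr (- m) \<le> x powr real n" by (rule powr_mono[OF n x(1)])
    also have "\<dots> = x ^ n" using x by (simp add: powr_realpow)
    finally have "2 * x powr (- m) \<le> 2 * x ^ n" by simp
    also have "\<dots> \<le> c * exp (x / 4)"
      using K0[OF x(2)] by (simp add: power_divide field_simps)
    finally have "2 \<le> c * exp (x / 4) * x powr m"
      using x by (simp add: powr_minus field_simps)
    hence 1: "2 * exp (3/4 * x) \<le> c * exp (x / 4) * x powr m * exp (3/4 * x)"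
      by (intro mult_right_mono) auto
    have e: "exp (x / 4) * exp (3/4 * x) = exp x" by (simp flip: exp_add)
    have 2: "2 * exp (3/4 * x) \<le> c * x powr m * exp x"
      using 1 unfolding e[symmetric] by (simp add: mult_ac)
    have "exp (- x) \<le> 1" using x by simp
    moreover have "exp x \<ge> 2" using exp_ge_add_one_self[of x] x by linarith
    moreover have "4 * sinh x = 2 * exp x - 2 * exp (- x)" by (simp add: sinh_field_def)
    ultimately have s: "exp x \<le> 4 * sinh x" by linarith
    have "sinh (3/4 * x) \<le> exp (3/4 * x) / 2" by (simp add: sinh_field_def)
    also have "\<dots> \<le> c * x powr m * exp x / 4" using 2 by simp
    also have "\<dots> \<le> c * x powr m * (4 * sinh x) / 4"
      using c s by (intro divide_right_mono mult_left_mono) auto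
    finally show "sinh (3/4 * x) \<le> c * x powr m * sinh x" by simp
  qed simp
qed

lemma powr_half_le:
  fixes k m :: real
  assumes "1/2 \<le> k" "k \<le> 1"
  shows "2 powr (- \<bar>m\<bar>) \<le> k powr m"
proof (cases "m \<ge> 0")
  case True
  have "2 powr (- m) = (1/2) powr m" by (simp add: powr_minus_divide powr_divide)
  also have "\<dots> \<le> k powr m" using True assms by (intro powr_mono2) auto
  finally show ?thesis using True by simp
next
  case False
  have "2 powr (- \<bar>m\<bar>) \<le> (1::real)" by (simp add: powr_le_one_le powr_minus inverse_le_1_iff ge_one_powr_ge_zero)
  also have "1 \<le> k powr m" using powr_mono'[of m 0 k] False assms by simp
  finally show ?thesis .
qed

context duhamel
begin

text \<open>\<open>\<xi>\<close> is the retarded time \<open>t - r\<close>. The factor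
  \<open>r\<close> records that the region of dependence narrows near the axis; at radii comparable
  with \<open>\<xi>\<close> it supplies an additional power of \<open>\<xi>\<close>.\<close>

definition growth :: "real \<Rightarrow> bool" where
  "growth m \<longleftrightarrow> (\<exists>c>0. \<exists>K. \<forall>\<xi>\<ge>K. \<forall>r\<in>{1..\<xi>}. radial_lb (\<xi> + r) r (c * r * \<xi> powr m))"

text \<open>On a compact piece of the positive cone \<open>U\<close> has a positive minimum.
  Radiation from the fixed shell between radii 1/2 and 1 travels along the outgoing cones, and
  \<open>sinh r * U\<close> keeps the same lower bound for every \<open>r\<close> \<ge> 1.\<close>

lemma strip_lower_bound:
  assumes pos: "\<And>t x. x \<in> H3 \<Longrightarrow> t > \<sigma>0 + hdist origin x \<Longrightarrow> U t x > 0" and \<sigma>0: "\<sigma>0 > R"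
  shows "\<exists>a>R. \<exists>c>0. \<forall>\<xi>\<in>{a..a+1/2}. \<forall>r\<ge>1. radial_lb (\<xi> + r) r c"
proof -
  define \<sigma> where "\<sigma> = \<sigma>0 + 2"
  define C where "C = (\<lambda>z. (fst z, hpol origin (fst (snd z)) (snd (snd z)))) ` ({\<sigma>..\<sigma>+1} \<times> {0..1} \<times> (sphere 0 1 :: (real ^ 3) set))"
  have cC: "compact C" unfolding C_def
    by (intro compact_continuous_image compact_Times compact_sphere compact_Icc continuous_intros)
  have "(axis 1 1 :: real ^ 3) \<in> sphere 0 1" by simp
  hence Cne: "C \<noteq> {}" unfolding C_def by fastforce
  obtain z where z: "z \<in> C" "\<And>z'. z' \<in> C \<Longrightarrow> (case z of (t, x) \<Rightarrow> U t x) \<le> (case z' of (t, x) \<Rightarrow> U t x)"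
    using continuous_attains_inf[OF cC Cne continuous_on_subset[OF cU subset_UNIV]] by blast
  define m where "m = (case z of (t, x) \<Rightarrow> U t x)"
  have m: "m > 0" using z(1) unfolding m_def C_def
    by (auto intro!: pos simp: hdist_hpol \<sigma>_def)
  have mU: "m \<le> U t x" if tx: "t \<in> {\<sigma>..\<sigma>+1}" "x \<in> H3" "hdist origin x \<le> 1" for t x
  proof -
    obtain w where "norm w = 1" "x = hpol origin (hdist origin x) w" using hpol_surj[OF origin_H3 tx(2)] by blast
    hence "(t, x) \<in> C" unfolding C_def
      using tx hdist_nonneg[OF origin_H3 tx(2)]
      by (intro image_eqI[of _ _ "(t, hdist origin x, w)"]) auto
    thus ?thesis using z(2)[of "(t, x)"] by (simp add: m_def)
  qed
  define c where "c = sinh (1/2) * m"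
  have c: "c > 0" using m by (simp add: c_def)
  \<comment> \<open>Chosen so that \<open>c * sinh y\<close> equals \<open>sinh 1\<close>, the value
    at the outer radius of the source shell.\<close>
  define y where "y = arsinh (sinh 1 / c)"
  have y: "y > 0" using c by (simp add: y_def)
  have cy: "c * sinh y = sinh 1" using c by (simp add: y_def)
  have lb: "radial_lb s \<rho> c" if "s \<in> {\<sigma>..\<sigma>+1}" "\<rho> \<in> {1/2..1}" for s \<rho>
    unfolding radial_lb_def
  proof (intro ballI impI)
    fix x assume x: "x \<in> H3" "hdist origin x = \<rho>"
    have "sinh (1/2) * m \<le> sinh \<rho> * U s x"
      using mU[OF that(1) x(1)] m that(2) x(2) by (intro mult_mono) auto
    thus "c \<le> sinh \<rho> * U s x" by (simp add: c_def)
  qed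
  have main: "radial_lb (\<xi> + r) r ((1/2) * (1/2) * (c * y powr (- (p - 1))) / 4)"
    if \<xi>: "\<xi> \<in> {\<sigma> + 1/2..\<sigma> + 1/2 + 1/2}" and r: "r \<ge> 1" for \<xi> r
  proof -
    have "radial_lb (\<xi> + r) r ((\<xi> - (\<xi> - 1/2)) * (1/2) * (c * y powr (- (p - 1))) / 4)"
    proof (rule radial_lb_propagate[where \<alpha> = "\<lambda>_. 1/2", OF _ _ _ _ _ _ c y])
      fix s \<rho> :: real assume "s \<in> {\<xi> - 1/2..\<xi>}" "1/2 \<le> \<rho>" "\<rho> \<le> 1/2 + 1/2"
      thus "radial_lb s \<rho> c" using \<xi> by (intro lb) auto
    qed (use \<xi> r \<sigma>0 R cy in \<open>auto simp: \<sigma>_def\<close>)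
    thus ?thesis by simp
  qed
  have "R < \<sigma> + 1/2" using \<sigma>0 by (simp add: \<sigma>_def)
  moreover have "(1/2) * (1/2) * (c * y powr (- (p - 1))) / 4 > 0" using c y by simp
  ultimately show ?thesis using main by blast
qed

text \<open>Integrate over the part of the strip \<open>a \<le> s - \<rho> \<le> a + 1/2\<close> in the domain of dependence.\<close>

lemma growth_start:
  assumes a: "a > R" and c: "c > 0" and lb: "\<And>\<xi> r. \<xi> \<in> {a..a+1/2} \<Longrightarrow> r \<ge> 1 \<Longrightarrow> radial_lb (\<xi> + r) r c"
  shows "growth (- (p - 1))"
proof -
  obtain K where K: "K \<ge> 1" "\<And>x. x \<ge> K \<Longrightarrow> sinh (3/4 * x) \<le> c * x powr 0 * sinh x"
    using sinh_ratio_eventually[OF c] by blast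
  have main: "radial_lb (\<xi> + r) r (c * 2 powr (- (p - 1)) / 16 * r * \<xi> powr (- (p - 1)))"
    if m: "max K (a + 5) \<le> \<xi>" and r: "r \<in> {1..\<xi>}" for \<xi> r
  proof -
    from m have \<xi>: "\<xi> \<ge> K" "\<xi> \<ge> a + 5" by auto
    have x0: "\<xi> > 0" using \<xi> a R by linarith
    have sh: "sinh (3/2 * \<xi>) \<le> c * sinh (2 * \<xi>)"
      using K(2)[of "2 * \<xi>"] \<xi> K(1) x0 by simp
    \<comment> \<open>At time \<open>s\<close> the strip is the shell from \<open>s - b\<close> to
      \<open>s - a\<close>. It lies in the interval of dependence exactly for \<open>s\<close>
      between \<open>(\<xi> + b) / 2\<close> and \<open>(\<xi> + 2 * r + a) / 2\<close>, an interval
      of length \<open>r - 1/4\<close>, which is at least \<open>r / 2\<close>.\<close>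
    define b where "b = a + 1/2"
    have L: "radial_lb (\<xi> + r) r (((\<xi> + 2 * r + a) / 2 - (\<xi> + b) / 2) * (1/2) * (c * (2 * \<xi>) powr (- (p - 1))) / 4)"
    proof (rule radial_lb_propagate[where \<alpha> = "\<lambda>s. s - b", OF _ _ _ _ _ _ c])
      fix s assume s: "s \<in> {(\<xi> + b) / 2..(\<xi> + 2 * r + a) / 2}"
      show "0 < s - b" using s \<xi> by (auto simp: b_def)
      show "\<bar>r - (\<xi> + r - s)\<bar> \<le> s - b" using s \<xi> by (auto simp: b_def abs_le_iff)
      show "s - b + 1/2 \<le> r + (\<xi> + r - s)" using s by (auto simp: b_def)
      have "s - b + 1/2 \<le> 3/2 * \<xi>" using s r a R by (auto simp: b_def)
      thus "sinh (s - b + 1/2) \<le> c * sinh (2 * \<xi>)"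
        using sh sinh_real_le_iff[of "s - b + 1/2" "3/2 * \<xi>"] by linarith
      fix \<rho> assume \<rho>: "s - b \<le> \<rho>" "\<rho> \<le> s - b + 1/2"
      have "radial_lb ((s - \<rho>) + \<rho>) \<rho> c"
        using s \<rho> \<xi> by (intro lb) (auto simp: b_def)
      thus "radial_lb s \<rho> c" by simp
    qed (use \<xi> r a R x0 in \<open>auto simp: b_def\<close>)
    show ?thesis
    proof (rule radial_lb_mono[OF L])
      have "c * 2 powr (- (p - 1)) / 16 * r * \<xi> powr (- (p - 1))
          = (r / 2) * ((1/2) * (c * (2 * \<xi>) powr (- (p - 1))) / 4)"
        using x0 by (simp add: powr_mult)
      also have "\<dots> \<le> ((\<xi> + 2 * r + a) / 2 - (\<xi> + b) / 2) * ((1/2) * (c * (2 * \<xi>) powr (- (p - 1))) / 4)"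
        using r c by (intro mult_right_mono) (auto simp: b_def field_simps)
      finally show "c * 2 powr (- (p - 1)) / 16 * r * \<xi> powr (- (p - 1))
        \<le> ((\<xi> + 2 * r + a) / 2 - (\<xi> + b) / 2) * (1/2) * (c * (2 * \<xi>) powr (- (p - 1))) / 4" by simp
    qed
  qed
  have "0 < c * 2 powr (- (p - 1)) / 16" using c by simp
  thus ?thesis unfolding growth_def using main by blast
qed

text \<open>The parallelogram \<open>13/16 \<xi> \<le> s \<le> 7/8 \<xi>\<close>, \<open>\<xi> \<le> s + \<rho> \<le> \<xi> + 2 r1\<close> lies in the domain of dependence and has area
  of order \<open>r \<xi>\<close>, while the potential is of order \<open>\<xi> powr (1 - p)\<close> there.\<close>

lemma growth_step:
  assumes "growth m"
  shows "growth (m + (3 - p))"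
proof -
  obtain c K where c: "c > 0" and K: "\<And>\<xi> r. \<xi> \<ge> K \<Longrightarrow> r \<in> {1..\<xi>} \<Longrightarrow> radial_lb (\<xi> + r) r (c * r * \<xi> powr m)"
    using assms unfolding growth_def by blast
  \<comment> \<open>On the source region the radius is at least \<open>\<xi> / 8\<close> and the
    retarded time lies between \<open>\<xi> / 2\<close> and \<open>\<xi>\<close>; these cost the
    factors \<open>1/8\<close> and \<open>2 powr (- \<bar>m\<bar>)\<close>.\<close>
  define d where "d = c / 8 * 2 powr (- \<bar>m\<bar>)"
  have d: "d > 0" using c by (simp add: d_def)
  obtain K1 where K1: "K1 \<ge> 1" "\<And>x. x \<ge> K1 \<Longrightarrow> sinh (3/4 * x) \<le> d * x powr (m + 1) * sinh x"
    using sinh_ratio_eventually[OF d] by blast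
  define K' where "K' = Max {2 * K, K1, 16, R + 1}"
  have main: "radial_lb (\<xi> + r) r (d / 512 * r * \<xi> powr (m + (3 - p)))"
    if k: "K' \<le> \<xi>" and r: "r \<in> {1..\<xi>}" for \<xi> r
  proof -
    from k have \<xi>: "\<xi> \<ge> 2 * K" "\<xi> \<ge> K1" "\<xi> \<ge> 16" "\<xi> \<ge> R + 1" by (auto simp: K'_def)
    \<comment> \<open>The cap keeps source radii below \<open>5/16 * \<xi>\<close>, so source times
      from \<open>13/16 * \<xi>\<close> on have retarded time at least \<open>\<xi> / 2\<close>.
      Since \<open>r \<le> \<xi>\<close>, it loses at most a factor 16.\<close>
    define r1 where "r1 = min r (\<xi> / 16)"
    have r1: "r1 > 0" "r1 \<le> r" "r1 \<le> \<xi> / 16" "r / 16 \<le> r1" using r \<xi> by (auto simp: r1_def)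
    define e where "e = d * \<xi> powr (m + 1)"
    have e: "e > 0" using d \<xi> by (simp add: e_def)
    have L: "radial_lb (\<xi> + r) r ((7/8 * \<xi> - 13/16 * \<xi>) * (2 * r1) * (e * \<xi> powr (- (p - 1))) / 4)"
    proof (rule radial_lb_propagate[where \<alpha> = "\<lambda>s. \<xi> - s", OF _ _ _ _ _ _ e])
      fix s assume s: "s \<in> {13/16 * \<xi>..7/8 * \<xi>}"
      show "0 < \<xi> - s" using s \<xi> by auto
      show "\<bar>r - (\<xi> + r - s)\<bar> \<le> \<xi> - s" using s \<xi> by auto
      show "\<xi> - s + 2 * r1 \<le> r + (\<xi> + r - s)" using r1 by auto
      have "\<xi> - s + 2 * r1 \<le> 3/4 * \<xi>" using s r1 \<xi> by auto
      thus "sinh (\<xi> - s + 2 * r1) \<le> e * sinh \<xi>"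
        using K1(2)[OF \<xi>(2)] sinh_real_le_iff[of "\<xi> - s + 2 * r1" "3/4 * \<xi>"] unfolding e_def by linarith
      fix \<rho> assume \<rho>: "\<xi> - s \<le> \<rho>" "\<rho> \<le> \<xi> - s + 2 * r1"
      define \<eta> where "\<eta> = s - \<rho>"
      have \<eta>: "\<xi> / 2 \<le> \<eta>" "\<eta> \<le> \<xi>" "\<rho> \<le> \<eta>" "1 \<le> \<rho>" "\<xi> / 8 \<le> \<rho>"
        using s \<rho> r1 \<xi> by (auto simp: \<eta>_def)
      have L: "radial_lb (\<eta> + \<rho>) \<rho> (c * \<rho> * \<eta> powr m)"
        by (rule K) (use \<eta> \<xi> in auto)
      have "\<eta> powr m = (\<eta> / \<xi>) powr m * \<xi> powr m"
        using \<eta> \<xi> by (simp add: powr_divide)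
      moreover have "2 powr (- \<bar>m\<bar>) \<le> (\<eta> / \<xi>) powr m"
        by (rule powr_half_le) (use \<eta> \<xi> in \<open>auto simp: field_simps\<close>)
      ultimately have k: "2 powr (- \<bar>m\<bar>) * \<xi> powr m \<le> \<eta> powr m" by (simp add: mult_right_mono)
      have "e = (c * (\<xi> / 8)) * (2 powr (- \<bar>m\<bar>) * \<xi> powr m)"
        using \<xi> by (simp add: e_def d_def powr_add)
      also have "\<dots> \<le> (c * \<rho>) * \<eta> powr m"
        by (intro mult_mono k) (use c \<eta> \<xi> in auto)
      finally have "radial_lb (\<eta> + \<rho>) \<rho> e" by (rule radial_lb_mono[OF L])
      thus "radial_lb s \<rho> e" by (simp add: \<eta>_def)
    qed (use \<xi> r r1 R in auto)
    show ?thesis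
    proof (rule radial_lb_mono[OF L])
      have "\<xi> powr (m + (3 - p)) = \<xi> powr (1 + (m + 1) + (- (p - 1)))" by (simp add: algebra_simps)
      also have "\<dots> = \<xi> * \<xi> powr (m + 1) * \<xi> powr (- (p - 1))" using \<xi> by (simp only: powr_add powr_one)
      finally have x: "\<xi> powr (m + (3 - p)) = \<xi> * \<xi> powr (m + 1) * \<xi> powr (- (p - 1))" .
      have "d / 512 * r * \<xi> powr (m + (3 - p)) = (\<xi> / 16) * (2 * (r / 16)) * (e * \<xi> powr (- (p - 1))) / 4"
        unfolding x e_def by (simp add: field_simps)
      also have "\<dots> \<le> (\<xi> / 16) * (2 * r1) * (e * \<xi> powr (- (p - 1))) / 4"
        using r1 \<xi> e by (intro divide_right_mono mult_right_mono mult_left_mono) auto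
      finally show "d / 512 * r * \<xi> powr (m + (3 - p)) \<le> (7/8 * \<xi> - 13/16 * \<xi>) * (2 * r1) * (e * \<xi> powr (- (p - 1))) / 4"
        by simp
    qed
  qed
  have "d / 512 > 0" using d by simp
  thus ?thesis unfolding growth_def using main by blast
qed

text \<open>Here \<open>p < 3\<close> is decisive: every step raises the exponent by the same
  positive amount \<open>3 - p\<close>.\<close>

lemma growth_unbounded:
  assumes "growth m"
  shows "\<exists>m'\<ge>1. growth m'"
proof -
  have g: "growth (m + real n * (3 - p))" for n
  proof (induction n)
    case (Suc n)
    thus ?case using growth_step[OF Suc] by (simp add: algebra_simps)
  qed (use assms in simp)
  obtain n where "1 - m < real n * (3 - p)" using reals_Archimedean3[of "3 - p"] p(2) by auto
  thus ?thesis using g[of n] by (intro exI[of _ "m + real n * (3 - p)"]) auto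
qed

section \<open>Blow-up on a bounded range of radii\<close>

lemma large_on_rectangle:
  assumes g: "growth m" and m: "m \<ge> 1"
  shows "\<exists>T>R+2. \<forall>t\<in>{T..T+1}. \<forall>r\<in>{1..2}. radial_lb t r A"
proof -
  obtain c K where c: "c > 0" and K: "\<And>\<xi> r. \<xi> \<ge> K \<Longrightarrow> r \<in> {1..\<xi>} \<Longrightarrow> radial_lb (\<xi> + r) r (c * r * \<xi> powr m)"
    using g unfolding growth_def by blast
  define T where "T = Max {K, 2, A / c, R + 1} + 2"
  have T: "T - 2 \<ge> K" "T - 2 \<ge> 2" "T - 2 \<ge> A / c" "T - 2 \<ge> R + 1" by (auto simp: T_def)
  show ?thesis
  proof (intro exI[of _ T] conjI ballI)
    fix t r :: real assume t: "t \<in> {T..T+1}" and r: "r \<in> {1..2}"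
    define \<xi> where "\<xi> = t - r"
    have \<xi>: "\<xi> \<ge> T - 2" using t r by (auto simp: \<xi>_def)
    have L: "radial_lb (\<xi> + r) r (c * r * \<xi> powr m)" by (rule K) (use \<xi> T r in auto)
    have "A / c \<le> \<xi>" using \<xi> T(3) by linarith
    hence "A \<le> c * \<xi>" using c by (simp add: pos_divide_le_eq mult.commute)
    also have "\<dots> = c * 1 * \<xi> powr 1" using \<xi> T by simp
    also have "\<dots> \<le> c * r * \<xi> powr m"
      using r c \<xi> T m by (intro mult_mono powr_mono) auto
    finally show "radial_lb t r A" using radial_lb_mono[OF L] by (simp add: \<xi>_def)
  qed (use T in simp)
qed

text \<open>Radii stay between 1 and 2, so the step can be repeated. A bound \<open>A\<close>
  becomes a multiple of \<open>A powr p\<close>, at the price of the area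
  \<open>\<delta> * \<delta>\<close> of the source region; \<open>sinh 2\<close> accounts for the
  largest radius.\<close>

lemma doubling_step:
  assumes T: "T > R + 2" and A: "A > 0" and \<tau>: "T \<le> \<tau>" "\<tau> + 2 * \<delta> \<le> T + 1" and \<delta>: "0 < \<delta>" "\<delta> \<le> 1/4"
    and lb: "\<And>t r. t \<in> {\<tau>..T+1} \<Longrightarrow> r \<in> {1..2} \<Longrightarrow> radial_lb t r A"
    and t: "t \<in> {\<tau> + 2 * \<delta>..T+1}" and r: "r \<in> {1..2}"
  shows "radial_lb t r (\<delta> * \<delta> * (A powr p * sinh 2 powr (1 - p)) / 4)"
proof -
  \<comment> \<open>The shell is attached to \<open>r\<close> from above or from below so as not to
    leave the radii between 1 and 2. As \<open>t - s\<close> is at least \<open>\<delta>\<close>,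
    both choices lie in the interval of dependence.\<close>
  define \<alpha> where "\<alpha> = (if r \<le> 3/2 then r else r - \<delta>)"
  have \<alpha>: "1 \<le> \<alpha>" "\<alpha> + \<delta> \<le> 2" "\<alpha> \<le> r" "r - \<delta> \<le> \<alpha>" "\<alpha> + \<delta> \<le> r + \<delta>" using r \<delta> by (auto simp: \<alpha>_def)
  have "radial_lb t r ((\<tau> + \<delta> - \<tau>) * \<delta> * (A powr p * sinh 2 powr (1 - p)) / 4)"
  proof (rule radial_lb_propagate_source[where \<alpha> = "\<lambda>_. \<alpha>"])
    fix s y assume s: "s \<in> {\<tau>..\<tau> + \<delta>}" and y: "y \<in> H3" and d: "\<alpha> \<le> hdist origin y" "hdist origin y \<le> \<alpha> + \<delta>"
    let ?\<rho> = "hdist origin y"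
    have \<rho>: "1 \<le> ?\<rho>" "?\<rho> \<le> 2" using d \<alpha> by auto
    hence sp: "sinh ?\<rho> > 0" by simp
    have "A \<le> sinh ?\<rho> * U s y" using lb[of s ?\<rho>] s y \<rho> \<tau> \<delta> by (auto simp: radial_lb_def)
    hence "A / sinh ?\<rho> \<le> U s y" using sp by (simp add: field_simps)
    hence "Fp p (A / sinh ?\<rho>) \<le> f s y" unfolding f_def by (intro Fp_mono p(1)) (use A sp in auto)
    hence "(A / sinh ?\<rho>) powr p \<le> f s y" using Fp_ge_powr[OF p(1), of "A / sinh ?\<rho>"] A sp by simp
    hence "sinh ?\<rho> * (A / sinh ?\<rho>) powr p \<le> sinh ?\<rho> * f s y" using sp by simp
    moreover have "sinh ?\<rho> * (A / sinh ?\<rho>) powr p = A powr p * sinh ?\<rho> powr (1 - p)"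
      using sp A by (simp add: powr_divide powr_diff)
    moreover have "sinh 2 powr (1 - p) \<le> sinh ?\<rho> powr (1 - p)"
      using sp \<rho> p by (intro powr_mono2') auto
    hence "A powr p * sinh 2 powr (1 - p) \<le> A powr p * sinh ?\<rho> powr (1 - p)" by (rule mult_left_mono) simp
    ultimately show "A powr p * sinh 2 powr (1 - p) \<le> sinh ?\<rho> * f s y" by linarith
  next
    fix s assume s: "s \<in> {\<tau>..\<tau> + \<delta>}"
    hence ts: "\<delta> \<le> t - s" "t - s \<le> 1" using t \<tau> by auto
    show "\<bar>r - (t - s)\<bar> \<le> \<alpha>" "\<alpha> + \<delta> \<le> r + (t - s)" using ts \<alpha> r by (auto simp: abs_le_iff)
  qed (use T \<tau> \<delta> t r R \<alpha> in auto)
  thus ?thesis by simp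
qed

text \<open>Each application of \<open>doubling_step\<close> halves the time left until \<open>T + 1\<close>; the condition \<open>lam powr (p - 1) = 4\<close>
  compensates the resulting factor \<open>1/4\<close> in the new lower bound.\<close>

lemma no_unbounded_growth:
  assumes g: "growth m" and m: "m \<ge> 1"
  shows False
proof -
  define lam where "lam = 4 powr (1 / (p - 1))"
  define \<kappa> where "\<kappa> = sinh (2::real) powr (1 - p)"
  \<comment> \<open>Makes \<open>A powr (p - 1) * \<kappa>\<close> equal to \<open>64 * lam\<close>.
    The factor 64 cancels the 16 from \<open>\<delta> * \<delta> * 4 ^ n = 1/16\<close> and the 4 of
    \<open>doubling_step\<close>, leaving a gain of exactly \<open>lam\<close>.\<close>
  define A where "A = (64 * lam / \<kappa>) powr (1 / (p - 1))"
  have l: "lam > 1" "lam powr (p - 1) = 4" using p by (auto simp: lam_def powr_powr)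
  have \<kappa>: "\<kappa> > 0" by (simp add: \<kappa>_def)
  have A: "A > 0" "A powr (p - 1) = 64 * lam / \<kappa>" using p l \<kappa> by (auto simp: A_def powr_powr)
  obtain T where T: "T > R + 2" "\<And>t r. t \<in> {T..T+1} \<Longrightarrow> r \<in> {1..2} \<Longrightarrow> radial_lb t r A"
    using large_on_rectangle[OF g m] by blast
  have it: "\<forall>t\<in>{T + 1 - (1/2)^n..T+1}. \<forall>r\<in>{1..2}. radial_lb t r (A * lam ^ n)" for n
  proof (induction n)
    case 0
    thus ?case using T by simp
  next
    case (Suc n)
    show ?case
    proof (intro ballI)
      fix t r assume t: "t \<in> {T + 1 - (1/2) ^ Suc n..T+1}" and r: "r \<in> {1..2::real}"
      define \<delta> where "\<delta> = (1/2::real) ^ n / 4"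
      have h: "(1/2::real) ^ n \<le> 1" by (simp add: power_le_one)
      have An: "A * lam ^ n > 0" using A l by simp
      have L: "radial_lb t r (\<delta> * \<delta> * ((A * lam ^ n) powr p * sinh 2 powr (1 - p)) / 4)"
        by (rule doubling_step[where \<tau> = "T + 1 - (1/2)^n", OF T(1) An])
          (use Suc t r h in \<open>auto simp: \<delta>_def\<close>)
      have "(A * lam ^ n) powr p = (A * lam ^ n) powr (1 + (p - 1))" by simp
      also have "\<dots> = (A * lam ^ n) powr 1 * (A * lam ^ n) powr (p - 1)" by (rule powr_add)
      also have "(A * lam ^ n) powr (p - 1) = 64 * lam / \<kappa> * 4 ^ n"
      proof -
        have "(lam ^ n) powr (p - 1) = (lam powr real n) powr (p - 1)" using l by (simp add: powr_realpow)
        also have "\<dots> = (lam powr (p - 1)) powr real n" by (simp only: powr_powr mult.commute)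
        also have "\<dots> = 4 ^ n" unfolding l(2) by (simp add: powr_realpow)
        finally show ?thesis using A l by (simp add: powr_mult)
      qed
      finally have P: "(A * lam ^ n) powr p = A * lam ^ n * (64 * lam / \<kappa> * 4 ^ n)" using An by simp
      have "\<delta> * \<delta> * 4 ^ n = 1/16" by (simp add: \<delta>_def power_mult_distrib[symmetric] flip: power_mult_distrib)
      hence "\<delta> * \<delta> * ((A * lam ^ n) powr p * sinh 2 powr (1 - p)) / 4 = A * lam ^ Suc n"
        unfolding P \<kappa>_def[symmetric] using \<kappa> by (simp add: field_simps)
      thus "radial_lb t r (A * lam ^ Suc n)" using L by simp
    qed
  qed
  define x where "x = hpol origin 1 (axis 1 1)"
  have x: "x \<in> H3" "hdist origin x = 1" by (auto simp: x_def hdist_hpol)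
  \<comment> \<open>The time \<open>T + 1\<close> belongs to every interval of the iteration, so one
    finite value of \<open>U\<close> would have to exceed all powers of \<open>lam\<close>.\<close>
  have ub: "A * lam ^ n \<le> sinh 1 * U (T + 1) x" for n
    using it[of n] x by (auto simp: radial_lb_def)
  obtain n where "sinh 1 * U (T + 1) x / A < lam ^ n" using real_arch_pow[OF l(1)] by blast
  thus False using ub[of n] A by (simp add: field_simps)
qed

lemma solution_zero:
  assumes t: "t \<ge> 0" and x: "x \<in> H3"
  shows "U t x = 0"
proof (rule backward_uniqueness[OF _ t x], rule ccontr)
  fix s y assume s: "s \<ge> 0" and y: "y \<in> H3" and out: "s + hdist origin y > R" and "U s y \<noteq> 0"
  note pos = solid_cone_pos[OF y s \<open>U s y \<noteq> 0\<close> out]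
  obtain a c where a: "a > R" "c > 0" "\<forall>\<xi>\<in>{a..a+1/2}. \<forall>r\<ge>1. radial_lb (\<xi> + r) r c"
    using strip_lower_bound[OF pos out] by blast
  have "growth (- (p - 1))" by (rule growth_start[OF a(1,2)]) (use a(3) in blast)
  then obtain m where "m \<ge> 1" "growth m" using growth_unbounded by blast
  thus False using no_unbounded_growth by blast
qed

end

section \<open>From weak solutions to the Duhamel equation\<close>

text \<open>\<open>mink_hpol\<close> is the hyperbolic law of cosines at the vertex
  \<open>y\<close>; Cauchy-Schwarz bounds its angular term, and what remains is the addition formula
  for \<open>cosh\<close>.\<close>

lemma hdist_triangle:
  assumes x: "x \<in> H3" and y: "y \<in> H3" and z: "z \<in> H3"
  shows "hdist x z \<le> hdist x y + hdist y z"
proof -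
  obtain w where w: "norm w = 1" "z = hpol y (hdist y z) w" using hpol_surj[OF y z] by blast
  have s: "norm (zonal_dir x y) = sinh (hdist x y)"
    using norm_zonal_dir[OF x y] cosh_hdist[OF x y] mink_H3_le[OF x y]
    by (simp add: hdist_def sinh_arcosh_real)
  have "- (zonal_dir x y \<bullet> w) \<le> sinh (hdist x y)"
    using Cauchy_Schwarz_ineq2[of "zonal_dir x y" w] s w(1) by simp
  hence "sinh (hdist y z) * - (zonal_dir x y \<bullet> w) \<le> sinh (hdist y z) * sinh (hdist x y)"
    using y z by (intro mult_left_mono) auto
  hence "- mink x z \<le> cosh (hdist x y + hdist y z)"
    by (subst w(2), subst mink_hpol[OF y]) (simp add: cosh_add cosh_hdist[OF x y] mult.commute)
  hence "cosh (hdist x z) \<le> cosh (hdist x y + hdist y z)" using cosh_hdist[OF x z] by simp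
  thus ?thesis using x y z by (subst (asm) cosh_real_nonneg_le_iff) auto
qed

text \<open>The time coordinate of a point is the hyperbolic cosine of its distance to the origin,
  so a Euclidean bound on the support bounds the hyperbolic distance.\<close>

lemma Cc_H3_support:
  assumes "Cc_H3 g"
  shows "\<exists>R. \<forall>x\<in>H3. hdist origin x > R \<longrightarrow> g x = 0"
proof -
  have "bounded (closure {x \<in> H3. g x \<noteq> 0})"
    using assms by (simp add: Cc_H3_def compact_imp_bounded)
  hence "bounded {x \<in> H3. g x \<noteq> 0}" by (rule bounded_subset[OF _ closure_subset])
  then obtain b where b: "\<And>x. x \<in> H3 \<Longrightarrow> g x \<noteq> 0 \<Longrightarrow> norm x \<le> b" unfolding bounded_iff by blast
  have "g x = 0" if x: "x \<in> H3" "hdist origin x > b" for x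
  proof (rule ccontr)
    assume "g x \<noteq> 0"
    hence "norm x \<le> b" using b x by blast
    moreover have "fst x \<le> norm x" using norm_fst_le[of "fst x" "snd x"] by simp
    moreover have "fst x = cosh (hdist origin x)" using cosh_hdist[OF origin_H3 x(1)] by (simp add: mink_def origin_def)
    moreover have "hdist origin x \<le> sinh (hdist origin x)"
      using real_le_x_sinh[of "hdist origin x"] x by (simp add: sinh_field_def exp_minus)
    moreover have "sinh (hdist origin x) \<le> cosh (hdist origin x)" by (rule sinh_le_cosh_real)
    ultimately show False using x(2) by linarith
  qed
  thus ?thesis by blast
qed

text \<open>By the triangle inequality a sphere of such a large radius about \<open>x\<close> misses
  the ball containing the support.\<close>

lemma Huygens:
  assumes g: "\<And>x. x \<in> H3 \<Longrightarrow> hdist origin x > R \<Longrightarrow> g x = 0" and x: "x \<in> H3"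
    and t: "t > hdist origin x + R" "t \<ge> 0" and w: "norm w = 1"
  shows "extend g (hpol x t w) = 0"
proof -
  have y: "hpol x t w \<in> H3" using x w by simp
  have "t = hdist x (hpol x t w)" using hdist_hpol[OF x t(2)] by simp
  also have "\<dots> \<le> hdist x origin + hdist origin (hpol x t w)" by (rule hdist_triangle[OF x origin_H3 y])
  finally show ?thesis using g[OF y] t y by (simp add: hdist_commute)
qed

lemma integral_reverse:
  fixes g :: "real \<Rightarrow> real"
  assumes "continuous_on UNIV g" "t \<ge> 0"
  shows "integral {0..t} (\<lambda>s. g (t - s)) = integral {0..t} g"
proof -
  obtain A where A: "(A has_real_derivative g s) (at s)" for s
    using antiderivative_exists[OF assms(1)] by blast
  have "((\<lambda>s. - A (t - s)) has_real_derivative g (t - s)) (at s)" for s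
  proof -
    have "((\<lambda>s. A (t - s)) has_real_derivative - g (t - s)) (at s)"
      by (rule DERIV_comp[OF A, where g' = "-1"]) (auto intro!: derivative_eq_intros)
    from DERIV_minus[OF this] show ?thesis by simp
  qed
  from integral_FTC[OF this assms(2)] integral_FTC[OF A assms(2)] show ?thesis by simp
qed

lemma weak_solution_duhamel:
  assumes p: "1 < p" "p < 3" and u0: "C1_H3 u0" "Cc_H3 u0" and u1: "Cc_H3 u1"
    and u: "global_weak_solution p \<epsilon> u0 u1 u"
  obtains R d where "duhamel p R (\<lambda>t y. u (max 0 t) (hchart (snd y))) (\<lambda>t x. \<epsilon> * (d t x + wave_op t (extend u1) x))"
    "\<And>t x. ((\<lambda>t. sinh t * sph_avg (\<lambda>w. extend u0 (hpol x t w))) has_real_derivative d t x) (at t)"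
    "\<And>x. x \<in> H3 \<Longrightarrow> d 0 x = u0 x"
proof -
  obtain d where cd: "continuous_on UNIV (\<lambda>(t, x). d t x)" and
    d: "\<And>t x. ((\<lambda>t. sinh t * sph_avg (\<lambda>w. extend u0 (hpol x t w))) has_real_derivative d t x) (at t)" and
    d0: "\<And>x. x \<in> H3 \<Longrightarrow> d 0 x = u0 x"
    using C1_wave_op_derivative[OF u0(1)] by blast
  have c0: "continuous_on H3 u0" and c1: "continuous_on H3 u1" using u0 u1 by (auto simp: Cc_H3_def)
  have cu: "continuous_on ({0..} \<times> H3) (\<lambda>(t, x). u t x)" using u by (simp add: weak_solution_def)
  obtain R0 R1 where R01: "\<And>x. x \<in> H3 \<Longrightarrow> hdist origin x > R0 \<Longrightarrow> u0 x = 0"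
    "\<And>x. x \<in> H3 \<Longrightarrow> hdist origin x > R1 \<Longrightarrow> u1 x = 0"
    using Cc_H3_support[OF u0(2)] Cc_H3_support[OF u1] by blast
  define R where "R = max 1 (max R0 R1)"
  have R: "R > 0" "\<And>x. x \<in> H3 \<Longrightarrow> hdist origin x > R \<Longrightarrow> u0 x = 0"
    "\<And>x. x \<in> H3 \<Longrightarrow> hdist origin x > R \<Longrightarrow> u1 x = 0"
    using R01 by (auto simp: R_def)
  define U where "U t y = u (max 0 t) (hchart (snd y))" for t and y :: mpoint
  have cU: "continuous_on UNIV (\<lambda>(t, x). U t x)"
  proof -
    have "continuous_on UNIV (\<lambda>z :: real \<times> mpoint. (max 0 (fst z), hchart (snd (snd z))))"
      by (intro continuous_intros)
    moreover have "range (\<lambda>z :: real \<times> mpoint. (max 0 (fst z), hchart (snd (snd z)))) \<subseteq> {0..} \<times> H3"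
      by auto
    ultimately show ?thesis
      using continuous_on_compose2[OF cu] by (fastforce simp: U_def case_prod_unfold)
  qed
  have cF: "continuous_on UNIV (\<lambda>(t, x). Fp p (U t x))"
    using continuous_on_UNIV_comp[OF continuous_on_Fp[OF p(1)] cU] by (simp add: case_prod_unfold)
  have "duhamel p R U (\<lambda>t x. \<epsilon> * (d t x + wave_op t (extend u1) x))"
  proof
    show "homogeneous (\<lambda>t x. \<epsilon> * (d t x + wave_op t (extend u1) x))"
      by (intro homogeneous_cmult homogeneous_add homogeneous_wave_op continuous_on_extend c1
          homogeneous_derivative[OF continuous_on_extend[OF c0] cd d])
    fix t x assume x: "x \<in> H3"
    {
      assume t: "(0::real) \<le> t"
      have "((\<lambda>s. hwave s x u0) has_vector_derivative d t x) (at t within {0..})"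
      proof (rule has_vector_derivative_transform)
        show "((\<lambda>t. sinh t * sph_avg (\<lambda>w. extend u0 (hpol x t w))) has_vector_derivative d t x) (at t within {0..})"
          using d has_real_derivative_iff_has_vector_derivative has_vector_derivative_at_within by blast
      qed (use t in \<open>auto simp: hwave_eq[OF x _ c0] wave_op_def\<close>)
      \<comment> \<open>\<open>vector_derivative\<close> is defined by choice; it equals
        \<open>d t x\<close> because derivatives within the half-line are unique, also at its
        endpoint 0.\<close>
      moreover have "at t within {0..} \<noteq> bot"
      proof
        assume "at t within {0..} = bot"
        moreover have "at_right t \<le> at t within {0..}" by (rule at_le) (use t in auto)
        ultimately show False using trivial_limit_at_right_real[of t] by (simp add: bot_unique)
      qed
      ultimately have D: "vector_derivative (\<lambda>s. hwave s x u0) (at t within {0..}) = d t x"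
        by (simp add: vector_derivative_within)
      have I: "integral {0..t} (\<lambda>\<tau>. hwave \<tau> x (\<lambda>y. Fp p (u (t - \<tau>) y)))
          = integral {0..t} (\<lambda>s. wave_op (t - s) (\<lambda>y. Fp p (U s y)) x)"
      proof -
        have "integral {0..t} (\<lambda>\<tau>. hwave \<tau> x (\<lambda>y. Fp p (u (t - \<tau>) y)))
          = integral {0..t} (\<lambda>\<tau>. wave_op \<tau> (\<lambda>y. Fp p (U (t - \<tau>) y)) x)"
        proof (rule integral_cong)
          fix \<tau> assume \<tau>: "\<tau> \<in> {0..t}"
          have "continuous_on H3 (\<lambda>y. (t - \<tau>, y))" by (intro continuous_intros)
          hence "continuous_on H3 (\<lambda>y. u (t - \<tau>) y)"
            using continuous_on_compose2[OF cu, of H3 "\<lambda>y. (t - \<tau>, y)"] \<tau> by force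
          hence "continuous_on H3 (\<lambda>y. Fp p (u (t - \<tau>) y))"
            by (rule continuous_on_UNIV_comp[OF continuous_on_Fp[OF p(1)]])
          moreover have "extend (\<lambda>y. Fp p (u (t - \<tau>) y)) = (\<lambda>y. Fp p (U (t - \<tau>) y))"
            using \<tau> by (simp add: extend_def[abs_def] U_def)
          ultimately show "hwave \<tau> x (\<lambda>y. Fp p (u (t - \<tau>) y)) = wave_op \<tau> (\<lambda>y. Fp p (U (t - \<tau>) y)) x"
            using hwave_eq[OF x] \<tau> by simp
        qed
        also have "\<dots> = integral {0..t} (\<lambda>s. wave_op (t - s) (\<lambda>y. Fp p (U (t - (t - s)) y)) x)"
        proof (rule integral_reverse[symmetric, OF _ t])
          show "continuous_on UNIV (\<lambda>\<tau>. wave_op \<tau> (\<lambda>y. Fp p (U (t - \<tau>) y)) x)"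
            by (rule continuous_on_wave_op_family[OF cF, where T = "\<lambda>\<tau>. \<tau>" and s = "\<lambda>\<tau>. t - \<tau>" and X = "\<lambda>_. x"])
              (auto intro: continuous_intros)
        qed
        finally show ?thesis by simp
      qed
      have "u t x = \<epsilon> * (vector_derivative (\<lambda>s. hwave s x u0) (at t within {0..}) + hwave t x u1)
              + integral {0..t} (\<lambda>\<tau>. hwave \<tau> x (\<lambda>y. Fp p (u (t - \<tau>) y)))"
        using u t x unfolding weak_solution_def by auto
      moreover have "U t x = u t x" using t x by (simp add: U_def hchart_snd)
      ultimately show "U t x = \<epsilon> * (d t x + wave_op t (extend u1) x)
          + integral {0..t} (\<lambda>s. wave_op (t - s) (\<lambda>y. Fp p (U s y)) x)"
        unfolding D I hwave_eq[OF x t c1] by simp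
    }
    assume t: "hdist origin x + R < t"
    have pos: "hdist origin x + R > 0" using R(1) hdist_nonneg[OF origin_H3 x] by linarith
    have "wave_op t (extend u1) x = wave_op t (\<lambda>_. 0) x" unfolding wave_op_def
      using t pos by (intro arg_cong2[of _ _ _ _ times] sph_avg_cong refl)
        (simp add: Huygens[OF R(3) x])
    moreover have "d t x = 0"
    \<comment> \<open>Huygens' principle makes the mean vanish on an open set of times, hence also
      its time derivative.\<close>
    proof (rule DERIV_unique[OF d])
      have z: "sinh s * sph_avg (\<lambda>w. extend u0 (hpol x s w)) = 0" if "s \<in> {hdist origin x + R<..}" for s
      proof -
        have "sph_avg (\<lambda>w. extend u0 (hpol x s w)) = sph_avg (\<lambda>_. 0)"
          using that pos by (intro sph_avg_cong Huygens[OF R(2) x]) auto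
        thus ?thesis by simp
      qed
      show "((\<lambda>t. sinh t * sph_avg (\<lambda>w. extend u0 (hpol x t w))) has_real_derivative 0) (at t)"
        by (rule has_field_derivative_transform_within_open[of "\<lambda>_. 0" 0 t "{hdist origin x + R<..}"])
          (use t z in auto)
    qed
    ultimately show "\<epsilon> * (d t x + wave_op t (extend u1) x) = 0" by simp
  qed (use p R cU in auto)
  thus ?thesis using that d d0 unfolding U_def by blast
qed

lemma global_weak_solution_zero:
  assumes "1 < p" "p < 3" "C1_H3 u0" "Cc_H3 u0" "Cc_H3 u1" "global_weak_solution p \<epsilon> u0 u1 u"
    and t: "t \<ge> 0" and x: "x \<in> H3"
  shows "u t x = 0"
proof -
  obtain R d where "duhamel p R (\<lambda>t y. u (max 0 t) (hchart (snd y))) (\<lambda>t x. \<epsilon> * (d t x + wave_op t (extend u1) x))"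
    by (rule weak_solution_duhamel[OF assms(1-6)]) (rule that)
  from duhamel.solution_zero[OF this t x] show ?thesis using t x by (simp add: hchart_snd)
qed

text \<open>With \<open>u = 0\<close> the equation says that the free wave of the data vanishes. Its
  value at time 0 is \<open>u0\<close>; then only the wave of \<open>u1\<close> is left, and
  dividing by \<open>sinh t\<close> and letting \<open>t\<close> tend to 0 recovers
  \<open>u1\<close>.\<close>

lemma global_weak_solution_data_zero:
  assumes a: "1 < p" "p < 3" "C1_H3 u0" "Cc_H3 u0" "Cc_H3 u1" "global_weak_solution p \<epsilon> u0 u1 u"
    and \<epsilon>: "\<epsilon> > 0" and x: "x \<in> H3"
  shows "u0 x = 0 \<and> u1 x = 0"
proof -
  obtain R d where D: "duhamel p R (\<lambda>t y. u (max 0 t) (hchart (snd y))) (\<lambda>t x. \<epsilon> * (d t x + wave_op t (extend u1) x))"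
    and d: "\<And>t x. ((\<lambda>t. sinh t * sph_avg (\<lambda>w. extend u0 (hpol x t w))) has_real_derivative d t x) (at t)"
    and d0: "\<And>x. x \<in> H3 \<Longrightarrow> d 0 x = u0 x"
    by (rule weak_solution_duhamel[OF a]) (rule that)
  have u: "u s y = 0" if "s \<ge> 0" "y \<in> H3" for s y
    by (rule global_weak_solution_zero[OF a that])
  have L: "d t x + wave_op t (extend u1) x = 0" if t: "t \<ge> 0" and x: "x \<in> H3" for t x
  proof -
    have "u (max 0 s) (hchart (snd y)) = 0" for s and y :: mpoint by (rule u) auto
    thus ?thesis using duhamel.eq[OF D t x] \<epsilon> by simp
  qed
  have u0: "u0 x = 0" if "x \<in> H3" for x using L[of 0 x] d0[OF that] that by simp
  have "sph_avg (\<lambda>w. extend u0 (hpol x t w)) = sph_avg (\<lambda>_. 0)" for t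
    by (rule sph_avg_cong) (use x u0 in simp)
  hence "((\<lambda>t. sinh t * sph_avg (\<lambda>w. extend u0 (hpol x t w))) has_real_derivative 0) (at t)" for t by simp
  hence "d t x = 0" for t using DERIV_unique[OF d] by blast
  hence w0: "wave_op t (extend u1) x = 0" if "t \<ge> 0" for t using L[OF that x] by simp
  have c1: "continuous_on UNIV (extend u1)" using a(5) by (intro continuous_on_extend) (simp add: Cc_H3_def)
  let ?m = "\<lambda>t. sph_avg (\<lambda>w. extend u1 (hpol x t w))"
  have "continuous_on UNIV ?m"
    by (rule continuous_on_sph_avg)
      (auto simp: case_prod_unfold intro!: continuous_on_UNIV_comp[OF c1] continuous_intros)
  hence "continuous_on (closure {0<..<1::real}) ?m" by (rule continuous_on_subset) simp
  moreover have "?m t = 0" if "t \<in> {0<..<1}" for t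
    using w0[of t] that by (simp add: wave_op_def)
  ultimately have "?m 0 = 0"
    by (rule continuous_constant_on_closure) (auto simp: closure_greaterThanLessThan)
  thus ?thesis using u0 x by simp
qed

theorem theorem1p2:
  fixes p :: real
  assumes "1 < p" and "p < 3"
  shows "(\<forall>\<epsilon> u0 u1 u. \<epsilon> > 0 \<and> C1_H3 u0 \<and> Cc_H3 u0 \<and> Cc_H3 u1 \<and> global_weak_solution p \<epsilon> u0 u1 u
            \<longrightarrow> (\<forall>t\<ge>0. \<forall>x\<in>H3. u t x = 0))
       \<and> (\<forall>\<epsilon> u0 u1. \<epsilon> > 0 \<and> C1_H3 u0 \<and> Cc_H3 u0 \<and> Cc_H3 u1 \<and> (\<exists>x\<in>H3. u0 x \<noteq> 0 \<or> u1 x \<noteq> 0)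
            \<longrightarrow> (\<nexists>u. global_weak_solution p \<epsilon> u0 u1 u))"
  using global_weak_solution_zero[OF assms] global_weak_solution_data_zero[OF assms] by blast

end
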